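(* Let $n\ge2$, $k_1\ge1$, $k_2\ge0$ and $0\le\alpha\le n-1$. The number of NBC bases of the gain graph $K_n^{[1-k_2,k_1+k_2]}$ with activity $\alpha$ equals the number of $(k_1,k_2)$-non-increasing $(k_1+k_2)$-colored rooted trees on $[n]$ having exactly $\alpha$ edges of the form $(n,i)$ colored $1$. In particular, the number of bounded regions of the arrangement associated with $K_n^{[1-k_2,k_1+k_2]}$ (taken in the hyperplane $x_1+\cdots+x_n=0$) equals the number of such trees with no edge of the form $(n,i)$ colored $1$. (For $k_1=1,k_2=0$ this is the Linial arrangement $x_j-x_i=1$, $1\le i<j\le n$, and the trees are uncolored.)
   Context: For integers $a\le b$, $K_n^{[a,b]}$ is the gain graph (over $\mathbb Z$) with vertex set $[n]$ and, for every $1\le i<j\le n$ and every integer $g\in[a,b]$, one edge from $i$ to $j$ with gain $g$ (gain $-g$ in the reverse direction), corresponding to the hyperplane $x_j-x_i=g$ in $\mathbb R^n$; the associated arrangement consists of all these hyperplanes. A circle is balanced if the sum of the gains along it, in a fixed direction, is $0$. Fix a linear order on the edges. A broken circuit is a balanced circle minus its smallest edge. An NBC set is an edge set forming a forest of the underlying multigraph (no circles, no two parallel edges) containing no broken circuit; an NBC basis is an NBC set which is a spanning tree. For an NBC basis $B$, $e\in B$ is active if $e$ is the smallest edge among all $f$ with $(B\setminus\{e\})\cup\{f\}$ a spanning tree; the activity of $B$ is the number of active edges (the counts do not depend on the order). A $k$-colored rooted tree on $[n]$ is a set of $n-1$ triples $(u,w,c)$, $u\neq w\in[n]$, $c\in[k]$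 (edge from parent $u$ to child $w$ with color $c$), each vertex a child at most once, with no cycle. For a vertex $v$ with at least one child let $c_v$ be the minimal color of edges from $v$ to its children. With $k=k_1+k_2$, the tree is $(k_1,k_2)$-non-increasing if for every vertex $v$ with a child and $c_v\le k_1$, at least one child $w$ joined to $v$ by an edge of color $c_v$ satisfies $w<v$. An edge of the form $(n,i)$ is one whose parent is $n$. *)

theory Defs
  imports "HOL-Analysis.Analysis"
begin

section \<open>Gain graphs K_n^{[a,b]}\<close>

text \<open>An edge is a triple (i,j,g) with i<j: directed from i to j with gain g
  (gain -g in the reverse direction); it corresponds to the hyperplane x_j - x_i = g.\<close>
type_synonym gedge = "nat \<times> nat \<times> int"

definition gain_edges :: "nat \<Rightarrow> int \<Rightarrow> int \<Rightarrow> gedge set" where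
  "gain_edges n a b = {(i, j, g). 1 \<le> i \<and> i < j \<and> j \<le> n \<and> a \<le> g \<and> g \<le> b}"

definition ends :: "gedge \<Rightarrow> nat set" where
  "ends e = {fst e, fst (snd e)}"

definition gain :: "gedge \<Rightarrow> int" where
  "gain e = snd (snd e)"

text \<open>gain of e when traversed starting at vertex u\<close>
definition dgain :: "gedge \<Rightarrow> nat \<Rightarrow> int" where
  "dgain e u = (if u = fst e then gain e else - gain e)"

text \<open>A closed walk along distinct vertices vs!0, ..., vs!(m-1) using distinct edges
  es!k joining vs!k and vs!((k+1) mod m); m = 2 covers two parallel edges.\<close>
definition circle_walk :: "nat list \<Rightarrow> gedge list \<Rightarrow> bool" where
  "circle_walk vs es \<longleftrightarrow> length vs = length es \<and> 2 \<le> length vs \<and> distinct vs \<and> distinct es \<and>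
     (\<forall>k < length vs. ends (es ! k) = {vs ! k, vs ! ((k + 1) mod length vs)})"

definition is_circle :: "gedge set \<Rightarrow> bool" where
  "is_circle C \<longleftrightarrow> (\<exists>vs es. circle_walk vs es \<and> C = set es)"

definition balanced_circle :: "gedge set \<Rightarrow> bool" where
  "balanced_circle C \<longleftrightarrow> (\<exists>vs es. circle_walk vs es \<and> C = set es \<and>
      (\<Sum>k < length vs. dgain (es ! k) (vs ! k)) = 0)"

definition is_forest :: "gedge set \<Rightarrow> bool" where
  "is_forest F \<longleftrightarrow> \<not> (\<exists>C. C \<subseteq> F \<and> is_circle C)"

definition adj :: "gedge set \<Rightarrow> (nat \<times> nat) set" where
  "adj F = {(u, w). \<exists>e\<in>F. ends e = {u, w}}"

definition spanning_tree :: "nat \<Rightarrow> int \<Rightarrow> int \<Rightarrow> gedge set \<Rightarrow> bool" where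
  "spanning_tree n a b T \<longleftrightarrow> T \<subseteq> gain_edges n a b \<and> is_forest T \<and>
     (\<forall>u\<in>{1..n}. \<forall>w\<in>{1..n}. (u, w) \<in> (adj T)\<^sup>*)"

text \<open>The linear order on the edges is given by an injective ranking r.\<close>
definition broken_circuit_in :: "(gedge \<Rightarrow> nat) \<Rightarrow> nat \<Rightarrow> int \<Rightarrow> int \<Rightarrow> gedge set \<Rightarrow> bool" where
  "broken_circuit_in r n a b F \<longleftrightarrow> (\<exists>C e. C \<subseteq> gain_edges n a b \<and> balanced_circle C \<and>
      e \<in> C \<and> (\<forall>f\<in>C. r e \<le> r f) \<and> C - {e} \<subseteq> F)"

definition nbc_set :: "(gedge \<Rightarrow> nat) \<Rightarrow> nat \<Rightarrow> int \<Rightarrow> int \<Rightarrow> gedge set \<Rightarrow> bool" where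
  "nbc_set r n a b F \<longleftrightarrow> F \<subseteq> gain_edges n a b \<and> is_forest F \<and> \<not> broken_circuit_in r n a b F"

definition nbc_basis :: "(gedge \<Rightarrow> nat) \<Rightarrow> nat \<Rightarrow> int \<Rightarrow> int \<Rightarrow> gedge set \<Rightarrow> bool" where
  "nbc_basis r n a b B \<longleftrightarrow> nbc_set r n a b B \<and> spanning_tree n a b B"

definition active_edge :: "(gedge \<Rightarrow> nat) \<Rightarrow> nat \<Rightarrow> int \<Rightarrow> int \<Rightarrow> gedge set \<Rightarrow> gedge \<Rightarrow> bool" where
  "active_edge r n a b B e \<longleftrightarrow> e \<in> B \<and>
     (\<forall>f \<in> gain_edges n a b. spanning_tree n a b ((B - {e}) \<union> {f}) \<longrightarrow> r e \<le> r f)"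

definition activity :: "(gedge \<Rightarrow> nat) \<Rightarrow> nat \<Rightarrow> int \<Rightarrow> int \<Rightarrow> gedge set \<Rightarrow> nat" where
  "activity r n a b B = card {e \<in> B. active_edge r n a b B e}"

section \<open>The associated arrangement, restricted to x_1 + ... + x_n = 0\<close>

text \<open>Points of R^n are functions nat => real vanishing outside {1..n} (product topology).\<close>
definition sum_zero_space :: "nat \<Rightarrow> (nat \<Rightarrow> real) set" where
  "sum_zero_space n = {x. (\<forall>i. i \<notin> {1..n} \<longrightarrow> x i = 0) \<and> (\<Sum>i=1..n. x i) = 0}"

definition hyperplane_of :: "gedge \<Rightarrow> (nat \<Rightarrow> real) set" where
  "hyperplane_of e = {x. x (fst (snd e)) - x (fst e) = real_of_int (gain e)}"

definition arr_complement :: "nat \<Rightarrow> int \<Rightarrow> int \<Rightarrow> (nat \<Rightarrow> real) set" where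
  "arr_complement n a b = sum_zero_space n - (\<Union>e \<in> gain_edges n a b. hyperplane_of e)"

definition regions :: "nat \<Rightarrow> int \<Rightarrow> int \<Rightarrow> (nat \<Rightarrow> real) set set" where
  "regions n a b = {connected_component_set (arr_complement n a b) x | x. x \<in> arr_complement n a b}"

definition bounded_region :: "nat \<Rightarrow> (nat \<Rightarrow> real) set \<Rightarrow> bool" where
  "bounded_region n R \<longleftrightarrow> (\<exists>M. \<forall>x\<in>R. \<forall>i\<in>{1..n}. \<bar>x i\<bar> \<le> M)"

section \<open>Colored rooted trees\<close>

text \<open>A triple (u,w,c): edge from parent u to child w with color c.\<close>
definition colored_rooted_tree :: "nat \<Rightarrow> nat \<Rightarrow> (nat \<times> nat \<times> nat) set \<Rightarrow> bool" where
  "colored_rooted_tree n k T \<longleftrightarrow>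
     T \<subseteq> {1..n} \<times> {1..n} \<times> {1..k} \<and> (\<forall>(u, w, c) \<in> T. u \<noteq> w) \<and>
     card T = n - 1 \<and>
     (\<forall>t\<in>T. \<forall>t'\<in>T. fst (snd t) = fst (snd t') \<longrightarrow> t = t') \<and>
     acyclic {(u, w). \<exists>c. (u, w, c) \<in> T}"

definition min_child_color :: "(nat \<times> nat \<times> nat) set \<Rightarrow> nat \<Rightarrow> nat" where
  "min_child_color T v = Min {c. \<exists>w. (v, w, c) \<in> T}"

definition non_increasing :: "nat \<Rightarrow> (nat \<times> nat \<times> nat) set \<Rightarrow> bool" where
  "non_increasing k1 T \<longleftrightarrow> (\<forall>v. (\<exists>w c. (v, w, c) \<in> T) \<and> min_child_color T v \<le> k1 \<longrightarrow>
      (\<exists>w. (v, w, min_child_color T v) \<in> T \<and> w < v))"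

definition num_root_edges_col1 :: "nat \<Rightarrow> (nat \<times> nat \<times> nat) set \<Rightarrow> nat" where
  "num_root_edges_col1 n T = card {t \<in> T. fst t = n \<and> snd (snd t) = 1}"

end

theory Submission
  imports Defs "HOL-Combinatorics.Multiset_Permutations"
begin

text \<open>Both sides are compared as polynomials. The NBC sets are partitioned by the intervals
  [B - A, B], where B is an NBC basis and A its set of active edges, so the generating function of
  activity is, up to a change of variable, the alternating sum over NBC sets. Toggling the least
  edge of a flat shows that for all large q this alternating sum counts the proper colorings modulo q.
  Reading such a coloring around the circle turns it into a permutation with prescribed gaps, hence
  into a sum of binomial coefficients over permutations that involves only the number of ascents.

  On the other side the condition at each vertex of a colored tree is resolved by
  inclusion-exclusion. The remaining sum over rooted trees, in which an edge is weighted by its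
  parent and by whether it goes up or down, is a product, as contracting the edge above the largest
  vertex shows. The resulting signed sum of products equals the same sum over permutations, by a
  computation with shift operators in which ordered set partitions appear on both sides.

  For the bounded regions, deletion and restriction computes the alternating sum over the central
  edge sets. A cell is bounded when its constraint digraph has symmetric reachability, so the three
  cases of the recursion are statements about adding arcs to a digraph. Comparing flat by flat, the
  alternating sum over central sets agrees with the one over the NBC sets.\<close>

section \<open>Connectivity and circles\<close>

definition conn :: "gedge set \<Rightarrow> (nat \<times> nat) set" where
  "conn F = (adj F)\<^sup>*"

lemma in_adj_iff: "(u, w) \<in> adj F \<longleftrightarrow> (\<exists>g. (u, w, g) \<in> F \<or> (w, u, g) \<in> F)"
proof
  assume "(u, w) \<in> adj F"
  then obtain i j g where "(i, j, g) \<in> F" "{i, j} = {u, w}"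
    by (auto simp: adj_def ends_def)
  then show "\<exists>g. (u, w, g) \<in> F \<or> (w, u, g) \<in> F"
    by (auto simp: doubleton_eq_iff)
qed (force simp: adj_def ends_def)

lemma adj_insert: "adj (insert (i, j, g) F) = insert (i, j) (insert (j, i) (adj F))"
  by (auto simp: in_adj_iff)

lemma sym_adj: "sym (adj F)"
  by (auto simp: sym_def in_adj_iff)

lemma equiv_conn: "equiv UNIV (conn F)"
  unfolding conn_def using sym_adj by (auto intro!: equivI sym_rtrancl refl_rtrancl trans_rtrancl)

lemma conn_refl [simp]: "(u, u) \<in> conn F"
  by (simp add: conn_def)

lemma conn_sym: "(u, w) \<in> conn F \<Longrightarrow> (w, u) \<in> conn F"
  using equiv_conn by (meson equivE symD)

lemma conn_trans: "(u, v) \<in> conn F \<Longrightarrow> (v, w) \<in> conn F \<Longrightarrow> (u, w) \<in> conn F"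
  unfolding conn_def by (rule rtrancl_trans)

lemma conn_class_eq_iff: "conn F `` {u} = conn F `` {w} \<longleftrightarrow> (u, w) \<in> conn F"
  by (simp add: eq_equiv_class_iff[OF equiv_conn])

lemma conn_mono: "F \<subseteq> G \<Longrightarrow> conn F \<subseteq> conn G"
  unfolding conn_def by (rule rtrancl_mono) (auto simp: adj_def)

lemma conn_ends: "e \<in> F \<Longrightarrow> ends e = {u, w} \<Longrightarrow> (u, w) \<in> conn F"
  unfolding conn_def by (rule r_into_rtrancl) (auto simp: adj_def)

lemma conn_edge: "(i, j, g) \<in> F \<Longrightarrow> (i, j) \<in> conn F"
  by (rule conn_ends[of "(i, j, g)"]) (simp_all add: ends_def)

lemma conn_class_edge: "(i, j, g) \<in> F \<Longrightarrow> i \<in> conn F `` {v} \<longleftrightarrow> j \<in> conn F `` {v}"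
  by (meson Image_singleton_iff conn_edge conn_sym conn_trans)

lemma conn_insert:
  "conn (insert (i, j, g) F) = {(u, w). (u, w) \<in> conn F \<or>
     (u, i) \<in> conn F \<and> (j, w) \<in> conn F \<or> (u, j) \<in> conn F \<and> (i, w) \<in> conn F}"
proof -
  have "conn (insert (i, j, g) F) \<subseteq> {(u, w). (u, w) \<in> conn F \<or>
     (u, i) \<in> conn F \<and> (j, w) \<in> conn F \<or> (u, j) \<in> conn F \<and> (i, w) \<in> conn F}"
    unfolding conn_def adj_insert rtrancl_insert by (auto intro: rtrancl_trans)
  moreover have "conn F \<subseteq> conn (insert (i, j, g) F)"
    by (rule conn_mono) auto
  moreover have "(i, j) \<in> conn (insert (i, j, g) F)"
    by (rule conn_edge[of _ _ g]) simp
  ultimately show ?thesis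
    by (auto; meson conn_trans conn_sym subsetD)
qed

lemma conn_insert_connected:
  "(i, j) \<in> conn F \<Longrightarrow> conn (insert (i, j, g) F) = conn F"
  unfolding conn_insert by (auto; meson conn_trans conn_sym)

lemma conn_least:
  assumes "\<And>e u w. e \<in> F \<Longrightarrow> ends e = {u, w} \<Longrightarrow> (u, w) \<in> R\<^sup>*"
  shows "conn F \<subseteq> R\<^sup>*"
proof -
  have "adj F \<subseteq> R\<^sup>*"
    using assms by (auto simp: adj_def)
  then show ?thesis
    unfolding conn_def by (rule rtrancl_subset_rtrancl)
qed

lemma simple_path_exists:
  assumes "(u, w) \<in> conn F"
  obtains vs es where "length vs = Suc (length es)" "distinct vs" "vs ! 0 = u" "vs ! length es = w"
    "set es \<subseteq> F" "\<forall>k<length es. ends (es ! k) = {vs ! k, vs ! Suc k}"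
proof -
  have "\<exists>vs es. length vs = Suc (length es) \<and> distinct vs \<and> vs ! 0 = u \<and> vs ! length es = w \<and>
     set es \<subseteq> F \<and> (\<forall>k<length es. ends (es ! k) = {vs ! k, vs ! Suc k})"
    using assms unfolding conn_def
  proof (induction rule: rtrancl_induct)
    case base
    show ?case
      by (rule exI[of _ "[u]"], rule exI[of _ "[]"]) auto
  next
    case (step y z)
    then obtain vs es where path: "length vs = Suc (length es)" "distinct vs" "vs ! 0 = u"
      "vs ! length es = y" "set es \<subseteq> F" "\<forall>k<length es. ends (es ! k) = {vs ! k, vs ! Suc k}"
      by blast
    obtain e where e: "e \<in> F" "ends e = {y, z}"
      using step.hyps by (auto simp: adj_def)
    show ?case
    proof (cases "z \<in> set vs")
      case True
      then obtain l where l: "l < length vs" "vs ! l = z"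
        by (auto simp: in_set_conv_nth)
      show ?thesis
        by (rule exI[of _ "take (Suc l) vs"], rule exI[of _ "take l es"])
          (use path l in \<open>auto dest: in_set_takeD simp: min_def le_Suc_eq less_Suc_eq_le\<close>)
    next
      case False
      show ?thesis
        by (rule exI[of _ "vs @ [z]"], rule exI[of _ "es @ [e]"])
          (use path e False in \<open>auto simp: nth_append less_Suc_eq\<close>)
    qed
  qed
  then show ?thesis
    using that by blast
qed

lemma circle_through_edge:
  assumes "(u, w) \<in> conn F" "ends e = {u, w}" "u \<noteq> w" "e \<notin> F"
  obtains C where "is_circle C" "e \<in> C" "C - {e} \<subseteq> F"
proof -
  obtain vs es where path: "length vs = Suc (length es)" "distinct vs" "vs ! 0 = u"
    "vs ! length es = w" "set es \<subseteq> F" "\<forall>k<length es. ends (es ! k) = {vs ! k, vs ! Suc k}"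
    using simple_path_exists[OF assms(1)] .
  have nonempty: "es \<noteq> []"
    using path assms(3) by auto
  have "k = l" if "k < length es" "l < length es" "es ! k = es ! l" for k l
  proof -
    have "{vs ! k, vs ! Suc k} = {vs ! l, vs ! Suc l}"
      using path(6) that by metis
    then have "k = l \<or> k = Suc l \<and> Suc k = l"
      using path(1,2) that by (auto simp: doubleton_eq_iff nth_eq_iff_index_eq)
    then show ?thesis by auto
  qed
  then have "distinct es"
    by (auto simp: distinct_conv_nth)
  then have "circle_walk vs (es @ [e])"
    unfolding circle_walk_def using path nonempty assms
    by (auto simp: nth_append Suc_le_eq less_Suc_eq mod_Suc)
  then have "is_circle (set (es @ [e]))"
    unfolding is_circle_def by blast
  then show ?thesis
    using that path(5) by auto
qed

lemma circle_walk_conn: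
  assumes "circle_walk vs es" "e \<in> set es" "ends e = {u, w}"
  shows "(u, w) \<in> conn (set es - {e})"
proof -
  define m where "m = length vs"
  have walk: "length es = m" "2 \<le> m" "distinct es"
    "\<And>k. k < m \<Longrightarrow> ends (es ! k) = {vs ! k, vs ! (Suc k mod m)}"
    using assms(1) by (auto simp: circle_walk_def m_def)
  obtain k where k: "k < m" "e = es ! k"
    using assms(2) walk(1) by (metis in_set_conv_nth)
  have around: "(vs ! (Suc k mod m), vs ! ((k + Suc t) mod m)) \<in> conn (set es - {e})" if "t < m"
    for t
    using that
  proof (induction t)
    case (Suc t)
    let ?l = "(k + Suc t) mod m"
    have l: "?l < m" using walk(2) by simp
    have "\<not> m dvd Suc t"
      using Suc.prems by (auto dest: dvd_imp_le)
    then have "?l \<noteq> k"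
      using k(1) by (metis add_diff_cancel_left' le_add1 mod_eq_dvd_iff_nat mod_less)
    then have "es ! ?l \<in> set es - {e}"
      using walk k l by (auto simp: nth_eq_iff_index_eq)
    moreover have "ends (es ! ?l) = {vs ! ?l, vs ! ((k + Suc (Suc t)) mod m)}"
      using walk(4)[OF l] by (simp add: mod_Suc_eq)
    ultimately have "(vs ! ?l, vs ! ((k + Suc (Suc t)) mod m)) \<in> conn (set es - {e})"
      by (rule conn_ends)
    then show ?case
      using Suc by (meson Suc_lessD conn_trans)
  qed simp
  have "(vs ! (Suc k mod m), vs ! k) \<in> conn (set es - {e})"
    using around[of "m - 1"] walk(2) k by simp
  moreover have "{u, w} = {vs ! k, vs ! (Suc k mod m)}"
    using walk(4)[OF k(1)] k(2) assms(3) by simp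
  ultimately show ?thesis
    by (auto simp: doubleton_eq_iff intro: conn_sym)
qed

lemma circle_conn:
  "is_circle C \<Longrightarrow> (i, j, g) \<in> C \<Longrightarrow> (i, j) \<in> conn (C - {(i, j, g)})"
  unfolding is_circle_def using circle_walk_conn[of _ _ "(i, j, g)" i j] by (auto simp: ends_def)

lemma balanced_circle_is_circle: "balanced_circle C \<Longrightarrow> is_circle C"
  by (auto simp: balanced_circle_def is_circle_def)

lemma is_forest_mono: "is_forest F \<Longrightarrow> G \<subseteq> F \<Longrightarrow> is_forest G"
  by (auto simp: is_forest_def)

lemma is_forest_empty [simp]: "is_forest {}"
  by (auto simp: is_forest_def is_circle_def circle_walk_def)

lemma is_forest_insert:
  assumes "is_forest F" "(i, j, g) \<notin> F" "i \<noteq> j"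
  shows "is_forest (insert (i, j, g) F) \<longleftrightarrow> (i, j) \<notin> conn F"
proof
  assume forest: "is_forest (insert (i, j, g) F)"
  show "(i, j) \<notin> conn F"
  proof
    assume "(i, j) \<in> conn F"
    then obtain C where "is_circle C" "C - {(i, j, g)} \<subseteq> F"
      using circle_through_edge[of i j F "(i, j, g)"] assms(2,3)
      by (metis ends_def fst_conv snd_conv)
    then have "C \<subseteq> insert (i, j, g) F" by blast
    with \<open>is_circle C\<close> show False using forest by (simp add: is_forest_def)
  qed
next
  assume unconnected: "(i, j) \<notin> conn F"
  show "is_forest (insert (i, j, g) F)"
    unfolding is_forest_def
  proof (rule notI, elim exE conjE)
    fix C assume C: "C \<subseteq> insert (i, j, g) F" "is_circle C"
    then have "(i, j, g) \<in> C"
      using assms(1) unfolding is_forest_def by blast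
    then have "(i, j) \<in> conn (C - {(i, j, g)})"
      using C(2) circle_conn by blast
    moreover have "C - {(i, j, g)} \<subseteq> F"
      using C(1) by blast
    ultimately show False
      using unconnected conn_mono by blast
  qed
qed

lemma is_forest_remove:
  assumes "is_forest F" "(i, j, g) \<in> F" "i \<noteq> j"
  shows "(i, j) \<notin> conn (F - {(i, j, g)})"
proof -
  have "is_forest (F - {(i, j, g)})"
    using assms(1) by (rule is_forest_mono) auto
  moreover have "insert (i, j, g) (F - {(i, j, g)}) = F"
    using assms(2) by blast
  ultimately show ?thesis
    using is_forest_insert[of "F - {(i, j, g)}" i j g] assms by auto
qed

section \<open>Counting components\<close>

lemma gain_edges_iff:
  "(i, j, g) \<in> gain_edges n a b \<longleftrightarrow> 1 \<le> i \<and> i < j \<and> j \<le> n \<and> a \<le> g \<and> g \<le> b"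
  by (simp add: gain_edges_def)

lemma finite_gain_edges [simp]: "finite (gain_edges n a b)"
  by (rule finite_subset[of _ "{0..n} \<times> {0..n} \<times> {a..b}"]) (auto simp: gain_edges_def)

lemma finite_if_gain_edges: "F \<subseteq> gain_edges n a b \<Longrightarrow> finite F"
  by (rule finite_subset[OF _ finite_gain_edges])

definition graph_components :: "nat \<Rightarrow> gedge set \<Rightarrow> nat set set" where
  "graph_components n F = {1..n} // conn F"

lemma graph_components_eq_image: "graph_components n F = (\<lambda>v. conn F `` {v}) ` {1..n}"
  by (auto simp: graph_components_def quotient_def)

lemma finite_graph_components [simp]: "finite (graph_components n F)"
  by (simp add: graph_components_eq_image)

lemma card_components_pos: "1 \<le> n \<Longrightarrow> 1 \<le> card (graph_components n F)"
  by (simp add: Suc_le_eq card_gt_0_iff graph_components_eq_image)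

lemma graph_components_insert_connected:
  "(i, j) \<in> conn F \<Longrightarrow> graph_components n (insert (i, j, g) F) = graph_components n F"
  by (simp add: graph_components_def conn_insert_connected)

lemma graph_components_insert:
  fixes F :: "gedge set" and i j :: nat
  defines "I \<equiv> conn F `` {i}" and "J \<equiv> conn F `` {j}"
  assumes "i \<in> {1..n}" "j \<in> {1..n}"
  shows "graph_components n (insert (i, j, g) F) = insert (I \<union> J) (graph_components n F - {I, J})"
proof (intro equalityI subsetI)
  have new_class: "conn (insert (i, j, g) F) `` {v} = (if v \<in> I \<union> J then I \<union> J else conn F `` {v})"
    for v
    unfolding conn_insert I_def J_def by (auto; meson conn_trans conn_sym)
  have merged: "v \<in> I \<union> J \<longleftrightarrow> conn F `` {v} \<in> {I, J}" for v
    by (auto simp: I_def J_def conn_class_eq_iff intro: conn_sym)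
  fix X
  {
    assume "X \<in> graph_components n (insert (i, j, g) F)"
    then obtain v where "v \<in> {1..n}" "X = conn (insert (i, j, g) F) `` {v}"
      by (auto simp: graph_components_eq_image)
    then show "X \<in> insert (I \<union> J) (graph_components n F - {I, J})"
      using new_class[of v] merged[of v] by (auto simp: graph_components_eq_image split: if_splits)
  next
    assume "X \<in> insert (I \<union> J) (graph_components n F - {I, J})"
    then consider (merged) "X = I \<union> J"
      | (old) v where "v \<in> {1..n}" "X = conn F `` {v}" "X \<notin> {I, J}"
      unfolding graph_components_eq_image by blast
    then show "X \<in> graph_components n (insert (i, j, g) F)"
    proof cases
      case merged
      moreover have "i \<in> I \<union> J" by (simp add: I_def)
      ultimately show ?thesis
        using new_class[of i] assms(3) by (auto simp: graph_components_eq_image)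
    next
      case old
      then show ?thesis
        using new_class[of v] merged[of v] unfolding graph_components_eq_image by (metis imageI)
    qed
  }
qed

lemma card_components_insert:
  assumes "i \<in> {1..n}" "j \<in> {1..n}" "(i, j) \<notin> conn F"
  shows "card (graph_components n F) = Suc (card (graph_components n (insert (i, j, g) F)))"
proof -
  define I J where "I = conn F `` {i}" and "J = conn F `` {j}"
  have new: "I \<union> J \<notin> graph_components n F"
  proof
    assume "I \<union> J \<in> graph_components n F"
    then obtain v where "I \<union> J = conn F `` {v}"
      by (auto simp: graph_components_eq_image)
    moreover have "i \<in> I \<union> J" "j \<in> I \<union> J"
      by (simp_all add: I_def J_def)
    ultimately have "(v, i) \<in> conn F" "(v, j) \<in> conn F"
      by blast+
    then show False
      using assms(3) by (meson conn_trans conn_sym)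
  qed
  have old: "{I, J} \<subseteq> graph_components n F"
    using assms by (auto simp: graph_components_eq_image I_def J_def)
  have "card {I, J} = 2"
    using assms(3) by (simp add: I_def J_def conn_class_eq_iff)
  then have "card (graph_components n F - {I, J}) + 2 = card (graph_components n F)"
    using card_Diff_subset[of "{I, J}"] card_mono[OF finite_graph_components old] old by simp
  moreover have "graph_components n (insert (i, j, g) F) =
      insert (I \<union> J) (graph_components n F - {I, J})"
    unfolding I_def J_def by (rule graph_components_insert[OF assms(1,2)])
  ultimately show ?thesis
    using new by simp
qed

lemma card_components_eq_1_iff:
  assumes "1 \<le> n"
  shows "card (graph_components n F) = 1 \<longleftrightarrow> {1..n} \<times> {1..n} \<subseteq> conn F"
proof
  assume "card (graph_components n F) = 1"
  then obtain X where "graph_components n F = {X}"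
    by (auto simp: card_1_singleton_iff)
  then have "conn F `` {u} = conn F `` {w}" if "u \<in> {1..n}" "w \<in> {1..n}" for u w
    using that unfolding graph_components_eq_image by (metis imageI singletonD)
  then show "{1..n} \<times> {1..n} \<subseteq> conn F"
    by (auto simp: conn_class_eq_iff)
next
  assume "{1..n} \<times> {1..n} \<subseteq> conn F"
  then have "conn F `` {v} = conn F `` {1}" if "v \<in> {1..n}" for v
    using that assms by (auto simp: conn_class_eq_iff)
  then have "graph_components n F = (\<lambda>v. conn F `` {1}) ` {1..n}"
    unfolding graph_components_eq_image by (rule image_cong[OF refl])
  then show "card (graph_components n F) = 1"
    using assms by (simp add: image_constant_conv)
qed

lemma card_components_empty: "card (graph_components n {}) = n"
proof -
  have "conn {} = Id"
    by (auto simp: conn_def adj_def)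
  then have "graph_components n {} = (\<lambda>v. {v}) ` {1..n}"
    by (auto simp: graph_components_eq_image)
  then show ?thesis
    by (simp add: card_image)
qed

lemma forest_card_components:
  assumes "F \<subseteq> gain_edges n a b" "is_forest F"
  shows "card F + card (graph_components n F) = n"
  using finite_if_gain_edges[OF assms(1)] assms
proof (induction F)
  case empty
  then show ?case
    by (simp add: card_components_empty)
next
  case (insert e F)
  obtain i j g where e: "e = (i, j, g)" by (cases e)
  have F: "is_forest F"
    using insert.prems by (auto intro: is_forest_mono)
  have ij: "1 \<le> i" "i < j" "j \<le> n"
    using insert.prems e by (auto simp: gain_edges_iff)
  have "(i, j) \<notin> conn F"
    using is_forest_insert[of F i j g] insert e F ij by auto
  then have "card (graph_components n F) = Suc (card (graph_components n (insert e F)))"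
    unfolding e using ij by (intro card_components_insert) auto
  then show ?case
    using insert F by simp
qed

corollary forest_card_le:
  "F \<subseteq> gain_edges n a b \<Longrightarrow> is_forest F \<Longrightarrow> 1 \<le> n \<Longrightarrow> card F \<le> n - 1"
  using forest_card_components[of F n a b] card_components_pos[of n F] by simp

section \<open>No-broken-circuit bases and activity\<close>

lemma finite_nbc_sets [simp]: "finite {F. nbc_set r n a b F}"
  by (rule finite_subset[of _ "Pow (gain_edges n a b)"]) (auto simp: nbc_set_def)

lemma finite_nbc_bases [simp]: "finite {B. nbc_basis r n a b B}"
  by (rule finite_subset[of _ "{F. nbc_set r n a b F}"]) (auto simp: nbc_basis_def)

lemma nbc_set_mono: "nbc_set r n a b F \<Longrightarrow> G \<subseteq> F \<Longrightarrow> nbc_set r n a b G"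
  unfolding nbc_set_def broken_circuit_in_def by (meson is_forest_mono subset_trans)

lemma nbc_set_empty: "nbc_set r n a b {}"
proof -
  have False if C: "balanced_circle C" "e \<in> C" "C - {e} \<subseteq> {}" for C e
  proof -
    have "C = {e}" using C by auto
    then obtain vs es where "circle_walk vs es" "set es = {e}"
      using C(1) unfolding balanced_circle_def by metis
    then show False
      using distinct_card[of es] by (auto simp: circle_walk_def)
  qed
  then show ?thesis
    unfolding nbc_set_def broken_circuit_in_def by auto
qed

lemma sum_Pow_insert:
  assumes "finite A" "x \<notin> A"
  shows "(\<Sum>S\<in>Pow (insert x A). f S) = (\<Sum>S\<in>Pow A. f S + f (insert x S))"
proof -
  have "inj_on (insert x) (Pow A)"
    using assms(2) by (auto simp: inj_on_def)
  moreover have "Pow A \<inter> insert x ` Pow A = {}"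
    using assms(2) by auto
  ultimately show ?thesis
    using assms(1) by (simp add: Pow_insert sum.union_disjoint sum.reindex sum.distrib)
qed

lemma sum_Pow_power_card:
  fixes y :: "'a :: comm_ring_1"
  assumes "finite A"
  shows "(\<Sum>D\<in>Pow A. y ^ card D) = (1 + y) ^ card A"
  using prod_add[OF assms, of "\<lambda>_. y" "\<lambda>_. 1"] by (simp add: add.commute)

locale gain_graph =
  fixes n :: nat and a b :: int
  assumes n_pos: "1 \<le> n" and gains_nonempty: "a \<le> b"
begin

abbreviation "E \<equiv> gain_edges n a b"

lemma edge_verts:
  assumes "(i, j, g) \<in> E"
  shows "i \<in> {1..n}" "j \<in> {1..n}" "i \<noteq> j"
  using assms by (auto simp: gain_edges_iff)

lemma spanning_tree_iff:
  "spanning_tree n a b T \<longleftrightarrow> T \<subseteq> E \<and> is_forest T \<and> card (graph_components n T) = 1"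
  unfolding card_components_eq_1_iff[OF n_pos] by (auto simp: spanning_tree_def conn_def)

lemma spanning_tree_conn:
  "spanning_tree n a b T \<Longrightarrow> u \<in> {1..n} \<Longrightarrow> w \<in> {1..n} \<Longrightarrow> (u, w) \<in> conn T"
  by (simp add: spanning_tree_def conn_def)

lemma card_spanning_tree: "spanning_tree n a b T \<Longrightarrow> card T = n - 1"
  using forest_card_components[of T n a b] by (auto simp: spanning_tree_iff)

lemma spanning_tree_exchange:
  assumes "spanning_tree n a b B" "e \<in> B" "(i, j, g) \<in> E" "(i, j) \<notin> conn (B - {e})"
  shows "spanning_tree n a b (insert (i, j, g) (B - {e}))"
proof -
  have B: "B \<subseteq> E" "is_forest B" "finite B"
    using assms(1) finite_if_gain_edges by (auto simp: spanning_tree_iff)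
  have F: "is_forest (B - {e})"
    using B(2) by (rule is_forest_mono) auto
  have "card (B - {e}) + card (graph_components n (B - {e})) = n"
    using F B by (intro forest_card_components[of _ n a b]) auto
  moreover have "Suc (card (B - {e})) = n - 1"
    using card_Suc_Diff1[OF B(3) assms(2)] card_spanning_tree[OF assms(1)] by simp
  ultimately have two: "card (graph_components n (B - {e})) = 2"
    by linarith
  have "card (graph_components n (insert (i, j, g) (B - {e}))) = 1"
    using card_components_insert[OF edge_verts(1,2)[OF assms(3)] assms(4), of g] two by simp
  moreover have "(i, j, g) \<notin> B - {e}"
    using assms(4) conn_edge by blast
  then have "is_forest (insert (i, j, g) (B - {e}))"
    using is_forest_insert[OF F] edge_verts[OF assms(3)] assms(4) by simp
  ultimately show ?thesis
    using B(1) assms(3) unfolding spanning_tree_iff by auto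
qed

lemma spanning_tree_circle_exchange:
  assumes "spanning_tree n a b B" "is_circle C" "C \<subseteq> E" "e \<in> C" "C - {e} \<subseteq> B" "f \<in> C - {e}"
  shows "spanning_tree n a b (insert e (B - {f}))"
proof -
  obtain i j g i' j' g' where e: "e = (i, j, g)" and f: "f = (i', j', g')"
    by (metis prod_cases3)
  have "(i', j') \<notin> conn (B - {f})"
    using is_forest_remove[of B i' j' g'] assms edge_verts[of i' j' g'] f
    by (auto simp: spanning_tree_iff)
  moreover have "(i', j') \<in> conn (C - {f})"
    using circle_conn[OF assms(2)] assms(6) f by simp
  then have "(i', j') \<in> conn (insert e (B - {f}))"
    using conn_mono[of "C - {f}" "insert e (B - {f})"] assms(5) by blast
  ultimately have "(i, j) \<notin> conn (B - {f})"
    using conn_insert_connected[of i j "B - {f}" g] e by auto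
  then show ?thesis
    using spanning_tree_exchange[OF assms(1), of f i j g] assms e by auto
qed

lemma spanning_tree_symmetric_exchange:
  assumes B: "spanning_tree n a b B" and B': "spanning_tree n a b B'" and e: "e \<in> B" "e \<notin> B'"
  obtains f where "f \<in> B'" "f \<notin> B" "spanning_tree n a b (insert f (B - {e}))"
    "spanning_tree n a b (insert e (B' - {f}))"
proof -
  have sub: "B \<subseteq> E" "B' \<subseteq> E" and forest: "is_forest B"
    using B B' by (auto simp: spanning_tree_iff)
  obtain i j g where e_eq: "e = (i, j, g)" by (cases e)
  note ij = edge_verts[of i j g]
  have eE: "(i, j, g) \<in> E"
    using e(1) e_eq sub by blast
  obtain C where C: "is_circle C" "e \<in> C" "C - {e} \<subseteq> B'"
    using circle_through_edge[of i j B' e] spanning_tree_conn[OF B'] ij[OF eE] e(2) e_eq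
    by (metis ends_def fst_conv snd_conv)
  have "(i, j) \<notin> conn (B - {e})"
    using is_forest_remove[OF forest] ij[OF eE] e(1) e_eq by blast
  moreover have "(i, j) \<in> conn (C - {e})"
    using circle_conn[OF C(1)] C(2) e_eq by blast
  ultimately obtain f u w where f: "f \<in> C - {e}" "ends f = {u, w}" "(u, w) \<notin> conn (B - {e})"
    using conn_least[of "C - {e}" "adj (B - {e})"] by (metis conn_def subsetD)
  obtain i' j' g' where f_eq: "f = (i', j', g')" by (cases f)
  have "(i', j') \<notin> conn (B - {e})"
    using f(2,3) f_eq conn_sym by (auto simp: ends_def doubleton_eq_iff)
  then have "spanning_tree n a b (insert f (B - {e}))" "f \<notin> B"
    using spanning_tree_exchange[OF B e(1), of i' j' g'] conn_edge[of i' j' g' "B - {e}"]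
      f(1) f_eq C(3) sub(2) by auto
  moreover have "spanning_tree n a b (insert e (B' - {f}))"
    using spanning_tree_circle_exchange[OF B' C(1) _ C(2,3) f(1)] C(3) sub e(1) by blast
  ultimately show ?thesis
    using that f(1) C(3) by blast
qed

lemma spanning_tree_extension:
  assumes "F \<subseteq> E" "is_forest F"
  obtains B where "spanning_tree n a b B" "F \<subseteq> B"
proof -
  let ?P = "\<lambda>G. G \<subseteq> E \<and> is_forest G \<and> F \<subseteq> G"
  have "finite {G. ?P G}"
    by (rule finite_subset[of _ "Pow E"]) auto
  moreover have "{G. ?P G} \<noteq> {}"
    using assms by blast
  ultimately obtain G where G: "?P G" and maximal: "\<And>H. ?P H \<Longrightarrow> G \<subseteq> H \<Longrightarrow> H = G"
    by (metis (mono_tags, lifting) finite_has_maximal mem_Collect_eq)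
  have less: "(u, w) \<in> conn G" if "u \<in> {1..n}" "w \<in> {1..n}" "u < w" for u w
  proof (rule ccontr)
    assume "(u, w) \<notin> conn G"
    moreover from this have "(u, w, a) \<notin> G"
      using conn_edge by blast
    ultimately have "is_forest (insert (u, w, a) G)"
      using is_forest_insert[of G u w a] G that by auto
    moreover have "(u, w, a) \<in> E"
      using that gains_nonempty by (auto simp: gain_edges_iff)
    ultimately show False
      using maximal[of "insert (u, w, a) G"] G \<open>(u, w, a) \<notin> G\<close> by blast
  qed
  have "(u, w) \<in> conn G" if "u \<in> {1..n}" "w \<in> {1..n}" for u w
    using less that by (metis conn_refl conn_sym linorder_neqE_nat)
  then have "spanning_tree n a b G"
    using G by (auto simp: spanning_tree_def conn_def)
  then show ?thesis
    using that G by blast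
qed

lemma card_components_edges: "card (graph_components n E) = 1"
proof -
  obtain B where B: "spanning_tree n a b B"
    using spanning_tree_extension[of "{}"] by auto
  then have "{1..n} \<times> {1..n} \<subseteq> conn B"
    using spanning_tree_conn by blast
  also have "\<dots> \<subseteq> conn E"
    using B by (intro conn_mono) (simp add: spanning_tree_iff)
  finally show ?thesis
    unfolding card_components_eq_1_iff[OF n_pos] .
qed

end

locale ordered_gain_graph = gain_graph +
  fixes r :: "gedge \<Rightarrow> nat"
  assumes inj_rank: "inj_on r E"
begin

definition active_edges :: "gedge set \<Rightarrow> gedge set" where
  "active_edges B = {e \<in> B. active_edge r n a b B e}"

lemma active_edges_subset: "active_edges B \<subseteq> B"
  by (auto simp: active_edges_def)

lemma card_active_edges: "card (active_edges B) = activity r n a b B"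
  by (simp add: active_edges_def activity_def)

lemma rank_le_if_active:
  "e \<in> active_edges B \<Longrightarrow> f \<in> E \<Longrightarrow> spanning_tree n a b (insert f (B - {e})) \<Longrightarrow> r e \<le> r f"
  by (simp add: active_edges_def active_edge_def)

lemma active_completion_exists:
  assumes "F \<subseteq> E" "is_forest F"
  obtains B where "spanning_tree n a b B" "F \<subseteq> B" "B - active_edges B \<subseteq> F"
proof -
  \<comment> \<open>A spanning tree of least total rank among those containing F admits no improving exchange
    outside F.\<close>
  obtain B where B: "spanning_tree n a b B" "F \<subseteq> B"
    and least: "\<And>T. spanning_tree n a b T \<Longrightarrow> F \<subseteq> T \<Longrightarrow> sum r B \<le> sum r T"
    using spanning_tree_extension[OF assms]
      ex_has_least_nat[of "\<lambda>T. spanning_tree n a b T \<and> F \<subseteq> T" _ "sum r"] by metis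
  have fin: "finite B"
    using B(1) finite_if_gain_edges by (auto simp: spanning_tree_def)
  have "active_edge r n a b B e" if e: "e \<in> B" "e \<notin> F" for e
    unfolding active_edge_def
  proof (intro conjI ballI impI)
    fix f assume f: "f \<in> E" "spanning_tree n a b ((B - {e}) \<union> {f})"
    have "f \<notin> B - {e}"
    proof
      assume "f \<in> B - {e}"
      then have "(B - {e}) \<union> {f} = B - {e}" by blast
      then have "card (B - {e}) = card B"
        using card_spanning_tree f(2) B(1) by metis
      then show False
        using e(1) fin by (metis card_Diff1_less less_irrefl)
    qed
    have "sum r B \<le> sum r ((B - {e}) \<union> {f})"
      using least[OF f(2)] B(2) e by blast
    also have "\<dots> = r f + sum r (B - {e})"
      using \<open>f \<notin> B - {e}\<close> fin by simp
    finally show "r e \<le> r f"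
      using sum.remove[OF fin e(1), of r] by simp
  qed (rule e(1))
  then have "B - active_edges B \<subseteq> F"
    by (auto simp: active_edges_def)
  then show ?thesis
    using that B by blast
qed

lemma active_completion_unique:
  assumes B: "spanning_tree n a b B" "F \<subseteq> B" "B - active_edges B \<subseteq> F"
    and B': "spanning_tree n a b B'" "F \<subseteq> B'" "B' - active_edges B' \<subseteq> F"
  shows "B = B'"
proof (rule ccontr)
  assume "B \<noteq> B'"
  have sub: "B \<subseteq> E" "B' \<subseteq> E"
    using B(1) B'(1) by (auto simp: spanning_tree_def)
  have "\<not> B \<subseteq> B'"
    using \<open>B \<noteq> B'\<close> card_subset_eq[OF finite_if_gain_edges[OF sub(2)]] card_spanning_tree B(1) B'(1)
    by metis
  then obtain e where e: "e \<in> B" "e \<notin> B'" by blast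
  then obtain f where f: "f \<in> B'" "f \<notin> B" and exchange: "spanning_tree n a b (insert f (B - {e}))"
    "spanning_tree n a b (insert e (B' - {f}))"
    using spanning_tree_symmetric_exchange[OF B(1) B'(1)] by blast
  have "e \<in> active_edges B" "f \<in> active_edges B'"
    using e f B(2,3) B'(2,3) by blast+
  then have "r e = r f"
    using rank_le_if_active exchange e f sub by (meson le_antisym subsetD)
  then have "e = f"
    using inj_rank e f sub by (meson inj_onD subsetD)
  then show False
    using e f by blast
qed

lemma active_completion_nbc:
  assumes "nbc_set r n a b F" "spanning_tree n a b B" "B - active_edges B \<subseteq> F"
  shows "nbc_basis r n a b B"
proof -
  have "\<not> broken_circuit_in r n a b B"
  proof
    assume "broken_circuit_in r n a b B"
    then obtain C e where C: "C \<subseteq> E" "balanced_circle C" "e \<in> C" "\<forall>f\<in>C. r e \<le> r f" "C - {e} \<subseteq> B"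
      unfolding broken_circuit_in_def by blast
    have "\<not> C - {e} \<subseteq> F"
      using C assms(1) unfolding nbc_set_def broken_circuit_in_def by blast
    then obtain f where f: "f \<in> C - {e}" "f \<in> active_edges B"
      using C(5) assms(3) by blast
    have "spanning_tree n a b (insert e (B - {f}))"
      by (rule spanning_tree_circle_exchange[OF assms(2)
            balanced_circle_is_circle[OF C(2)] C(1,3,5) f(1)])
    then have "r e = r f"
      using rank_le_if_active[OF f(2)] C f(1) by (meson DiffD1 le_antisym subsetD)
    then have "e = f" using inj_rank C f(1) by (auto dest: inj_onD)
    then show False using f(1) by simp
  qed
  then show ?thesis
    using assms(2) by (simp add: nbc_basis_def nbc_set_def spanning_tree_def)
qed

lemma nbc_basisD:
  assumes "nbc_basis r n a b B"
  shows "spanning_tree n a b B" "nbc_set r n a b B"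
  using assms by (auto simp: nbc_basis_def)

lemma active_interval_sum:
  fixes y :: "'a :: comm_ring_1"
  assumes "spanning_tree n a b B"
  shows "(\<Sum>F | B - active_edges B \<subseteq> F \<and> F \<subseteq> B. y ^ (n - 1 - card F)) = (1 + y) ^ activity r n a b B"
proof -
  have fin: "finite B"
    using assms finite_if_gain_edges by (auto simp: spanning_tree_def)
  have sub: "D \<subseteq> B" if "D \<in> Pow (active_edges B)" for D
    using that active_edges_subset by blast
  have "bij_betw (\<lambda>D. B - D) (Pow (active_edges B)) {F. B - active_edges B \<subseteq> F \<and> F \<subseteq> B}"
    by (rule bij_betw_byWitness[where f' = "\<lambda>F. B - F"]) (use active_edges_subset in auto)
  then have "(\<Sum>F | B - active_edges B \<subseteq> F \<and> F \<subseteq> B. y ^ (n - 1 - card F)) =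
      (\<Sum>D\<in>Pow (active_edges B). y ^ (n - 1 - card (B - D)))"
    by (rule sum.reindex_bij_betw[symmetric])
  also have "\<dots> = (\<Sum>D\<in>Pow (active_edges B). y ^ card D)"
  proof (rule sum.cong[OF refl])
    fix D assume "D \<in> Pow (active_edges B)"
    then have "card (B - D) + card D = n - 1"
      using fin card_spanning_tree[OF assms] sub
      by (metis card_Diff_subset card_mono finite_subset le_add_diff_inverse2)
    then show "y ^ (n - 1 - card (B - D)) = y ^ card D"
      by (metis add_diff_cancel_left')
  qed
  also have "\<dots> = (1 + y) ^ activity r n a b B"
    using sum_Pow_power_card[of "active_edges B" y] finite_subset[OF active_edges_subset fin]
    by (simp add: card_active_edges)
  finally show ?thesis .
qed

theorem nbc_sets_sum_activity:
  fixes y :: "'a :: comm_ring_1"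
  shows "(\<Sum>F | nbc_set r n a b F. y ^ (n - 1 - card F)) =
         (\<Sum>B | nbc_basis r n a b B. (1 + y) ^ activity r n a b B)"
proof -
  let ?I = "\<lambda>B. {F. B - active_edges B \<subseteq> F \<and> F \<subseteq> B}"
  let ?NB = "{B. nbc_basis r n a b B}"
  have fin: "finite (?I B)" if "B \<in> ?NB" for B
    using that finite_if_gain_edges[of B n a b]
    by (auto dest!: nbc_basisD(1) simp: spanning_tree_def)
  have union: "{F. nbc_set r n a b F} = (\<Union>B\<in>?NB. ?I B)"
  proof (intro equalityI subsetI)
    fix F assume "F \<in> {F. nbc_set r n a b F}"
    then have F: "nbc_set r n a b F" by simp
    then obtain B where "spanning_tree n a b B" "F \<subseteq> B" "B - active_edges B \<subseteq> F"
      using active_completion_exists[of F] by (auto simp: nbc_set_def)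
    then show "F \<in> (\<Union>B\<in>?NB. ?I B)"
      using active_completion_nbc[OF F] by blast
  qed (auto dest: nbc_basisD nbc_set_mono)
  have disjoint: "?I B \<inter> ?I B' = {}" if "B \<in> ?NB" "B' \<in> ?NB" "B \<noteq> B'" for B B'
    using active_completion_unique[of B _ B'] that by (auto dest!: nbc_basisD(1))
  have "(\<Sum>F | nbc_set r n a b F. y ^ (n - 1 - card F)) =
      (\<Sum>B\<in>?NB. \<Sum>F\<in>?I B. y ^ (n - 1 - card F))"
    unfolding union using disjoint fin by (intro sum.UNION_disjoint) auto
  also have "\<dots> = (\<Sum>B\<in>?NB. (1 + y) ^ activity r n a b B)"
    by (intro sum.cong[OF refl] active_interval_sum) (auto dest: nbc_basisD)
  finally show ?thesis .
qed

corollary nbc_sets_alternating_sum_activity: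
  fixes q :: "'a :: comm_ring_1"
  shows "(-1) ^ (n - 1) * (\<Sum>F | nbc_set r n a b F. (-1) ^ card F * q ^ (n - 1 - card F)) =
         (\<Sum>B | nbc_basis r n a b B. (1 - q) ^ activity r n a b B)"
proof -
  have "(-1) ^ (n - 1) * ((-1) ^ card F * q ^ (n - 1 - card F)) = (- q) ^ (n - 1 - card F)"
    if "nbc_set r n a b F" for F
  proof -
    have "card F \<le> n - 1"
      using that forest_card_le n_pos by (auto simp: nbc_set_def)
    then obtain k where k: "n - 1 = card F + k"
      using le_Suc_ex by blast
    have "(-1 :: 'a) ^ (n - 1) * (-1) ^ card F = (-1) ^ k"
      unfolding k power_add mult.assoc mult.commute[of "(-1) ^ k"]
      by (simp flip: mult.assoc power_mult_distrib)
    then show ?thesis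
      by (simp only: k mult.assoc[symmetric] add_diff_cancel_left' power_minus[of q k])
  qed
  then have "(-1) ^ (n - 1) * (\<Sum>F | nbc_set r n a b F. (-1) ^ card F * q ^ (n - 1 - card F)) =
      (\<Sum>F | nbc_set r n a b F. (- q) ^ (n - 1 - card F))"
    unfolding sum_distrib_left by (intro sum.cong) auto
  then show ?thesis
    using nbc_sets_sum_activity[of "- q"] by simp
qed

lemma nbc_set_insert_least:
  assumes X: "X \<subseteq> E" "e \<in> X" "\<And>f. f \<in> X \<Longrightarrow> r e \<le> r f"
    and balanced: "\<And>C. C \<subseteq> X \<Longrightarrow> is_circle C \<Longrightarrow> balanced_circle C"
    and closed: "\<And>C e. C \<subseteq> E \<Longrightarrow> balanced_circle C \<Longrightarrow> e \<in> C \<Longrightarrow> C - {e} \<subseteq> X \<Longrightarrow> e \<in> X"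
    and F: "nbc_set r n a b F" "F \<subseteq> X"
  shows "nbc_set r n a b (insert e F)"
proof -
  have "\<not> broken_circuit_in r n a b (insert e F)"
  proof
    assume "broken_circuit_in r n a b (insert e F)"
    then obtain C f where C: "C \<subseteq> E" "balanced_circle C" "f \<in> C" "\<forall>g\<in>C. r f \<le> r g"
      "C - {f} \<subseteq> insert e F"
      unfolding broken_circuit_in_def by blast
    then have "f \<in> X"
      using closed F(2) X(2) by blast
    have "e \<in> C - {f}"
      using C F(1) unfolding nbc_set_def broken_circuit_in_def by blast
    then have "r f = r e"
      using C(4) X(3)[OF \<open>f \<in> X\<close>] by (simp add: order_antisym)
    then have "f = e"
      using inj_rank \<open>f \<in> X\<close> X(1,2) by (meson inj_onD subsetD)
    then show False using \<open>e \<in> C - {f}\<close> by simp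
  qed
  moreover have "is_forest (insert e F)"
    unfolding is_forest_def
  proof (rule notI, elim exE conjE)
    fix C assume C: "C \<subseteq> insert e F" "is_circle C"
    have "e \<in> C"
      using C F(1) unfolding nbc_set_def is_forest_def by blast
    moreover have "C \<subseteq> X" using C F(2) X(2) by blast
    ultimately have "broken_circuit_in r n a b F"
      using balanced[OF \<open>C \<subseteq> X\<close> C(2)] C(1) X(1,3) unfolding broken_circuit_in_def by blast
    then show False using F(1) by (simp add: nbc_set_def)
  qed
  ultimately show ?thesis
    using F X(1,2) unfolding nbc_set_def by blast
qed

lemma nbc_subsets_alternating_sum_0:
  assumes X: "X \<subseteq> E" "X \<noteq> {}"
    and balanced: "\<And>C. C \<subseteq> X \<Longrightarrow> is_circle C \<Longrightarrow> balanced_circle C"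
    and closed: "\<And>C e. C \<subseteq> E \<Longrightarrow> balanced_circle C \<Longrightarrow> e \<in> C \<Longrightarrow> C - {e} \<subseteq> X \<Longrightarrow> e \<in> X"
  shows "(\<Sum>F | nbc_set r n a b F \<and> F \<subseteq> X. (-1 :: 'a :: comm_ring_1) ^ card F) = 0"
proof -
  obtain e where e: "e \<in> X" "\<And>f. f \<in> X \<Longrightarrow> r e \<le> r f"
    using ex_has_least_nat[of "\<lambda>e. e \<in> X" _ r] X(2) by blast
  have fin: "finite X"
    using X(1) by (rule finite_if_gain_edges)
  let ?w = "\<lambda>F. if nbc_set r n a b F then (-1 :: 'a) ^ card F else 0"
  have "?w F + ?w (insert e F) = 0" if F: "F \<in> Pow (X - {e})" for F
  proof -
    have "nbc_set r n a b (insert e F) \<longleftrightarrow> nbc_set r n a b F"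
    proof
      assume "nbc_set r n a b F"
      then show "nbc_set r n a b (insert e F)"
        using F by (intro nbc_set_insert_least[OF X(1) e balanced closed]) auto
    qed (rule nbc_set_mono, auto)
    moreover have "card (insert e F) = Suc (card F)"
      using F fin finite_subset[of F X] by (intro card_insert_disjoint) auto
    ultimately show ?thesis by simp
  qed
  then have "(\<Sum>F\<in>Pow (insert e (X - {e})). ?w F) = 0"
    using fin by (simp add: sum_Pow_insert del: insert_Diff_single)
  then have "(\<Sum>F\<in>Pow X. ?w F) = 0"
    using e(1) by (simp add: insert_absorb)
  then show ?thesis
    using fin by (simp add: sum.inter_filter[symmetric] conj_commute)
qed

end

section \<open>Counting solutions modulo q\<close>

definition slack :: "(nat \<Rightarrow> 'a :: comm_ring_1) \<Rightarrow> gedge \<Rightarrow> 'a" where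
  "slack x e = x (fst (snd e)) - x (fst e) - of_int (gain e)"

lemma slack_edge: "slack x (i, j, g) = x j - x i - of_int g"
  by (simp add: slack_def gain_def)

definition shift :: "nat set \<Rightarrow> 'a \<Rightarrow> (nat \<Rightarrow> 'a) \<Rightarrow> nat \<Rightarrow> 'a :: comm_ring_1" where
  "shift C t x v = x v + t * of_bool (v \<in> C)"

lemma slack_shift:
  "slack (shift C t x) (i, j, g) = slack x (i, j, g) + t * (of_bool (j \<in> C) - of_bool (i \<in> C))"
  by (simp add: slack_edge shift_def algebra_simps)

lemma sum_lessThan_cyclic: "(\<Sum>k<m. f (Suc k mod m)) = (\<Sum>k<m. f k :: 'a :: comm_monoid_add)"
proof (cases m)
  case (Suc p)
  have "(\<Sum>k<m. f (Suc k mod m)) = (\<Sum>k<p. f (Suc k)) + f 0"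
    by (simp add: Suc)
  also have "\<dots> = (\<Sum>k<m. f k)"
    unfolding Suc sum.lessThan_Suc_shift by (simp add: add.commute)
  finally show ?thesis .
qed simp

definition walk_sign :: "nat list \<Rightarrow> gedge list \<Rightarrow> nat \<Rightarrow> 'a :: comm_ring_1" where
  "walk_sign vs es k = (if vs ! k = fst (es ! k) then 1 else -1)"

lemma circle_walk_slack_sum:
  fixes x :: "nat \<Rightarrow> 'a :: comm_ring_1"
  assumes walk: "circle_walk vs es" and no_loop: "\<And>e. e \<in> set es \<Longrightarrow> fst e \<noteq> fst (snd e)"
  shows "(\<Sum>k<length vs. walk_sign vs es k * slack x (es ! k)) =
         - of_int (\<Sum>k<length vs. dgain (es ! k) (vs ! k))"
proof -
  define m where "m = length vs"
  have step: "walk_sign vs es k * slack x (es ! k) =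
      x (vs ! (Suc k mod m)) - x (vs ! k) - of_int (dgain (es ! k) (vs ! k))" if k: "k < m" for k
  proof -
    have "es ! k \<in> set es" and ends: "ends (es ! k) = {vs ! k, vs ! (Suc k mod m)}"
      using walk k by (auto simp: circle_walk_def m_def)
    then have neq: "fst (es ! k) \<noteq> fst (snd (es ! k))"
      using no_loop by blast
    consider (forward) "vs ! k = fst (es ! k)" "vs ! (Suc k mod m) = fst (snd (es ! k))"
      | (backward) "vs ! k = fst (snd (es ! k))" "vs ! (Suc k mod m) = fst (es ! k)"
      using ends unfolding ends_def doubleton_eq_iff by metis
    then show ?thesis
    proof cases
      case forward
      then show ?thesis
        by (simp only: walk_sign_def dgain_def slack_def simp_thms if_True mult_1)
    next
      case backward
      then show ?thesis
        using neq by (simp add: walk_sign_def dgain_def slack_def)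
    qed
  qed
  have "(\<Sum>k<m. walk_sign vs es k * slack x (es ! k)) =
      (\<Sum>k<m. x (vs ! (Suc k mod m)) - x (vs ! k) - of_int (dgain (es ! k) (vs ! k)))"
    by (rule sum.cong) (use step in auto)
  also have "\<dots> = - of_int (\<Sum>k<m. dgain (es ! k) (vs ! k))"
    by (simp add: sum_subtractf sum_lessThan_cyclic[of "\<lambda>k. x (vs ! k)"])
  finally show ?thesis
    by (simp add: m_def)
qed

context gain_graph
begin

lemma edge_no_loop: "e \<in> E \<Longrightarrow> fst e \<noteq> fst (snd e)"
  by (auto simp: gain_edges_def)

lemma balanced_circle_slack_dvd:
  fixes q :: "'a :: comm_ring_1"
  assumes "C \<subseteq> E" "balanced_circle C" "e \<in> C" "\<forall>f\<in>C - {e}. q dvd slack x f"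
  shows "q dvd slack x e"
proof -
  obtain vs es where walk: "circle_walk vs es" "C = set es"
    and zero: "(\<Sum>k<length vs. dgain (es ! k) (vs ! k)) = 0"
    using assms(2) by (auto simp: balanced_circle_def)
  define summand where "summand = (\<lambda>k. walk_sign vs es k * slack x (es ! k))"
  have len: "length es = length vs" "distinct es"
    using walk(1) by (auto simp: circle_walk_def)
  obtain k where k: "k < length vs" "e = es ! k"
    using assms(3) walk(2) len(1) by (metis in_set_conv_nth)
  have "fst f \<noteq> fst (snd f)" if "f \<in> set es" for f
    using edge_no_loop assms(1) walk(2) that by blast
  then have "(\<Sum>l<length vs. summand l) = 0"
    unfolding summand_def by (simp add: circle_walk_slack_sum[OF walk(1)] zero)
  then have "summand k = - (\<Sum>l\<in>{..<length vs} - {k}. summand l)"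
    using k sum.remove[of "{..<length vs}" k summand] by (simp add: eq_neg_iff_add_eq_0)
  moreover have "q dvd (\<Sum>l\<in>{..<length vs} - {k}. summand l)"
  proof (rule dvd_sum)
    fix l assume l: "l \<in> {..<length vs} - {k}"
    then have "es ! l \<in> C - {e}"
      using len k walk(2) by (auto simp: nth_eq_iff_index_eq)
    then show "q dvd summand l"
      using assms(4) unfolding summand_def by (intro dvd_mult) blast
  qed
  ultimately have "q dvd walk_sign vs es k * slack x e"
    by (simp add: summand_def k(2))
  then show ?thesis
    by (auto simp: walk_sign_def split: if_splits)
qed

lemma circle_walk_gain_bound:
  assumes "circle_walk vs es" "set es \<subseteq> E"
  shows "\<bar>\<Sum>k<length vs. dgain (es ! k) (vs ! k)\<bar> \<le> int n * (\<bar>a\<bar> + \<bar>b\<bar>)"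
proof -
  have walk: "length es = length vs" "distinct vs"
    "\<And>k. k < length vs \<Longrightarrow> vs ! k \<in> ends (es ! k)"
    using assms(1) by (auto simp: circle_walk_def)
  have edge: "es ! k \<in> E" if "k < length vs" for k
    using that walk(1) assms(2) by auto
  have "set vs \<subseteq> {1..n}"
  proof
    fix v assume "v \<in> set vs"
    then obtain k where "k < length vs" "v = vs ! k"
      by (metis in_set_conv_nth)
    then show "v \<in> {1..n}"
      using walk(3)[of k] edge[of k] by (auto simp: ends_def gain_edges_def)
  qed
  then have "length vs \<le> n"
    using distinct_card[OF walk(2)] card_mono[of "{1..n}" "set vs"] by simp
  have "\<bar>dgain (es ! k) (vs ! k)\<bar> \<le> \<bar>a\<bar> + \<bar>b\<bar>" if "k < length vs" for k
    using edge[OF that] by (auto simp: dgain_def gain_def gain_edges_def)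
  then have "(\<Sum>k<length vs. \<bar>dgain (es ! k) (vs ! k)\<bar>) \<le> (\<Sum>k<length vs. \<bar>a\<bar> + \<bar>b\<bar>)"
    by (intro sum_mono) auto
  also have "\<dots> \<le> int n * (\<bar>a\<bar> + \<bar>b\<bar>)"
    using \<open>length vs \<le> n\<close> by (simp add: mult_right_mono)
  finally show ?thesis
    using sum_abs[of "\<lambda>k. dgain (es ! k) (vs ! k)" "{..<length vs}"] by linarith
qed

text \<open>A circle that is balanced modulo such a q is balanced. Both uses matter: a large integer q
  for the finite field method, and q = 0 over the reals, where divisibility means vanishing.\<close>

definition large_modulus :: "'a :: comm_ring_1 \<Rightarrow> bool" where
  "large_modulus q \<longleftrightarrow> (\<forall>s :: int. q dvd of_int s \<and> \<bar>s\<bar> \<le> int n * (\<bar>a\<bar> + \<bar>b\<bar>) \<longrightarrow> s = 0)"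

lemma large_modulus_real_0: "large_modulus (0 :: real)"
  by (simp add: large_modulus_def)

lemma large_modulus_int: "int n * (\<bar>a\<bar> + \<bar>b\<bar>) < q \<Longrightarrow> large_modulus (q :: int)"
  unfolding large_modulus_def using zdvd_imp_le[of q "\<bar>s\<bar>" for s] by force

lemma circle_balanced_if_dvd:
  fixes q :: "'a :: comm_ring_1"
  assumes "C \<subseteq> E" "is_circle C" "\<forall>f\<in>C. q dvd slack x f" "large_modulus q"
  shows "balanced_circle C"
proof -
  obtain vs es where walk: "circle_walk vs es" "C = set es"
    using assms(2) by (auto simp: is_circle_def)
  let ?s = "\<Sum>k<length vs. dgain (es ! k) (vs ! k)"
  have "length es = length vs"
    using walk(1) by (auto simp: circle_walk_def)
  then have "q dvd (\<Sum>k<length vs. walk_sign vs es k * slack x (es ! k))"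
    by (intro dvd_sum dvd_mult) (use assms(3) walk(2) in auto)
  moreover have "(\<Sum>k<length vs. walk_sign vs es k * slack x (es ! k)) = - of_int ?s"
    by (rule circle_walk_slack_sum[OF walk(1)]) (use edge_no_loop assms(1) walk(2) in blast)
  ultimately have "q dvd of_int ?s"
    by (simp only: dvd_minus_iff)
  then have "?s = 0"
    using circle_walk_gain_bound[OF walk(1)] assms(1,4) walk(2) unfolding large_modulus_def by blast
  then show ?thesis
    using walk by (auto simp: balanced_circle_def)
qed

definition flat_of :: "'a :: comm_ring_1 \<Rightarrow> (nat \<Rightarrow> 'a) set \<Rightarrow> gedge set" where
  "flat_of q Z = {e \<in> E. \<forall>x\<in>Z. q dvd slack x e}"

lemma flat_of_subset: "flat_of q Z \<subseteq> E"
  by (auto simp: flat_of_def)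

end

lemma (in ordered_gain_graph) nbc_alternating_sum_flat:
  fixes q :: "'a :: comm_ring_1"
  assumes "Z \<noteq> {}" and large: "large_modulus q"
  shows "(\<Sum>F | nbc_set r n a b F \<and> F \<subseteq> flat_of q Z. (-1 :: 'b :: comm_ring_1) ^ card F) =
         of_bool (flat_of q Z = {})"
proof (cases "flat_of q Z = {}")
  case True
  then have "{F. nbc_set r n a b F \<and> F \<subseteq> flat_of q Z} = {{}}"
    using nbc_set_empty by auto
  then show ?thesis
    using True by simp
next
  case False
  obtain x where x: "x \<in> Z" using assms(1) by blast
  have "(\<Sum>F | nbc_set r n a b F \<and> F \<subseteq> flat_of q Z. (-1 :: 'b) ^ card F) = 0"
  proof (rule nbc_subsets_alternating_sum_0[OF flat_of_subset False])
    show "balanced_circle C" if C: "C \<subseteq> flat_of q Z" "is_circle C" for C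
    proof (rule circle_balanced_if_dvd[OF _ C(2) _ large])
      show "C \<subseteq> E" "\<forall>f\<in>C. q dvd slack x f"
        using C(1) x by (auto simp: flat_of_def)
    qed
    show "e \<in> flat_of q Z" if C: "C \<subseteq> E" "balanced_circle C" "e \<in> C" "C - {e} \<subseteq> flat_of q Z" for C e
    proof -
      have "q dvd slack y e" if "y \<in> Z" for y
        by (rule balanced_circle_slack_dvd[OF C(1-3)]) (use C(4) that in \<open>auto simp: flat_of_def\<close>)
      then show ?thesis
        using C by (auto simp: flat_of_def)
    qed
  qed
  then show ?thesis
    using False by simp
qed

context gain_graph
begin

text \<open>Potentials modulo q up to a constant, normalized by the value 0 at the vertex n.\<close>

definition residue_vectors :: "int \<Rightarrow> (nat \<Rightarrow> int) set" where
  "residue_vectors q = {x. \<forall>v. (v \<in> {1..<n} \<longrightarrow> x v \<in> {0..<q}) \<and> (v \<notin> {1..<n} \<longrightarrow> x v = 0)}"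

definition mod_solutions :: "int \<Rightarrow> gedge set \<Rightarrow> (nat \<Rightarrow> int) set" where
  "mod_solutions q F = {x \<in> residue_vectors q. \<forall>e\<in>F. q dvd slack x e}"

definition proper_vectors :: "int \<Rightarrow> (nat \<Rightarrow> int) set" where
  "proper_vectors q = {x \<in> residue_vectors q. \<forall>e\<in>E. \<not> q dvd slack x e}"

lemma finite_residue_vectors [simp]: "finite (residue_vectors q)"
  unfolding residue_vectors_def by (rule finite_set_of_finite_funs) auto

lemma finite_mod_solutions [simp]: "finite (mod_solutions q F)"
  by (simp add: mod_solutions_def)

lemma card_residue_vectors: "card (residue_vectors q) = nat q ^ (n - 1)"
proof -
  have "bij_betw (\<lambda>g v. if v \<in> {1..<n} then g v else 0)
      (PiE {1..<n} (\<lambda>_. {0..<q})) (residue_vectors q)"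
    by (rule bij_betw_byWitness[where f' = "\<lambda>x. restrict x {1..<n}"])
      (auto simp: residue_vectors_def fun_eq_iff PiE_def extensional_def)
  then have "card (residue_vectors q) = card (PiE {1..<n} (\<lambda>_. {0..<q}))"
    by (rule bij_betw_same_card[symmetric])
  then show ?thesis
    by (simp add: card_PiE)
qed

definition shift_mod :: "int \<Rightarrow> nat set \<Rightarrow> int \<Rightarrow> (nat \<Rightarrow> int) \<Rightarrow> nat \<Rightarrow> int" where
  "shift_mod q C t x v = shift C t x v mod q"

lemma slack_shift_mod:
  "slack (shift_mod q C t x) (i, j, g) mod q =
   (slack x (i, j, g) + t * (of_bool (j \<in> C) - of_bool (i \<in> C))) mod q"
proof -
  have "slack (shift_mod q C t x) (i, j, g) mod q = slack (shift C t x) (i, j, g) mod q"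
    unfolding slack_edge shift_mod_def by (rule mod_diff_cong[OF mod_diff_eq refl])
  then show ?thesis
    by (simp only: slack_shift)
qed

lemma shift_mod_residue_vectors:
  "0 < q \<Longrightarrow> C \<subseteq> {1..<n} \<Longrightarrow> x \<in> residue_vectors q \<Longrightarrow> shift_mod q C t x \<in> residue_vectors q"
  by (auto simp: residue_vectors_def shift_mod_def shift_def)

lemma shift_mod_inverse:
  assumes "0 < q" "x \<in> residue_vectors q"
  shows "shift_mod q C (- t) (shift_mod q C t x) = x"
proof
  fix v
  have "x v mod q = x v"
    using assms by (cases "v \<in> {1..<n}") (auto simp: residue_vectors_def)
  then show "shift_mod q C (- t) (shift_mod q C t x) v = x v"
    by (simp add: shift_mod_def shift_def mod_simps)
qed

lemma conn_verts:
  assumes "F \<subseteq> E" "(u, w) \<in> conn F" "u \<in> {1..n}"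
  shows "w \<in> {1..n}"
  using assms(2) unfolding conn_def
proof (induction rule: rtrancl_induct)
  case (step v w)
  then obtain e where "e \<in> F" "w \<in> ends e"
    by (auto simp: adj_def)
  then show ?case
    using assms(1) by (auto simp: ends_def gain_edges_def)
qed (rule assms(3))

lemma separating_component:
  assumes F: "F \<subseteq> E" and ij: "i \<in> {1..n}" "j \<in> {1..n}" "(i, j) \<notin> conn F"
  obtains C where "C \<subseteq> {1..<n}" "i \<in> C \<longleftrightarrow> j \<notin> C"
    "\<And>i' j' g'. (i', j', g') \<in> F \<Longrightarrow> i' \<in> C \<longleftrightarrow> j' \<in> C"
proof -
  have "(i, n) \<notin> conn F \<or> (j, n) \<notin> conn F"
    using ij(3) by (meson conn_sym conn_trans)
  then obtain v where v: "v = i \<or> v = j" "(v, n) \<notin> conn F"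
    by blast
  let ?C = "conn F `` {v}"
  have "v \<in> {1..n}"
    using v(1) ij by blast
  then have "?C \<subseteq> {1..n} - {n}"
    using conn_verts[OF F] v(2) by blast
  also have "\<dots> = {1..<n}" by auto
  finally have "?C \<subseteq> {1..<n}" .
  moreover have "i \<in> ?C \<longleftrightarrow> j \<notin> ?C"
    using v(1) ij(3) conn_sym by auto
  moreover have "i' \<in> ?C \<longleftrightarrow> j' \<in> ?C" if "(i', j', g') \<in> F" for i' j' g'
    using that by (rule conn_class_edge)
  ultimately show ?thesis
    by (rule that)
qed

lemma shift_mod_mod_solutions:
  assumes "0 < q" "C \<subseteq> {1..<n}" "\<And>i j g. (i, j, g) \<in> F \<Longrightarrow> i \<in> C \<longleftrightarrow> j \<in> C"
    and x: "x \<in> mod_solutions q F"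
  shows "shift_mod q C t x \<in> mod_solutions q F"
proof -
  have "q dvd slack (shift_mod q C t x) f" if f: "f \<in> F" for f
  proof -
    obtain i j g where "f = (i, j, g)" by (cases f)
    then have "slack (shift_mod q C t x) f mod q = slack x f mod q"
      using slack_shift_mod[of q C t x i j g] assms(3)[of i j g] f by simp
    then show ?thesis
      using x f by (simp add: mod_solutions_def dvd_eq_mod_eq_0)
  qed
  then show ?thesis
    using assms(1,2) x by (simp add: mod_solutions_def shift_mod_residue_vectors)
qed

text \<open>Shifting by t along a separating set of vertices moves the residue of the slack of the new
  edge by t, so all residues are taken equally often.\<close>

lemma card_mod_solutions_insert:
  assumes q: "0 < q" and F: "F \<subseteq> E" and e: "(i, j, g) \<in> E" "(i, j) \<notin> conn F"
  shows "card (mod_solutions q F) = nat q * card (mod_solutions q (insert (i, j, g) F))"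
proof -
  obtain C where C: "C \<subseteq> {1..<n}" "i \<in> C \<longleftrightarrow> j \<notin> C"
    and closed: "\<And>i' j' g'. (i', j', g') \<in> F \<Longrightarrow> i' \<in> C \<longleftrightarrow> j' \<in> C"
    by (rule separating_component[OF F edge_verts(1,2)[OF e(1)] e(2)]) (rule that)
  define \<epsilon> :: int where "\<epsilon> = of_bool (j \<in> C) - of_bool (i \<in> C)"
  have \<epsilon>: "\<epsilon> = 1 \<or> \<epsilon> = -1"
    using C(2) by (auto simp: \<epsilon>_def)
  define residue where "residue x = \<epsilon> * slack x (i, j, g) mod q" for x
  define fibre where "fibre t = {x \<in> mod_solutions q F. residue x = t}" for t
  have residue_shift: "residue (shift_mod q C t x) = (residue x + t) mod q" for t x
  proof -
    have "residue (shift_mod q C t x) = \<epsilon> * (slack x (i, j, g) + t * \<epsilon>) mod q"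
      unfolding residue_def \<epsilon>_def by (metis slack_shift_mod mod_mult_right_eq)
    also have "\<epsilon> * (slack x (i, j, g) + t * \<epsilon>) = \<epsilon> * slack x (i, j, g) + t"
      using \<epsilon> by auto
    finally show ?thesis
      by (simp add: residue_def mod_simps)
  qed
  have "bij_betw (shift_mod q C t) (fibre 0) (fibre t)" if t: "t \<in> {0..<q}" for t
  proof (rule bij_betw_byWitness[where f' = "shift_mod q C (- t)"])
    show "\<forall>x\<in>fibre 0. shift_mod q C (- t) (shift_mod q C t x) = x"
      "\<forall>x\<in>fibre t. shift_mod q C t (shift_mod q C (- t) x) = x"
      using shift_mod_inverse[OF q, of _ C t] shift_mod_inverse[OF q, of _ C "- t"]
      by (auto simp: fibre_def mod_solutions_def)
    show "shift_mod q C t ` fibre 0 \<subseteq> fibre t" "shift_mod q C (- t) ` fibre t \<subseteq> fibre 0"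
      using shift_mod_mod_solutions[OF q C(1) closed] residue_shift t by (auto simp: fibre_def)
  qed
  then have "card (fibre t) = card (fibre 0)" if "t \<in> {0..<q}" for t
    using that bij_betw_same_card by metis
  moreover have "card (mod_solutions q F) = (\<Sum>t\<in>{0..<q}. card (fibre t))"
    using sum.group[of "mod_solutions q F" "{0..<q}" residue "\<lambda>_. 1 :: nat"] q
    by (force simp: fibre_def residue_def)
  moreover have "fibre 0 = mod_solutions q (insert (i, j, g) F)"
    using \<epsilon> by (auto simp: fibre_def mod_solutions_def residue_def dvd_eq_mod_eq_0[symmetric])
  ultimately show ?thesis
    by simp
qed

lemma card_mod_solutions_forest:
  assumes q: "0 < q" and "F \<subseteq> E" "is_forest F"
  shows "card (mod_solutions q F) = nat q ^ (n - 1 - card F)"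
  using finite_if_gain_edges[OF assms(2)] assms(2,3)
proof (induction F)
  case empty
  then show ?case
    by (simp add: mod_solutions_def card_residue_vectors)
next
  case (insert e F)
  obtain i j g where e: "e = (i, j, g)" by (cases e)
  have F: "is_forest F" "F \<subseteq> E" and eE: "(i, j, g) \<in> E"
    using insert.prems e by (auto intro: is_forest_mono)
  have "(i, j) \<notin> conn F"
    using is_forest_insert[of F i j g] insert e F edge_verts[OF eE] by auto
  then have "nat q * card (mod_solutions q (insert e F)) = nat q ^ (n - 1 - card F)"
    using card_mod_solutions_insert[OF q F(2) eE] insert.IH F e by simp
  moreover have "n - 1 - card F = Suc (n - 1 - card (insert e F))"
    using forest_card_le[OF insert.prems n_pos] insert.hyps by simp
  ultimately show ?case
    using q by simp
qed

end

text \<open>The finite field method: q need not be prime.\<close>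

theorem (in ordered_gain_graph) card_proper_vectors:
  assumes q: "int n * (\<bar>a\<bar> + \<bar>b\<bar>) < q"
  shows "int (card (proper_vectors q)) =
         (\<Sum>F | nbc_set r n a b F. (-1) ^ card F * q ^ (n - 1 - card F))"
proof -
  have "0 \<le> int n * (\<bar>a\<bar> + \<bar>b\<bar>)" by simp
  then have q_pos: "0 < q" using q by linarith
  have "int (card (proper_vectors q)) = (\<Sum>x\<in>residue_vectors q. of_bool (flat_of q {x} = {}))"
  proof -
    have "proper_vectors q = residue_vectors q \<inter> {x. flat_of q {x} = {}}"
      by (auto simp: proper_vectors_def flat_of_def)
    then show ?thesis by simp
  qed
  also have "\<dots> = (\<Sum>x\<in>residue_vectors q. \<Sum>F | nbc_set r n a b F \<and> F \<subseteq> flat_of q {x}. (-1) ^ card F)"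
    by (simp add: nbc_alternating_sum_flat large_modulus_int[OF q])
  also have "\<dots> =
      (\<Sum>F | nbc_set r n a b F. \<Sum>x | x \<in> residue_vectors q \<and> F \<subseteq> flat_of q {x}. (-1) ^ card F)"
    using sum.swap_restrict[of "residue_vectors q" "{F. nbc_set r n a b F}"
        "\<lambda>x F. (-1 :: int) ^ card F" "\<lambda>x F. F \<subseteq> flat_of q {x}"] by simp
  also have "\<dots> = (\<Sum>F | nbc_set r n a b F. (-1) ^ card F * q ^ (n - 1 - card F))"
  proof (rule sum.cong[OF refl])
    fix F assume "F \<in> {F. nbc_set r n a b F}"
    then have F: "F \<subseteq> E" "is_forest F" by (auto simp: nbc_set_def)
    have "{x. x \<in> residue_vectors q \<and> F \<subseteq> flat_of q {x}} = mod_solutions q F"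
      using F(1) by (auto simp: mod_solutions_def flat_of_def)
    then show "(\<Sum>x | x \<in> residue_vectors q \<and> F \<subseteq> flat_of q {x}. (-1) ^ card F) =
        (-1) ^ card F * q ^ (n - 1 - card F)"
      using card_mod_solutions_forest[OF q_pos F] q_pos by simp
  qed
  finally show ?thesis .
qed

section \<open>Permutations by ascents\<close>

fun ascents :: "'a :: linorder list \<Rightarrow> nat" where
  "ascents [] = 0"
| "ascents [u] = 0"
| "ascents (u # v # w) = of_bool (u < v) + ascents (v # w)"

lemma ascents_le: "ascents w \<le> length w - 1"
  by (induction w rule: ascents.induct) auto

lemma sum_ascents_insert_greatest:
  fixes h :: "nat \<Rightarrow> 'b :: comm_semiring_1"
  assumes "\<forall>u\<in>set w. u < N"
  shows "(\<Sum>p\<le>length w. h (ascents (take p w @ N # drop p w))) =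
         of_nat (Suc (ascents w)) * h (ascents w) +
         of_nat (length w - ascents w) * h (Suc (ascents w))"
  using assms
proof (induction w arbitrary: h rule: ascents.induct)
  case (3 u v w)
  define c d where "c = ascents (v # w)" and "d = (of_bool (u < v) :: nat)"
  have less: "u < N" "v < N" "\<not> N < u" "\<not> N < v" using 3 by auto
  have length_diff: "Suc (length w) - c = Suc (length w - c)"
    "Suc (Suc (length w)) - c = Suc (Suc (length w - c))"
    using ascents_le[of "v # w"] by (simp_all add: c_def Suc_diff_le)
  let ?later = "\<Sum>p\<le>length w. h (d + ascents (v # take p w @ N # drop p w))"
  have "(\<Sum>p\<le>length (v # w). h (d + ascents (take p (v # w) @ N # drop p (v # w)))) =
      h (d + c) + ?later"
    using less by (simp add: sum.atMost_Suc_shift c_def del: sum.atMost_Suc)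
  then have "h (d + c) + ?later =
      of_nat (Suc c) * h (d + c) + of_nat (Suc (length w - c)) * h (d + Suc c)"
    using "3.IH"[of "\<lambda>x. h (d + x)"] 3(2) length_diff by (simp add: c_def)
  moreover have
    "(\<Sum>p\<le>length (u # v # w). h (ascents (take p (u # v # w) @ N # drop p (u # v # w)))) =
      h (Suc c) + (h (d + c) + ?later)"
    using less by (simp add: sum.atMost_Suc_shift c_def d_def add_ac del: sum.atMost_Suc)
  ultimately show ?case
    using length_diff by (cases "u < v") (simp_all add: c_def[symmetric] d_def algebra_simps)
qed auto

lemma bij_betw_insert_permutations_of_set:
  assumes "finite A" "x \<notin> A"
  shows "bij_betw (\<lambda>(w, p). take p w @ x # drop p w) (permutations_of_set A \<times> {..card A})
           (permutations_of_set (insert x A))"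
proof -
  let ?ins = "\<lambda>(w, p). take p w @ x # drop p w" and ?S = "permutations_of_set A \<times> {..card A}"
  have perm: "x \<notin> set w" "length w = card A" if "w \<in> permutations_of_set A" for w
    using that assms(2) by (auto simp: permutations_of_set_def distinct_card)
  have inj: "inj_on ?ins ?S"
  proof (rule inj_on_inverseI[where g = "\<lambda>w. (remove1 x w, length (takeWhile (\<lambda>u. u \<noteq> x) w))"])
    fix wp assume "wp \<in> ?S"
    then obtain w p where wp: "wp = (w, p)" "w \<in> permutations_of_set A" "p \<le> length w"
      using perm by auto
    have "x \<notin> set (take p w)"
      using perm(1)[OF wp(2)] in_set_takeD by fast
    moreover from this have "takeWhile (\<lambda>u. u \<noteq> x) (take p w @ x # drop p w) = take p w"
      by (subst takeWhile_append2) auto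
    ultimately show "(remove1 x (?ins wp), length (takeWhile (\<lambda>u. u \<noteq> x) (?ins wp))) = wp"
      using wp by (simp add: remove1_append)
  qed
  have sub: "?ins ` ?S \<subseteq> permutations_of_set (insert x A)"
  proof (rule image_subsetI)
    fix wp assume "wp \<in> ?S"
    then obtain w p where wp: "wp = (w, p)" "w \<in> permutations_of_set A" by auto
    have "set (take p w @ drop p w) = A" "distinct (take p w @ drop p w)"
      using wp(2) by (simp_all only: append_take_drop_id permutations_of_setD)
    then show "?ins wp \<in> permutations_of_set (insert x A)"
      using assms(2) by (auto simp: wp(1) permutations_of_set_def simp del: append_take_drop_id)
  qed
  have "card ?S = card (permutations_of_set (insert x A))"
    using assms by (simp add: card_cartesian_product)
  then have "?ins ` ?S = permutations_of_set (insert x A)"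
    using card_subset_eq[OF finite_permutations_of_set sub] card_image[OF inj] by simp
  then show ?thesis
    using inj by (simp add: bij_betw_def)
qed

lemma sum_ascents_permutations_insert:
  fixes h :: "nat \<Rightarrow> 'b :: comm_semiring_1"
  assumes "finite A" "\<forall>u\<in>A. u < N"
  shows "(\<Sum>w\<in>permutations_of_set (insert N A). h (ascents w)) =
         (\<Sum>w\<in>permutations_of_set A. of_nat (Suc (ascents w)) * h (ascents w) +
            of_nat (card A - ascents w) * h (Suc (ascents w)))"
proof -
  have "N \<notin> A" using assms(2) by blast
  note bij = bij_betw_insert_permutations_of_set[OF assms(1) this]
  have "(\<Sum>w\<in>permutations_of_set (insert N A). h (ascents w)) =
      (\<Sum>(w, p)\<in>permutations_of_set A \<times> {..card A}. h (ascents (take p w @ N # drop p w)))"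
    by (subst sum.reindex_bij_betw[OF bij, symmetric]) (simp add: case_prod_beta)
  also have "\<dots> = (\<Sum>w\<in>permutations_of_set A. \<Sum>p\<le>card A. h (ascents (take p w @ N # drop p w)))"
    by (simp add: sum.cartesian_product)
  also have "\<dots> = (\<Sum>w\<in>permutations_of_set A. of_nat (Suc (ascents w)) * h (ascents w) +
            of_nat (card A - ascents w) * h (Suc (ascents w)))"
  proof (rule sum.cong[OF refl])
    fix w assume w: "w \<in> permutations_of_set A"
    then have "\<forall>u\<in>set w. u < N"
      using assms(2) by (simp add: permutations_of_set_def)
    then show "(\<Sum>p\<le>card A. h (ascents (take p w @ N # drop p w))) =
        of_nat (Suc (ascents w)) * h (ascents w) +
        of_nat (card A - ascents w) * h (Suc (ascents w))"
      using sum_ascents_insert_greatest[of w N h]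
      by (simp only: length_finite_permutations_of_set[OF w])
  qed
  finally show ?thesis .
qed

text \<open>Equivalently, the number of ordered set partitions of [m] into m - j blocks.\<close>

definition marked_ascents :: "nat \<Rightarrow> nat \<Rightarrow> nat" where
  "marked_ascents m j = (\<Sum>w\<in>permutations_of_set {1..m}. ascents w choose j)"

lemma marked_ascents_0: "marked_ascents 0 j = of_bool (j = 0)"
  by (simp add: marked_ascents_def binomial_eq_0)

lemma marked_ascents_Suc:
  "marked_ascents (Suc m) j = (\<Sum>w\<in>permutations_of_set {1..m}.
     Suc (ascents w) * (ascents w choose j) + (m - ascents w) * (Suc (ascents w) choose j))"
proof -
  have "{1..Suc m} = insert (Suc m) {1..m}" by auto
  then show ?thesis
    using sum_ascents_permutations_insert[of "{1..m}" "Suc m" "\<lambda>c. c choose j"]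
    by (simp add: marked_ascents_def del: binomial_Suc_Suc)
qed

lemma ascents_permutation_le: "w \<in> permutations_of_set {1..m} \<Longrightarrow> ascents w \<le> m"
  using ascents_le[of w] length_finite_permutations_of_set[of w "{1..m}"] by simp

lemma marked_ascents_Suc_0: "marked_ascents (Suc m) 0 = Suc m * marked_ascents m 0"
proof -
  have "Suc (ascents w) + (m - ascents w) = Suc m" if "w \<in> permutations_of_set {1..m}" for w
    using ascents_permutation_le[OF that] by simp
  then show ?thesis
    unfolding marked_ascents_Suc by (simp add: marked_ascents_def)
qed

lemma marked_ascents_Suc_Suc:
  "marked_ascents (Suc m) (Suc j) = (m - j) * (marked_ascents m (Suc j) + marked_ascents m j)"
proof -
  have "Suc c * (c choose Suc j) + (m - c) * (Suc c choose Suc j) =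
      (m - j) * ((c choose Suc j) + (c choose j))" if "c \<le> m" for c
  proof (cases "j \<le> c")
    case True
    have "Suc c * (c choose Suc j) = (c - j) * (Suc c choose Suc j)"
      using binomial_absorb_comp[of "Suc c" "Suc j"] by simp
    then have "Suc c * (c choose Suc j) + (m - c) * (Suc c choose Suc j) =
        ((c - j) + (m - c)) * (Suc c choose Suc j)"
      by (simp only: add_mult_distrib)
    then show ?thesis
      using True that by (simp add: add.commute)
  qed (simp add: binomial_eq_0)
  then have "marked_ascents (Suc m) (Suc j) =
      (\<Sum>w\<in>permutations_of_set {1..m}. (m - j) * ((ascents w choose Suc j) + (ascents w choose j)))"
    unfolding marked_ascents_Suc by (intro sum.cong refl) (use ascents_permutation_le in blast)
  then show ?thesis
    by (simp add: marked_ascents_def sum.distrib flip: sum_distrib_left)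
qed

section \<open>The signed sum over vertex choices\<close>

definition multichoose :: "'a :: field_char_0 \<Rightarrow> nat \<Rightarrow> 'a" where
  "multichoose z d = (z + of_nat d - 1) gchoose d"

lemma multichoose_0 [simp]: "multichoose z 0 = 1"
  by (simp add: multichoose_def)

lemma multichoose_diff: "multichoose (z + 1) (Suc d) - multichoose z (Suc d) =
    multichoose (z + 1) d"
  using gbinomial_Suc_Suc[of "z + of_nat d" d] by (simp add: multichoose_def algebra_simps)

lemma mult_multichoose: "z * multichoose (z + 1) d = of_nat (Suc d) * multichoose z (Suc d)"
  using gbinomial_mult_1[of "z + of_nat d" d] by (simp add: multichoose_def algebra_simps)

fun choice_coeff :: "nat \<Rightarrow> nat \<Rightarrow> 'a :: comm_ring_1 \<Rightarrow> 'a" where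
  "choice_coeff 0 l z = of_bool (l = 0)"
| "choice_coeff (Suc m) 0 z = z * choice_coeff m 0 (z + 1)"
| "choice_coeff (Suc m) (Suc l) z =
     z * choice_coeff m (Suc l) (z + 1) + z * (choice_coeff m l z - choice_coeff m l (z + 1))"

lemma choice_coeff_eq_0: "m < l \<Longrightarrow> choice_coeff m l z = 0"
  by (induction m l z rule: choice_coeff.induct) auto

lemma choice_coeff_eq:
  fixes z :: "'a :: field_char_0"
  shows "m = l + d \<Longrightarrow> choice_coeff m l z = (-1) ^ l * of_nat (marked_ascents m l) * multichoose z d"
proof (induction m arbitrary: l d z)
  case 0
  then show ?case by (simp add: marked_ascents_0)
next
  case (Suc m)
  show ?case
  proof (cases l)
    case 0
    then have "choice_coeff (Suc m) l z = of_nat (marked_ascents m 0) * (z * multichoose (z + 1) m)"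
      using Suc.IH[of 0 m] by simp
    also have "\<dots> = of_nat (marked_ascents (Suc m) 0) * multichoose z (Suc m)"
      by (simp only: mult_multichoose marked_ascents_Suc_0 of_nat_mult mult_ac)
    finally show ?thesis
      using 0 Suc.prems by simp
  next
    case l: (Suc k)
    show ?thesis
    proof (cases d)
      case 0
      then have "m = k + 0" using l Suc.prems by simp
      then have "choice_coeff m k z' = (-1) ^ k * of_nat (marked_ascents m k)" for z' :: 'a
        using Suc.IH[of k 0 z'] by simp
      then show ?thesis
        using \<open>m = k + 0\<close> l by (simp add: choice_coeff_eq_0 marked_ascents_Suc_Suc)
    next
      case d: (Suc i)
      let ?M = "\<lambda>j. of_nat (marked_ascents m j) :: 'a"
      have m_eq: "m = k + Suc i" "m = Suc k + i" "m - k = Suc i"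
        using l d Suc.prems by auto
      have "choice_coeff (Suc m) (Suc k) z =
          z * ((-1) ^ Suc k * ?M (Suc k) * multichoose (z + 1) i) -
          z * ((-1) ^ k * ?M k * (multichoose (z + 1) (Suc i) - multichoose z (Suc i)))"
        unfolding choice_coeff.simps Suc.IH[OF m_eq(1)] Suc.IH[OF m_eq(2)]
        by (simp add: algebra_simps)
      also have "\<dots> = (-1) ^ Suc k * (?M (Suc k) + ?M k) * (z * multichoose (z + 1) i)"
        unfolding multichoose_diff by (simp add: algebra_simps)
      also have "\<dots> = (-1) ^ Suc k * of_nat (marked_ascents (Suc m) (Suc k)) * multichoose z (Suc i)"
        unfolding mult_multichoose marked_ascents_Suc_Suc m_eq(3) by (simp add: algebra_simps)
      finally show ?thesis
        using l d by simp
    qed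
  qed
qed

definition window :: "nat \<Rightarrow> ('a :: comm_ring_1 \<Rightarrow> 'a) \<Rightarrow> 'a \<Rightarrow> 'a" where
  "window K g z = (\<Sum>j\<le>K. g (z - of_nat j))"

lemma funpow_window_add: "(window K ^^ l) (\<lambda>z. f z + g z) z =
    (window K ^^ l) f z + (window K ^^ l) g z"
  by (induction l arbitrary: z) (simp_all add: window_def sum.distrib)

lemma funpow_window_diff: "(window K ^^ l) (\<lambda>z. f z - g z) z =
    (window K ^^ l) f z - (window K ^^ l) g z"
  by (induction l arbitrary: z) (simp_all add: window_def sum_subtractf)

lemma funpow_window_cmult: "(window K ^^ l) (\<lambda>z. c * g z) z = c * (window K ^^ l) g z"
  by (induction l arbitrary: z) (simp_all add: window_def sum_distrib_left)

lemma funpow_window_shift: "(window K ^^ l) (\<lambda>z. g (z - c)) z = (window K ^^ l) g (z - c)"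
  by (induction l arbitrary: z) (simp_all add: window_def algebra_simps)

definition choices :: "nat \<Rightarrow> (nat \<times> nat) set" where
  "choices K = {0..K} \<times> {0} \<union> {1..K} \<times> {1}"

lemma finite_choices [simp]: "finite (choices K)"
  by (simp add: choices_def)

lemma sum_choices:
  fixes \<phi> :: "nat \<Rightarrow> nat \<Rightarrow> 'a :: comm_ring_1"
  shows "(\<Sum>(j, e)\<in>choices K. (-1) ^ e * \<phi> j e) = (\<Sum>j\<in>{0..K}. \<phi> j 0) - (\<Sum>j\<in>{1..K}. \<phi> j 1)"
proof -
  have "(\<Sum>(j, e)\<in>choices K. (-1) ^ e * \<phi> j e) =
      (\<Sum>(j, e)\<in>{0..K} \<times> {0}. (-1) ^ e * \<phi> j e) + (\<Sum>(j, e)\<in>{1..K} \<times> {1}. (-1) ^ e * \<phi> j e)"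
    unfolding choices_def by (rule sum.union_disjoint) auto
  then show ?thesis
    by (simp add: sum.cartesian_product[symmetric] sum_negf)
qed

lemma sum_PiE_insert:
  assumes "x \<notin> I"
  shows "(\<Sum>f\<in>PiE (insert x I) S. g f) = (\<Sum>y\<in>S x. \<Sum>f\<in>PiE I S. g (f(x := y)))"
proof -
  have "(\<Sum>f\<in>PiE (insert x I) S. g f) = (\<Sum>(y, f)\<in>S x \<times> PiE I S. g (f(x := y)))"
    unfolding PiE_insert_eq
    by (subst sum.reindex[OF inj_combinator[OF assms]]) (simp add: case_prod_beta)
  then show ?thesis
    by (simp add: sum.cartesian_product)
qed

text \<open>A choice (j, e) at every vertex lowers the argument by j and raises by e the factors of all
  smaller vertices.\<close>

definition choice_term :: "nat \<Rightarrow> ('a :: comm_ring_1 \<Rightarrow> 'a) \<Rightarrow> 'a \<Rightarrow> 'a \<Rightarrow> (nat \<Rightarrow> nat \<times> nat) \<Rightarrow> 'a" where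
  "choice_term m \<psi> y R \<kappa> =
     (let z = R - (\<Sum>u\<in>{1..m}. of_nat (fst (\<kappa> u)))
      in (\<Prod>u\<in>{1..m}. (-1) ^ snd (\<kappa> u)) * \<psi> z *
         (\<Prod>i\<in>{1..m}. z + y + (\<Sum>u\<in>{i<..m}. of_nat (snd (\<kappa> u)))))"

definition choice_sum :: "nat \<Rightarrow> nat \<Rightarrow> ('a :: comm_ring_1 \<Rightarrow> 'a) \<Rightarrow> 'a \<Rightarrow> 'a \<Rightarrow> 'a" where
  "choice_sum K m \<psi> y R = (\<Sum>\<kappa>\<in>PiE {1..m} (\<lambda>_. choices K). choice_term m \<psi> y R \<kappa>)"

lemma choice_sum_0: "choice_sum K 0 \<psi> y R = \<psi> R"
  by (simp add: choice_sum_def choice_term_def)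

lemma choice_term_Suc:
  "choice_term (Suc m) \<psi> y R (\<kappa>(Suc m := (j, e))) =
   (-1) ^ e * choice_term m (\<lambda>z. \<psi> z * (z + y)) (y + of_nat e) (R - of_nat j) \<kappa>"
proof -
  let ?\<kappa> = "\<kappa>(Suc m := (j, e))"
  define z where "z = R - of_nat j - (\<Sum>u\<in>{1..m}. of_nat (fst (\<kappa> u)))"
  have ins: "{1..Suc m} = insert (Suc m) {1..m}" by auto
  have arg: "R - (\<Sum>u\<in>{1..Suc m}. of_nat (fst (?\<kappa> u))) = z"
    unfolding ins by (simp add: z_def)
  have sign: "(\<Prod>u\<in>{1..Suc m}. (-1 :: 'a) ^ snd (?\<kappa> u)) = (-1) ^ e * (\<Prod>u\<in>{1..m}. (-1) ^ snd (\<kappa> u))"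
    unfolding ins by simp
  have raised: "(\<Sum>u\<in>{i<..Suc m}. of_nat (snd (?\<kappa> u)) :: 'a) =
      of_nat e + (\<Sum>u\<in>{i<..m}. of_nat (snd (\<kappa> u)))"
    if "i \<in> {1..m}" for i
  proof -
    have "{i<..Suc m} = insert (Suc m) {i<..m}" using that by auto
    then show ?thesis by simp
  qed
  have "(\<Prod>i\<in>{1..Suc m}. z + y + (\<Sum>u\<in>{i<..Suc m}. of_nat (snd (?\<kappa> u)))) =
      (z + y) * (\<Prod>i\<in>{1..m}. z + y + (\<Sum>u\<in>{i<..Suc m}. of_nat (snd (?\<kappa> u))))"
    unfolding ins by simp
  also have "(\<Prod>i\<in>{1..m}. z + y + (\<Sum>u\<in>{i<..Suc m}. of_nat (snd (?\<kappa> u)))) =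
      (\<Prod>i\<in>{1..m}. z + (y + of_nat e) + (\<Sum>u\<in>{i<..m}. of_nat (snd (\<kappa> u))))"
    by (rule prod.cong[OF refl], subst raised) (simp_all add: add.assoc)
  finally have factors: "(\<Prod>i\<in>{1..Suc m}. z + y + (\<Sum>u\<in>{i<..Suc m}. of_nat (snd (?\<kappa> u)))) =
      (z + y) * (\<Prod>i\<in>{1..m}. z + (y + of_nat e) + (\<Sum>u\<in>{i<..m}. of_nat (snd (\<kappa> u))))" .
  show ?thesis
    unfolding choice_term_def Let_def arg sign factors z_def[symmetric] by (simp only: mult_ac)
qed

lemma choice_sum_Suc:
  fixes \<psi> :: "'a :: comm_ring_1 \<Rightarrow> 'a"
  defines "\<psi>' y \<equiv> \<lambda>z. \<psi> z * (z + y)"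
  shows "choice_sum K (Suc m) \<psi> y R =
    (\<Sum>j\<le>K. choice_sum K m (\<psi>' y) y (R - of_nat j) - choice_sum K m (\<psi>' y) (y + 1) (R - of_nat j)) +
    choice_sum K m (\<psi>' y) (y + 1) R"
proof -
  let ?s = "\<lambda>j e. choice_sum K m (\<psi>' y) (y + of_nat e) (R - of_nat j)"
  have ins: "{1..Suc m} = insert (Suc m) {1..m}" by auto
  have "choice_sum K (Suc m) \<psi> y R = (\<Sum>(j, e)\<in>choices K. \<Sum>\<kappa>\<in>PiE {1..m} (\<lambda>_. choices K).
      choice_term (Suc m) \<psi> y R (\<kappa>(Suc m := (j, e))))"
    unfolding choice_sum_def ins by (subst sum_PiE_insert) (simp_all add: case_prod_beta)
  also have "\<dots> = (\<Sum>(j, e)\<in>choices K. (-1) ^ e * ?s j e)"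
    unfolding choice_term_Suc \<psi>'_def choice_sum_def by (simp add: sum_distrib_left)
  also have "\<dots> = (\<Sum>j\<in>{0..K}. ?s j 0) - (\<Sum>j\<in>{1..K}. ?s j 1)"
    by (rule sum_choices)
  also have "(\<Sum>j\<in>{1..K}. ?s j 1) = (\<Sum>j\<in>{0..K}. ?s j 1) - ?s 0 1"
    by (simp add: sum.atLeast_Suc_atMost)
  finally show ?thesis
    by (simp add: sum_subtractf atMost_atLeast0)
qed

text \<open>The choices at a vertex act as the window operator W when e = 0 and as 1 - W followed by a
  unit shift when e = 1; choice_coeff m l collects the coefficient of the l-th power of W.\<close>

lemma choice_sum_eq_window:
  fixes \<psi> :: "'a :: comm_ring_1 \<Rightarrow> 'a"
  shows "choice_sum K m \<psi> y R = (\<Sum>l\<le>m. (window K ^^ l) (\<lambda>z. \<psi> z * choice_coeff m l (z + y)) R)"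
proof (induction m arbitrary: \<psi> y R)
  case 0
  then show ?case by (simp add: choice_sum_0)
next
  case (Suc m)
  let ?W = "\<lambda>l. (window K ^^ l) :: ('a \<Rightarrow> 'a) \<Rightarrow> 'a \<Rightarrow> 'a"
  define A where "A l = (\<lambda>z. \<psi> z * (z + y) * choice_coeff m l (z + y))" for l
  define B where "B l = (\<lambda>z. \<psi> z * (z + y) * choice_coeff m l (z + (y + 1)))" for l
  have "choice_sum K (Suc m) \<psi> y R =
      (\<Sum>j\<le>K. (\<Sum>l\<le>m. ?W l (A l) (R - of_nat j)) - (\<Sum>l\<le>m. ?W l (B l) (R - of_nat j))) +
      (\<Sum>l\<le>m. ?W l (B l) R)"
    unfolding choice_sum_Suc Suc.IH A_def B_def ..
  also have "\<dots> = (\<Sum>l\<le>m. ?W (Suc l) (\<lambda>z. A l z - B l z) R) + (\<Sum>l\<le>m. ?W l (B l) R)"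
    by (simp add: funpow_window_diff window_def sum_subtractf sum.swap[of _ "{..m}" "{..K}"])
  also have "(\<Sum>l\<le>m. ?W l (B l) R) = (\<Sum>l\<le>Suc m. ?W l (B l) R)"
  proof -
    have "B (Suc m) = (\<lambda>z. 0 * B (Suc m) z)"
      by (simp add: B_def choice_coeff_eq_0)
    then have "?W (Suc m) (B (Suc m)) R = 0"
      by (metis funpow_window_cmult mult_zero_left)
    then show ?thesis by (simp del: funpow.simps)
  qed
  also have "\<dots> = B 0 R + (\<Sum>l\<le>m. ?W (Suc l) (B (Suc l)) R)"
    unfolding sum.atMost_Suc_shift by simp
  also have "(\<Sum>l\<le>m. ?W (Suc l) (\<lambda>z. A l z - B l z) R) + (B 0 R + (\<Sum>l\<le>m. ?W (Suc l) (B (Suc l)) R)) =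
      B 0 R + (\<Sum>l\<le>m. ?W (Suc l) (\<lambda>z. B (Suc l) z + (A l z - B l z)) R)"
    by (simp add: funpow_window_add sum.distrib del: funpow.simps)
  also have "\<dots> = \<psi> R * choice_coeff (Suc m) 0 (R + y) +
      (\<Sum>l\<le>m. ?W (Suc l) (\<lambda>z. \<psi> z * choice_coeff (Suc m) (Suc l) (z + y)) R)"
  proof -
    have "(\<lambda>z. B (Suc l) z + (A l z - B l z)) = (\<lambda>z. \<psi> z * choice_coeff (Suc m) (Suc l) (z + y))"
      for l
      by (simp add: A_def B_def fun_eq_iff algebra_simps)
    then show ?thesis
      by (simp only: B_def) (simp add: algebra_simps del: funpow.simps)
  qed
  also have "\<dots> = (\<Sum>l\<le>Suc m. ?W l (\<lambda>z. \<psi> z * choice_coeff (Suc m) l (z + y)) R)"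
    unfolding sum.atMost_Suc_shift by simp
  finally show ?case .
qed

lemma window_multichoose:
  "window K (\<lambda>z. multichoose z d) z =
      multichoose z (Suc d) - multichoose (z - of_nat (Suc K)) (Suc d)"
  unfolding window_def
proof (induction K)
  case 0
  show ?case
    using multichoose_diff[of "z - 1" d] by simp
next
  case (Suc K)
  have "multichoose (z - of_nat (Suc K)) (Suc d) - multichoose (z - of_nat (Suc (Suc K))) (Suc d) =
      multichoose (z - of_nat (Suc K)) d"
    using multichoose_diff[of "z - of_nat (Suc (Suc K))" d] by (simp add: algebra_simps)
  then show ?case
    using Suc by (simp add: algebra_simps del: of_nat_Suc)
qed

lemma funpow_window_multichoose_shift:
  "(window K ^^ l) (\<lambda>z. multichoose z (Suc d)) (R - of_nat (Suc K)) =
   (window K ^^ l) (\<lambda>z. multichoose z (Suc d)) R - (window K ^^ Suc l) (\<lambda>z. multichoose z d) R"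
proof -
  have "(window K ^^ Suc l) (\<lambda>z. multichoose z d) R =
      (window K ^^ l) (\<lambda>z. multichoose z (Suc d) - multichoose (z - of_nat (Suc K)) (Suc d)) R"
    unfolding funpow_Suc_right comp_apply window_multichoose ..
  then show ?thesis
    using funpow_window_shift[of l K "\<lambda>z. multichoose z (Suc d)" "of_nat (Suc K)" R]
    by (simp only: funpow_window_diff) simp
qed

lemma iterated_shift_eq_binomial_sum:
  fixes C :: "nat \<Rightarrow> 'a :: comm_ring_1 \<Rightarrow> 'a"
  assumes step: "\<And>l R. l < m \<Longrightarrow> C l (R - s) = C l R - C (Suc l) R" and "l + c \<le> m"
  shows "C l (R - of_nat c * s) = (\<Sum>i\<le>c. (-1) ^ i * of_nat (c choose i) * C (l + i) R)"
  using assms(2)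
proof (induction c arbitrary: l)
  case (Suc c)
  let ?t = "\<lambda>c l i. (-1) ^ i * of_nat (c choose i) * C (l + i) R"
  have "C l (R - of_nat (Suc c) * s) = C l (R - of_nat c * s) - C (Suc l) (R - of_nat c * s)"
    using step[of l "R - of_nat c * s"] Suc.prems by (simp add: algebra_simps)
  also have "\<dots> = (\<Sum>i\<le>Suc c. ?t c l i) - (\<Sum>i\<le>c. ?t c (Suc l) i)"
    using Suc.IH[of l] Suc.IH[of "Suc l"] Suc.prems by (simp add: binomial_eq_0)
  also have "\<dots> = C l R + (\<Sum>i\<le>c. ?t c l (Suc i) - ?t c (Suc l) i)"
    unfolding sum.atMost_Suc_shift by (simp add: sum_subtractf)
  also have "\<dots> = C l R + (\<Sum>i\<le>c. ?t (Suc c) l (Suc i))"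
    by (intro arg_cong2[of _ _ _ _ "(+)"] sum.cong refl) (simp add: algebra_simps)
  also have "\<dots> = (\<Sum>i\<le>Suc c. ?t (Suc c) l i)"
    unfolding sum.atMost_Suc_shift by simp
  finally show ?case .
qed simp

theorem choice_sum_ascents:
  fixes R :: "'a :: field_char_0"
  shows "choice_sum K m (\<lambda>_. 1) 0 R =
    (\<Sum>w\<in>permutations_of_set {1..m}. multichoose (R - of_nat (ascents w) * of_nat (Suc K)) m)"
proof -
  define C where "C l = (window K ^^ l) (\<lambda>z :: 'a. multichoose z (m - l))" for l
  have step: "C l (z - of_nat (Suc K)) = C l z - C (Suc l) z" if "l < m" for l z
  proof -
    have "m - l = Suc (m - Suc l)" using that by simp
    then show ?thesis
      unfolding C_def by (simp only: funpow_window_multichoose_shift)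
  qed
  have "(window K ^^ l) (\<lambda>z. 1 * choice_coeff m l (z + 0)) R =
      (-1) ^ l * of_nat (marked_ascents m l) * C l R" if "l \<le> m" for l
  proof -
    have "choice_coeff m l =
        (\<lambda>z. (-1) ^ l * of_nat (marked_ascents m l) * multichoose z (m - l) :: 'a)"
      using choice_coeff_eq[of m l "m - l"] that by auto
    then show ?thesis
      by (simp add: C_def funpow_window_cmult)
  qed
  then have "choice_sum K m (\<lambda>_. 1) 0 R = (\<Sum>l\<le>m. (-1) ^ l * of_nat (marked_ascents m l) * C l R)"
    unfolding choice_sum_eq_window by (intro sum.cong) auto
  also have "\<dots> =
      (\<Sum>w\<in>permutations_of_set {1..m}. \<Sum>l\<le>m. (-1) ^ l * of_nat (ascents w choose l) * C l R)"
    unfolding marked_ascents_def of_nat_sum sum_distrib_left sum_distrib_right by (rule sum.swap)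
  also have "\<dots> = (\<Sum>w\<in>permutations_of_set {1..m}. C 0 (R - of_nat (ascents w) * of_nat (Suc K)))"
  proof (rule sum.cong[OF refl])
    fix w assume "w \<in> permutations_of_set {1..m}"
    then have ascents_le_m: "ascents w \<le> m"
      by (rule ascents_permutation_le)
    have "(\<Sum>l\<le>m. (-1) ^ l * of_nat (ascents w choose l) * C l R) =
        (\<Sum>l\<le>ascents w. (-1) ^ l * of_nat (ascents w choose l) * C l R)"
      by (rule sum.mono_neutral_right) (use ascents_le_m in \<open>auto simp: binomial_eq_0\<close>)
    also have "\<dots> = C 0 (R - of_nat (ascents w) * of_nat (Suc K))"
      using iterated_shift_eq_binomial_sum[of m C "of_nat (Suc K)" 0 "ascents w" R]
        step ascents_le_m by simp
    finally show "(\<Sum>l\<le>m. (-1) ^ l * of_nat (ascents w choose l) * C l R) =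
        C 0 (R - of_nat (ascents w) * of_nat (Suc K))" .
  qed
  finally show ?thesis
    by (simp add: C_def)
qed

section \<open>Counting points with prescribed gaps\<close>

lemma ex_sorted_wrt:
  assumes "finite A" "transp R" "\<And>u v. u \<in> A \<Longrightarrow> v \<in> A \<Longrightarrow> u \<noteq> v \<Longrightarrow> R u v \<or> R v u"
  shows "\<exists>w\<in>permutations_of_set A. sorted_wrt R w"
  using assms(1,3)
proof (induction A rule: finite_induct)
  case (insert u A)
  then obtain w where w: "w \<in> permutations_of_set A" "sorted_wrt R w" by auto
  let ?w = "filter (\<lambda>v. R v u) w @ u # filter (\<lambda>v. \<not> R v u) w"
  have "R u v" if "v \<in> A" "\<not> R v u" for v
    using insert that by (metis insert_iff)
  then have "sorted_wrt R ?w"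
    using w assms(2)
    by (auto simp: sorted_wrt_append sorted_wrt_filter permutations_of_set_def dest: transpD)
  moreover have "?w \<in> permutations_of_set (insert u A)"
    using w(1) insert.hyps by (auto simp: permutations_of_set_def)
  ultimately show ?case by blast
qed simp

lemma sorted_wrt_unique:
  assumes "\<And>u v. R u v \<Longrightarrow> \<not> R v u"
  shows "w \<in> permutations_of_set A \<Longrightarrow> w' \<in> permutations_of_set A \<Longrightarrow>
    sorted_wrt R w \<Longrightarrow> sorted_wrt R w' \<Longrightarrow> w = w'"
proof (induction w arbitrary: w' A)
  case Nil
  then show ?case by (auto simp: permutations_of_set_def)
next
  case (Cons u w)
  then have A: "A = set w'" "distinct w'" "A = insert u (set w)" "u \<notin> set w" "distinct w"
    by (auto simp: permutations_of_set_def)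
  then obtain u' v' where w': "w' = u' # v'"
    by (cases w') auto
  have "u = u'"
  proof (rule ccontr)
    assume "u \<noteq> u'"
    then have "u' \<in> set w" "u \<in> set v'"
      using A w' by auto
    then have "R u u'" "R u' u"
      using Cons.prems w' by auto
    then show False using assms by blast
  qed
  moreover have "set w = set v'"
    using A w' \<open>u = u'\<close> by (metis distinct.simps(2) insert_ident list.simps(15))
  ultimately show ?case
    using Cons.IH[of "set w" v'] Cons.prems(3,4) A w' by (simp add: permutations_of_set_def)
qed

lemma hockey_stick_int:
  fixes D lo hi :: int
  assumes "0 < l" "D - hi < int l"
  shows "(\<Sum>t\<in>{lo..<hi}. nat (D - t) choose l) = nat (D - lo + 1) choose Suc l"
proof (cases "lo \<le> hi")
  case False
  then show ?thesis using assms by (simp add: binomial_eq_0)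
next
  case True
  then show ?thesis
  proof (induction lo rule: int_le_induct)
    case base
    show ?case using assms by (simp add: binomial_eq_0)
  next
    case (step t)
    have "{t - 1..<hi} = insert (t - 1) {t..<hi}"
      using step.hyps by auto
    then have "(\<Sum>s\<in>{t - 1..<hi}. nat (D - s) choose l) =
        (nat (D - (t - 1)) choose l) + (nat (D - t + 1) choose Suc l)"
      using step by simp
    also have "\<dots> = nat (D - (t - 1) + 1) choose Suc l"
    proof (cases "D - t + 1 \<ge> 0")
      case True
      then have "nat (D - (t - 1) + 1) = Suc (nat (D - t + 1))"
        "nat (D - (t - 1)) = nat (D - t + 1)"
        by auto
      then show ?thesis by simp
    qed (use assms in \<open>simp add: binomial_eq_0\<close>)
    finally show ?case .
  qed
qed

locale gap_function =
  fixes gap :: "'a \<Rightarrow> 'a \<Rightarrow> int"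
  assumes gap_nonneg: "0 \<le> gap u v"
    and gap_pos: "u \<noteq> v \<Longrightarrow> 0 < gap u v + gap v u"
    and gap_triangle: "u \<noteq> w \<Longrightarrow> gap u w \<le> gap u v + gap v w"
begin

definition precedes :: "('a \<Rightarrow> int) \<Rightarrow> 'a \<Rightarrow> 'a \<Rightarrow> bool" where
  "precedes x u v \<longleftrightarrow> u \<noteq> v \<and> x u + gap u v \<le> x v"

lemma precedes_asym: "precedes x u v \<Longrightarrow> \<not> precedes x v u"
  using gap_pos[of u v] by (auto simp: precedes_def)

lemma transp_precedes: "transp (precedes x)"
proof (rule transpI)
  fix u v w assume uv: "precedes x u v" and vw: "precedes x v w"
  then have "u \<noteq> w" using precedes_asym by blast
  then show "precedes x u w"
    using uv vw gap_triangle[of u w v] by (simp add: precedes_def)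
qed

definition spaced_points :: "int \<Rightarrow> int \<Rightarrow> 'a list \<Rightarrow> ('a \<Rightarrow> int) set" where
  "spaced_points lo hi w = {x. (\<forall>i. i \<notin> set w \<longrightarrow> x i = 0) \<and> (\<forall>i\<in>set w. lo \<le> x i \<and> x i < hi) \<and>
     sorted_wrt (precedes x) w}"

fun total_gap :: "'a list \<Rightarrow> int" where
  "total_gap [] = 0"
| "total_gap [u] = 0"
| "total_gap (u # v # w) = gap u v + total_gap (v # w)"

lemma total_gap_nonneg: "0 \<le> total_gap w"
  by (induction w rule: total_gap.induct) (simp_all add: gap_nonneg)

lemma sorted_wrt_precedes_upd:
  assumes "u \<notin> set w"
  shows "sorted_wrt (precedes (x(u := t))) w \<longleftrightarrow> sorted_wrt (precedes x) w"
proof -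
  have "precedes (x(u := t)) i j \<longleftrightarrow> precedes x i j" if "i \<in> set w" "j \<in> set w" for i j
    using assms that by (auto simp: precedes_def)
  then show ?thesis
    by (metis (mono_tags, lifting) sorted_wrt_mono_rel)
qed

lemma bij_betw_spaced_points_Cons:
  assumes u: "u \<notin> set (v # w)"
  shows "bij_betw (\<lambda>(t, x). x(u := t)) (SIGMA t:{lo..<hi}. spaced_points (t + gap u v) hi (v # w))
           (spaced_points lo hi (u # v # w))"
proof -
  let ?w = "v # w"
  let ?S = "SIGMA t:{lo..<hi}. spaced_points (t + gap u v) hi ?w"
  show ?thesis
  proof (rule bij_betw_byWitness[where f' = "\<lambda>x. (x u, x(u := 0))"])
    show "\<forall>p\<in>?S. (\<lambda>x. (x u, x(u := 0))) ((\<lambda>(t, x). x(u := t)) p) = p"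
      using u by (auto simp: spaced_points_def fun_eq_iff)
    show "\<forall>x\<in>spaced_points lo hi (u # ?w). (\<lambda>(t, x). x(u := t)) ((\<lambda>x. (x u, x(u := 0))) x) = x"
      by auto
    show "(\<lambda>(t, x). x(u := t)) ` ?S \<subseteq> spaced_points lo hi (u # ?w)"
    proof (rule image_subsetI)
      fix p assume "p \<in> ?S"
      then obtain t x where p: "p = (t, x)" "lo \<le> t" "t < hi"
        and x: "x \<in> spaced_points (t + gap u v) hi ?w"
        by auto
      have "precedes (x(u := t)) u v"
        using x u by (auto simp: precedes_def spaced_points_def)
      moreover have "lo \<le> x i \<and> x i < hi" if "i \<in> set ?w" for i
        using x p(2) that gap_nonneg[of u v] unfolding spaced_points_def by fastforce
      ultimately show "(\<lambda>(t, x). x(u := t)) p \<in> spaced_points lo hi (u # ?w)"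
        using p x u sorted_wrt_precedes_upd[OF u, of x t]
        by (auto simp: spaced_points_def sorted_wrt2[OF transp_precedes] simp del: sorted_wrt.simps)
    qed
    show "(\<lambda>x. (x u, x(u := 0))) ` spaced_points lo hi (u # ?w) \<subseteq> ?S"
    proof (rule image_subsetI)
      fix x assume x: "x \<in> spaced_points lo hi (u # ?w)"
      then have "precedes x u v" "sorted_wrt (precedes x) ?w"
        by (auto simp: spaced_points_def sorted_wrt2[OF transp_precedes] simp del: sorted_wrt.simps)
      moreover from this have "x v \<le> x i" if "i \<in> set ?w" for i
        using that gap_nonneg[of v i] by (force simp: precedes_def)
      ultimately have "x(u := 0) \<in> spaced_points (x u + gap u v) hi ?w"
        using x u sorted_wrt_precedes_upd[OF u, of x 0]
        by (fastforce simp: spaced_points_def precedes_def simp del: sorted_wrt.simps)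
      then show "(x u, x(u := 0)) \<in> ?S"
        using x by (auto simp: spaced_points_def)
    qed
  qed
qed

lemma card_spaced_points:
  assumes "distinct w"
  shows "finite (spaced_points lo hi w) \<and>
    card (spaced_points lo hi w) = nat (hi - lo - total_gap w + int (length w) - 1) choose length w"
  using assms
proof (induction w arbitrary: lo rule: total_gap.induct)
  case 1
  have "spaced_points lo hi [] = {\<lambda>_. 0}"
    by (auto simp: spaced_points_def)
  then show ?case by simp
next
  case (2 u)
  have "bij_betw (\<lambda>t i. if i = u then t else 0) {lo..<hi} (spaced_points lo hi [u])"
    by (rule bij_betw_byWitness[where f' = "\<lambda>x. x u"]) (auto simp: spaced_points_def)
  from bij_betw_finite[OF this] bij_betw_same_card[OF this] show ?case
    by simp
next
  case (3 u v w)
  let ?w = "v # w"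
  let ?S = "SIGMA t:{lo..<hi}. spaced_points (t + gap u v) hi ?w"
  define D where "D = hi - gap u v - total_gap ?w + int (length ?w) - 1"
  have bij: "bij_betw (\<lambda>(t, x). x(u := t)) ?S (spaced_points lo hi (u # ?w))"
    by (rule bij_betw_spaced_points_Cons) (use 3 in simp)
  have IH: "finite (spaced_points lo hi ?w)"
    "card (spaced_points lo hi ?w) =
        nat (hi - lo - total_gap ?w + int (length ?w) - 1) choose length ?w" for lo
    using 3 by auto
  have "card ?S = (\<Sum>t\<in>{lo..<hi}. card (spaced_points (t + gap u v) hi ?w))"
    using IH(1) by simp
  also have "\<dots> = (\<Sum>t\<in>{lo..<hi}. nat (D - t) choose length ?w)"
    by (rule sum.cong[OF refl]) (simp add: IH(2) D_def algebra_simps)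
  also have "\<dots> = nat (D - lo + 1) choose Suc (length ?w)"
    using gap_nonneg[of u v] total_gap_nonneg[of ?w] by (intro hockey_stick_int) (auto simp: D_def)
  also have "D - lo + 1 = hi - lo - total_gap (u # ?w) + int (length (u # ?w)) - 1"
    by (simp add: D_def)
  finally have "card ?S =
      nat (hi - lo - total_gap (u # ?w) + int (length (u # ?w)) - 1) choose length (u # ?w)"
    by simp
  moreover have "finite ?S"
    using IH(1) by blast
  ultimately show ?case
    using bij_betw_finite[OF bij] bij_betw_same_card[OF bij] by simp
qed

definition separated_points :: "int \<Rightarrow> int \<Rightarrow> 'a set \<Rightarrow> ('a \<Rightarrow> int) set" where
  "separated_points lo hi V = {x. (\<forall>i. i \<notin> V \<longrightarrow> x i = 0) \<and> (\<forall>i\<in>V. lo \<le> x i \<and> x i < hi) \<and>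
     (\<forall>u\<in>V. \<forall>v\<in>V. u \<noteq> v \<longrightarrow> precedes x u v \<or> precedes x v u)}"

lemma separated_points_eq_UN:
  assumes "finite V"
  shows "separated_points lo hi V = (\<Union>w\<in>permutations_of_set V. spaced_points lo hi w)"
proof (intro equalityI subsetI)
  fix x assume x: "x \<in> separated_points lo hi V"
  have "\<exists>w\<in>permutations_of_set V. sorted_wrt (precedes x) w"
    by (rule ex_sorted_wrt[OF assms transp_precedes]) (use x in \<open>auto simp: separated_points_def\<close>)
  then show "x \<in> (\<Union>w\<in>permutations_of_set V. spaced_points lo hi w)"
    using x by (fastforce simp: separated_points_def spaced_points_def permutations_of_set_def)
next
  fix x assume "x \<in> (\<Union>w\<in>permutations_of_set V. spaced_points lo hi w)"
  then obtain w where w: "set w = V" and x: "x \<in> spaced_points lo hi w"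
    by (auto simp: permutations_of_set_def)
  have "precedes x u v \<or> precedes x v u" if uv: "u \<in> V" "v \<in> V" "u \<noteq> v" for u v
  proof -
    obtain k where k: "k < length w" "u = w ! k"
      using uv(1) w by (metis in_set_conv_nth)
    obtain l where l: "l < length w" "v = w ! l"
      using uv(2) w by (metis in_set_conv_nth)
    have "k < l \<or> l < k"
      using uv(3) k(2) l(2) by (metis linorder_neqE_nat)
    then show ?thesis
      using x k l by (auto simp: spaced_points_def sorted_wrt_iff_nth_less)
  qed
  then show "x \<in> separated_points lo hi V"
    using x w by (auto simp: separated_points_def spaced_points_def)
qed

theorem card_separated_points:
  assumes "finite V"
  shows "card (separated_points lo hi V) = (\<Sum>w\<in>permutations_of_set V.
    nat (hi - lo - total_gap w + int (card V) - 1) choose card V)"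
proof -
  have "spaced_points lo hi w \<inter> spaced_points lo hi w' = {}"
    if "w \<in> permutations_of_set V" "w' \<in> permutations_of_set V" "w \<noteq> w'" for w w'
    using sorted_wrt_unique[OF precedes_asym that(1,2)] that(3) by (auto simp: spaced_points_def)
  then have "card (separated_points lo hi V) =
      (\<Sum>w\<in>permutations_of_set V. card (spaced_points lo hi w))"
    unfolding separated_points_eq_UN[OF assms]
    by (intro card_UN_disjoint) (auto simp: card_spaced_points permutations_of_setD)
  also have "\<dots> =
      (\<Sum>w\<in>permutations_of_set V. nat (hi - lo - total_gap w + int (card V) - 1) choose card V)"
    by (intro sum.cong refl)
      (simp add: card_spaced_points permutations_of_setD length_finite_permutations_of_set)
  finally show ?thesis .
qed

end

section \<open>Weighted sums over rooted forests\<close>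

text \<open>A rooted forest on V is a parent function with value 0 at the roots; acyclicity is
  expressed by a rank that increases from parent to child.\<close>

definition forests :: "nat set \<Rightarrow> (nat \<Rightarrow> nat) set" where
  "forests V = {f \<in> PiE V (\<lambda>_. insert 0 V). \<exists>h :: nat \<Rightarrow> nat. \<forall>w\<in>V. h (f w) < h w}"

definition forest_sum :: "nat set \<Rightarrow> (nat \<Rightarrow> nat \<Rightarrow> 'a :: comm_ring_1) \<Rightarrow> 'a" where
  "forest_sum V \<omega> = (\<Sum>f\<in>forests V. \<Prod>w\<in>V. \<omega> (f w) w)"

lemma finite_forests [simp]: "finite V \<Longrightarrow> finite (forests V)"
  unfolding forests_def by (rule finite_subset[OF _ finite_PiE[of V "\<lambda>_. insert 0 V"]]) auto

lemma forest_parent: "f \<in> forests V \<Longrightarrow> w \<in> V \<Longrightarrow> f w \<in> insert 0 V"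
  by (auto simp: forests_def)

lemma forest_parent_ne: "f \<in> forests V \<Longrightarrow> w \<in> V \<Longrightarrow> f w \<noteq> w"
  by (force simp: forests_def)

lemma forest_sum_cong:
  assumes "\<And>u w. u \<in> insert 0 V \<Longrightarrow> w \<in> V \<Longrightarrow> \<omega> u w = \<omega>' u w"
  shows "forest_sum V \<omega> = forest_sum V \<omega>'"
  unfolding forest_sum_def
  by (intro sum.cong prod.cong refl assms) (auto dest: forest_parent)

lemma forest_sum_empty: "forest_sum {} \<omega> = 1"
proof -
  have "forests {} = {\<lambda>_. undefined}"
    by (auto simp: forests_def restrict_def)
  then show ?thesis
    by (simp add: forest_sum_def)
qed

definition insert_vertex :: "nat \<Rightarrow> nat \<Rightarrow> nat set \<Rightarrow> (nat \<Rightarrow> nat) \<Rightarrow> nat \<Rightarrow> nat" where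
  "insert_vertex v u D f w = (if w = v then u else if w \<in> D then v else f w)"

definition contract_vertex :: "nat set \<Rightarrow> nat \<Rightarrow> (nat \<Rightarrow> nat) \<Rightarrow> nat \<Rightarrow> nat" where
  "contract_vertex V v f = (\<lambda>w\<in>V. if f w = v then f v else f w)"

lemma insert_vertex_forest:
  assumes f: "f \<in> forests V" and u: "u \<in> insert 0 V" and D: "D \<subseteq> {w \<in> V. f w = u}"
    and v: "v \<notin> V" "v \<noteq> 0"
  shows "insert_vertex v u D f \<in> forests (insert v V)"
proof -
  obtain h :: "nat \<Rightarrow> nat" where h: "\<And>w. w \<in> V \<Longrightarrow> h (f w) < h w"
    using f by (auto simp: forests_def)
  define g where "g x = (if x = v then 2 * h u + 1 else 2 * h x)" for x
  have "g (insert_vertex v u D f w) < g w" if w: "w \<in> insert v V" for w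
  proof -
    consider (new) "w = v" | (moved) "w \<noteq> v" "w \<in> D" | (kept) "w \<noteq> v" "w \<notin> D" by blast
    then show ?thesis
    proof cases
      case new
      then show ?thesis using u v by (auto simp: g_def insert_vertex_def)
    next
      case moved
      then have "h u < h w" using h[of w] D by auto
      then show ?thesis using moved by (simp add: g_def insert_vertex_def)
    next
      case kept
      then have "h (f w) < h w" "f w \<noteq> v" using h w forest_parent[OF f, of w] v by auto
      then show ?thesis using kept by (simp add: g_def insert_vertex_def)
    qed
  qed
  moreover have "insert_vertex v u D f \<in> PiE (insert v V) (\<lambda>_. insert 0 (insert v V))"
    using f u D forest_parent[OF f]
    by (auto simp: insert_vertex_def PiE_iff forests_def extensional_def)
  ultimately show ?thesis
    unfolding forests_def by blast
qed

lemma contract_vertex_forest: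
  assumes f: "f \<in> forests (insert v V)"
  shows "contract_vertex V v f \<in> forests V"
proof -
  obtain h :: "nat \<Rightarrow> nat" where h: "\<And>w. w \<in> insert v V \<Longrightarrow> h (f w) < h w"
    using f by (auto simp: forests_def)
  have "h (contract_vertex V v f w) < h w" if "w \<in> V" for w
    using h[of w] h[of v] that by (auto simp: contract_vertex_def)
  moreover have "contract_vertex V v f \<in> PiE V (\<lambda>_. insert 0 V)"
    using forest_parent[OF f] forest_parent_ne[OF f, of v]
    by (auto simp: contract_vertex_def PiE_iff)
  ultimately show ?thesis
    unfolding forests_def by blast
qed

lemma bij_betw_insert_vertex:
  assumes v: "v \<notin> V" "v \<noteq> 0" "0 \<notin> V"
  shows "bij_betw (\<lambda>(u, f, D). insert_vertex v u D f)
    (SIGMA u:insert 0 V. SIGMA f:forests V. Pow {w \<in> V. f w = u}) (forests (insert v V))"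
    (is "bij_betw ?ins ?S _")
proof (rule bij_betw_byWitness[where f' = "\<lambda>f. (f v, contract_vertex V v f, {w \<in> V. f w = v})"])
  show "\<forall>p\<in>?S. (?ins p v, contract_vertex V v (?ins p), {w \<in> V. ?ins p w = v}) = p"
  proof
    fix p assume "p \<in> ?S"
    then obtain u f D where p: "p = (u, f, D)" "u \<in> insert 0 V" "f \<in> forests V"
      "D \<subseteq> {w \<in> V. f w = u}"
      by auto
    have parent_ne: "f w \<noteq> v" if "w \<in> V" for w
      using forest_parent[OF p(3) that] v by auto
    have "{w \<in> V. insert_vertex v u D f w = v} = D"
      using p(4) parent_ne v by (auto simp: insert_vertex_def)
    moreover have "contract_vertex V v (insert_vertex v u D f) w = f w" for w
    proof (cases "w \<in> V")
      case True
      then show ?thesis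
        using p(4) parent_ne[OF True] v by (auto simp: contract_vertex_def insert_vertex_def)
    next
      case False
      then show ?thesis
        using p(3) by (auto simp: contract_vertex_def forests_def)
    qed
    ultimately show "(?ins p v, contract_vertex V v (?ins p), {w \<in> V. ?ins p w = v}) = p"
      by (simp add: p(1) insert_vertex_def fun_eq_iff)
  qed
  show "\<forall>f\<in>forests (insert v V). ?ins (f v, contract_vertex V v f, {w \<in> V. f w = v}) = f"
    by (auto simp: insert_vertex_def contract_vertex_def forests_def PiE_def extensional_def
        fun_eq_iff)
  show "?ins ` ?S \<subseteq> forests (insert v V)"
    using insert_vertex_forest v by auto
  show "(\<lambda>f. (f v, contract_vertex V v f, {w \<in> V. f w = v})) ` forests (insert v V) \<subseteq> ?S"
  proof (rule image_subsetI)
    fix f assume f: "f \<in> forests (insert v V)"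
    then have "f v \<in> insert 0 V"
      using forest_parent[OF f, of v] forest_parent_ne[OF f, of v] by auto
    then show "(f v, contract_vertex V v f, {w \<in> V. f w = v}) \<in> ?S"
      using contract_vertex_forest[OF f] by (auto simp: contract_vertex_def)
  qed
qed

lemma prod_insert_vertex:
  fixes \<omega> :: "nat \<Rightarrow> nat \<Rightarrow> 'a :: comm_ring_1"
  assumes "finite V" "v \<notin> V" "D \<subseteq> V"
  shows "(\<Prod>w\<in>insert v V. \<omega> (insert_vertex v u D f w) w) =
    \<omega> u v * ((\<Prod>w\<in>D. \<omega> v w) * (\<Prod>w\<in>V - D. \<omega> (f w) w))"
proof -
  have "(\<Prod>w\<in>V. \<omega> (insert_vertex v u D f w) w) =
      (\<Prod>w\<in>V - D. \<omega> (insert_vertex v u D f w) w) * (\<Prod>w\<in>D. \<omega> (insert_vertex v u D f w) w)"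
    by (rule prod.subset_diff[OF assms(3,1)])
  also have "(\<Prod>w\<in>V - D. \<omega> (insert_vertex v u D f w) w) = (\<Prod>w\<in>V - D. \<omega> (f w) w)"
    by (rule prod.cong) (use assms(2) in \<open>auto simp: insert_vertex_def\<close>)
  also have "(\<Prod>w\<in>D. \<omega> (insert_vertex v u D f w) w) = (\<Prod>w\<in>D. \<omega> v w)"
    by (rule prod.cong) (use assms(2,3) in \<open>auto simp: insert_vertex_def\<close>)
  finally show ?thesis
    using assms by (simp add: insert_vertex_def mult.commute)
qed

lemma prod_add_restrict:
  fixes g h :: "'b \<Rightarrow> 'a :: comm_ring_1"
  assumes "finite V"
  shows "(\<Prod>w\<in>V. (if P w then g w else 0) + h w) =
    (\<Sum>D\<in>Pow {w \<in> V. P w}. (\<Prod>w\<in>D. g w) * (\<Prod>w\<in>V - D. h w))"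
proof -
  have "(\<Prod>w\<in>V. (if P w then g w else 0) + h w) =
      (\<Sum>D\<in>Pow V. (\<Prod>w\<in>D. if P w then g w else 0) * (\<Prod>w\<in>V - D. h w))"
    by (rule prod_add[OF assms])
  also have "\<dots> = (\<Sum>D\<in>Pow {w \<in> V. P w}. (\<Prod>w\<in>D. g w) * (\<Prod>w\<in>V - D. h w))"
  proof (rule sum.mono_neutral_cong_right)
    show "\<forall>D\<in>Pow V - Pow {w \<in> V. P w}. (\<Prod>w\<in>D. if P w then g w else 0) * (\<Prod>w\<in>V - D. h w) = 0"
    proof
      fix D assume "D \<in> Pow V - Pow {w \<in> V. P w}"
      then have "finite D" "\<exists>w\<in>D. (if P w then g w else 0) = 0"
        using assms finite_subset by auto
      then show "(\<Prod>w\<in>D. if P w then g w else 0) * (\<Prod>w\<in>V - D. h w) = 0"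
        by (simp add: prod_zero)
    qed
    fix D assume "D \<in> Pow {w \<in> V. P w}"
    then have "(\<Prod>w\<in>D. if P w then g w else 0) = (\<Prod>w\<in>D. g w)"
      by (intro prod.cong) auto
    then show "(\<Prod>w\<in>D. if P w then g w else 0) * (\<Prod>w\<in>V - D. h w) = (\<Prod>w\<in>D. g w) * (\<Prod>w\<in>V - D. h w)"
      by simp
  qed (use assms in auto)
  finally show ?thesis .
qed

text \<open>Contracting the edge above v: the children of v become children of the parent of v.\<close>

theorem forest_sum_contract:
  fixes \<omega> :: "nat \<Rightarrow> nat \<Rightarrow> 'a :: comm_ring_1"
  assumes fin: "finite V" and v: "v \<notin> V" "v \<noteq> 0" "0 \<notin> V"
  shows "forest_sum (insert v V) \<omega> =
    (\<Sum>u\<in>insert 0 V. \<omega> u v * forest_sum V (\<lambda>u' w. (if u' = u then \<omega> v w else 0) + \<omega> u' w))"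
proof -
  have "forest_sum (insert v V) \<omega> =
      (\<Sum>(u, f, D)\<in>(SIGMA u:insert 0 V. SIGMA f:forests V. Pow {w \<in> V. f w = u}).
        \<Prod>w\<in>insert v V. \<omega> (insert_vertex v u D f w) w)"
    unfolding forest_sum_def
    by (subst sum.reindex_bij_betw[OF bij_betw_insert_vertex[OF v], symmetric])
      (simp add: case_prod_beta)
  also have "\<dots> = (\<Sum>u\<in>insert 0 V. \<Sum>f\<in>forests V. \<Sum>D\<in>Pow {w \<in> V. f w = u}.
      \<Prod>w\<in>insert v V. \<omega> (insert_vertex v u D f w) w)"
    using fin by (simp add: sum.Sigma case_prod_beta)
  also have "\<dots> = (\<Sum>u\<in>insert 0 V. \<Sum>f\<in>forests V. \<omega> u v *
      (\<Prod>w\<in>V. (if f w = u then \<omega> v w else 0) + \<omega> (f w) w))"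
    unfolding prod_add_restrict[OF fin] sum_distrib_left
    by (intro sum.cong[OF refl] prod_insert_vertex[OF fin v(1)]) auto
  finally show ?thesis
    by (simp add: forest_sum_def sum_distrib_left)
qed

definition updown :: "'a \<Rightarrow> (nat \<Rightarrow> 'a) \<Rightarrow> (nat \<Rightarrow> 'a) \<Rightarrow> nat \<Rightarrow> nat \<Rightarrow> 'a" where
  "updown t A D u w = (if u = 0 then t else if u < w then A u else D u)"

definition updown_contracted ::
    "nat \<Rightarrow> 'a \<Rightarrow> (nat \<Rightarrow> 'a) \<Rightarrow> (nat \<Rightarrow> 'a) \<Rightarrow> nat \<Rightarrow> nat \<Rightarrow> nat \<Rightarrow> 'a :: comm_ring_1" where
  "updown_contracted N t A D v u w =
     (if u = v then updown t A D (Suc N) w else 0) + updown t A D u w"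

definition updown_factor ::
    "nat \<Rightarrow> 'a \<Rightarrow> (nat \<Rightarrow> 'a) \<Rightarrow> (nat \<Rightarrow> 'a) \<Rightarrow> nat \<Rightarrow> 'a :: comm_ring_1" where
  "updown_factor N t A D i = t + (\<Sum>u\<in>{1..i}. A u) + (\<Sum>u\<in>{i<..N}. D u)"

lemma updown_contract_root:
  "forest_sum {1..N} (updown_contracted N t A D 0) = forest_sum {1..N} (updown (t + D (Suc N)) A D)"
  by (rule forest_sum_cong) (auto simp: updown_contracted_def updown_def add.commute)

lemma updown_contract_vertex:
  assumes "v \<in> {1..N}"
  shows "forest_sum {1..N} (updown_contracted N t A D v) =
    forest_sum {1..N} (updown t (A(v := A v + D (Suc N))) (D(v := D v + D (Suc N))))"
  by (rule forest_sum_cong) (use assms in \<open>auto simp: updown_contracted_def updown_def add.commute\<close>)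

lemma sum_fun_upd_add:
  fixes g :: "'b \<Rightarrow> 'a :: comm_monoid_add"
  assumes "finite X"
  shows "(\<Sum>x\<in>X. (g(v := g v + d)) x) = (\<Sum>x\<in>X. g x) + (if v \<in> X then d else 0)"
proof -
  have "(\<Sum>x\<in>X. (g(v := g v + d)) x) = (\<Sum>x\<in>X. g x + (if x = v then d else 0))"
    by (rule sum.cong) auto
  then show ?thesis
    using assms by (simp add: sum.distrib)
qed

lemma updown_factor_Suc:
  "i \<le> N \<Longrightarrow> updown_factor (Suc N) t A D i = updown_factor N (t + D (Suc N)) A D i"
proof -
  assume "i \<le> N"
  then have "{i<..Suc N} = insert (Suc N) {i<..N}" by auto
  then show ?thesis by (simp add: updown_factor_def algebra_simps)
qed

lemma updown_factor_upd:
  assumes "v \<in> {1..N}" "i \<le> N"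
  shows "updown_factor N t (A(v := A v + d)) (D(v := D v + d)) i = updown_factor N (t + d) A D i"
  unfolding updown_factor_def
    sum_fun_upd_add[OF finite_atLeastAtMost] sum_fun_upd_add[OF finite_greaterThanAtMost]
  using assms by (auto simp: algebra_simps)

theorem forest_sum_updown:
  fixes A D :: "nat \<Rightarrow> 'a :: comm_ring_1"
  shows "forest_sum {1..Suc n} (updown t A D) = t * (\<Prod>i\<in>{1..n}. updown_factor (Suc n) t A D i)"
proof (induction n arbitrary: t A D)
  case 0
  have ins: "{1..Suc 0} = insert 1 {}" by auto
  show ?case
    unfolding ins using forest_sum_contract[of "{}" 1 "updown t A D"]
    by (simp add: forest_sum_empty updown_def[of _ _ _ 0])
next
  case (Suc n)
  let ?N = "Suc n"
  define d where "d = D (Suc ?N)"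
  define P where "P = (\<Prod>i\<in>{1..n}. updown_factor (Suc ?N) t A D i)"
  have P: "P = (\<Prod>i\<in>{1..n}. updown_factor ?N (t + d) A D i)"
    unfolding P_def d_def by (rule prod.cong[OF refl]) (simp add: updown_factor_Suc)
  let ?contracted = "\<lambda>v. forest_sum {1..?N} (updown_contracted ?N t A D v)"
  have root: "?contracted 0 = (t + d) * P"
    unfolding updown_contract_root Suc.IH P d_def ..
  have vertex: "?contracted v = t * P" if v: "v \<in> {1..?N}" for v
    unfolding updown_contract_vertex[OF v] Suc.IH P d_def
    by (intro arg_cong[of _ _ "(*) t"] prod.cong refl updown_factor_upd v) auto
  have "{1..Suc ?N} = insert (Suc ?N) {1..?N}" by auto
  then have "forest_sum {1..Suc ?N} (updown t A D) =
      (\<Sum>v\<in>insert 0 {1..?N}. updown t A D v (Suc ?N) * ?contracted v)"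
    unfolding updown_contracted_def by (simp only:) (rule forest_sum_contract, auto)
  also have "\<dots> = t * ((t + d) * P) + (\<Sum>v\<in>{1..?N}. A v * (t * P))"
  proof -
    have "(\<Sum>v\<in>{1..?N}. updown t A D v (Suc ?N) * ?contracted v) = (\<Sum>v\<in>{1..?N}. A v * (t * P))"
      by (rule sum.cong[OF refl]) (use vertex in \<open>auto simp: updown_def\<close>)
    then show ?thesis
      using root by (subst sum.insert) (auto simp: updown_def)
  qed
  also have "\<dots> = t * (P * (t + (\<Sum>v\<in>{1..?N}. A v) + d))"
    by (simp add: algebra_simps sum_distrib_left sum_distrib_right del: sum.cl_ivl_Suc)
  also have "t + (\<Sum>v\<in>{1..?N}. A v) + d = updown_factor (Suc ?N) t A D ?N"
  proof -
    have "{?N<..Suc ?N} = {Suc ?N}" by auto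
    then show ?thesis by (simp add: updown_factor_def d_def del: sum.cl_ivl_Suc)
  qed
  also have "P * updown_factor (Suc ?N) t A D ?N = (\<Prod>i\<in>{1..?N}. updown_factor (Suc ?N) t A D i)"
    by (simp add: P_def)
  finally show ?case .
qed

definition nonroots :: "nat \<Rightarrow> (nat \<Rightarrow> nat) \<Rightarrow> nat set" where
  "nonroots n f = {w \<in> {1..n}. f w \<noteq> 0}"

definition trees :: "nat \<Rightarrow> (nat \<Rightarrow> nat) set" where
  "trees n = {f \<in> forests {1..n}. card {w \<in> {1..n}. f w = 0} = 1}"

lemma finite_nonroots [simp]: "finite (nonroots n f)"
  by (simp add: nonroots_def)

lemma finite_trees [simp]: "finite (trees n)"
  by (simp add: trees_def)

lemma tree_parent:
  assumes "f \<in> trees n" "w \<in> nonroots n f"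
  shows "f w \<in> {1..n}" "f w \<noteq> w"
  using assms forest_parent[of f "{1..n}" w] forest_parent_ne[of f "{1..n}" w]
  by (auto simp: trees_def nonroots_def)

text \<open>Rooted trees are the forests counted by the linear term in the root weight t.\<close>

theorem tree_sum_updown:
  fixes A D :: "nat \<Rightarrow> 'a :: comm_ring_1"
  shows "(\<Sum>f\<in>trees (Suc n). \<Prod>w\<in>nonroots (Suc n) f. if f w < w then A (f w) else D (f w)) =
         (\<Prod>i\<in>{1..n}. updown_factor (Suc n) 0 A D i)"
proof -
  let ?V = "{1..Suc n}" and ?X = "[:0, 1:] :: 'a poly"
  let ?wt = "\<lambda>f. \<Prod>w\<in>nonroots (Suc n) f. if f w < w then A (f w) else D (f w)"
  let ?roots = "\<lambda>f :: nat \<Rightarrow> nat. card {w \<in> ?V. f w = 0}"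
  let ?Q = "\<Prod>i\<in>{1..n}. updown_factor (Suc n) ?X (\<lambda>u. [:A u:]) (\<lambda>u. [:D u:]) i"
  have prod_const: "(\<Prod>x\<in>S. [:g x:]) = [:\<Prod>x\<in>S. g x:]" if "finite S" for S and g :: "nat \<Rightarrow> 'a"
    using that by (induction S rule: finite_induct) (simp_all add: one_pCons)
  have "(\<Prod>w\<in>?V. updown ?X (\<lambda>u. [:A u:]) (\<lambda>u. [:D u:]) (f w) w) = monom (?wt f) (?roots f)" for f
  proof -
    have "(\<Prod>w\<in>?V. updown ?X (\<lambda>u. [:A u:]) (\<lambda>u. [:D u:]) (f w) w) =
        (\<Prod>w\<in>?V. if f w = 0 then ?X else [:if f w < w then A (f w) else D (f w):])"
      by (rule prod.cong) (auto simp: updown_def)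
    also have "\<dots> = (\<Prod>w\<in>?V \<inter> {w. f w = 0}. ?X) *
        (\<Prod>w\<in>?V \<inter> - {w. f w = 0}. [:if f w < w then A (f w) else D (f w):])"
      by (rule prod.If_cases) simp
    also have "?V \<inter> {w. f w = 0} = {w \<in> ?V. f w = 0}" by auto
    also have "?V \<inter> - {w. f w = 0} = nonroots (Suc n) f" by (auto simp: nonroots_def)
    finally show ?thesis
      by (simp add: prod_const monom_altdef mult.commute)
  qed
  then have "(\<Sum>f\<in>forests ?V. monom (?wt f) (?roots f)) = ?X * ?Q"
    using forest_sum_updown[of n ?X "\<lambda>u. [:A u:]" "\<lambda>u. [:D u:]"] unfolding forest_sum_def by simp
  then have "coeff (\<Sum>f\<in>forests ?V. monom (?wt f) (?roots f)) 1 = coeff (?X * ?Q) 1"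
    by (rule arg_cong)
  then have "(\<Sum>f\<in>forests ?V. if ?roots f = 1 then ?wt f else 0) = poly ?Q 0"
    by (simp add: coeff_sum poly_0_coeff_0)
  also have "poly ?Q 0 = (\<Prod>i\<in>{1..n}. updown_factor (Suc n) 0 A D i)"
    by (simp add: poly_prod poly_sum updown_factor_def)
  also have "(\<Sum>f\<in>forests ?V. if ?roots f = 1 then ?wt f else 0) = (\<Sum>f\<in>trees (Suc n). ?wt f)"
    unfolding trees_def by (rule sum.inter_filter[symmetric]) simp
  finally show ?thesis .
qed

section \<open>Colored rooted trees\<close>

definition colorings :: "nat \<Rightarrow> nat \<Rightarrow> (nat \<Rightarrow> nat) \<Rightarrow> (nat \<Rightarrow> nat) set" where
  "colorings n k f = PiE (nonroots n f) (\<lambda>_. {1..k})"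

definition tree_of :: "nat \<Rightarrow> (nat \<Rightarrow> nat) \<Rightarrow> (nat \<Rightarrow> nat) \<Rightarrow> (nat \<times> nat \<times> nat) set" where
  "tree_of n f c = (\<lambda>w. (f w, w, c w)) ` nonroots n f"

lemma finite_colorings [simp]: "finite (colorings n k f)"
  unfolding colorings_def by (intro finite_PiE) auto

lemma finite_colored_rooted_trees: "finite {T. colored_rooted_tree n k T}"
  by (rule finite_subset[of _ "Pow ({1..n} \<times> {1..n} \<times> {1..k})"])
    (auto simp: colored_rooted_tree_def)

lemma in_tree_of: "(u, w, y) \<in> tree_of n f c \<longleftrightarrow> w \<in> nonroots n f \<and> u = f w \<and> y = c w"
  by (auto simp: tree_of_def)

lemma card_tree_of: "card (tree_of n f c) = card (nonroots n f)"
  unfolding tree_of_def by (rule card_image) (auto simp: inj_on_def)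

lemma card_nonroots_add_roots: "card (nonroots n f) + card {w \<in> {1..n}. f w = 0} = n"
proof -
  have "card (nonroots n f \<union> {w \<in> {1..n}. f w = 0}) =
      card (nonroots n f) + card {w \<in> {1..n}. f w = 0}"
    by (rule card_Un_disjoint) (auto simp: nonroots_def)
  moreover have "nonroots n f \<union> {w \<in> {1..n}. f w = 0} = {1..n}"
    by (auto simp: nonroots_def)
  ultimately show ?thesis by simp
qed

lemma colored_rooted_tree_tree_of:
  assumes f: "f \<in> trees n" and c: "c \<in> colorings n k f"
  shows "colored_rooted_tree n k (tree_of n f c)"
proof -
  obtain h :: "nat \<Rightarrow> nat" where h: "\<And>w. w \<in> {1..n} \<Longrightarrow> h (f w) < h w"
    using f unfolding trees_def forests_def by blast
  have "f w \<in> {1..n}" "f w \<noteq> w" "w \<in> {1..n}" "c w \<in> {1..k}" if "w \<in> nonroots n f" for w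
    using tree_parent[OF f that] that PiE_mem[OF c[unfolded colorings_def] that]
    by (auto simp: nonroots_def)
  then have "tree_of n f c \<subseteq> {1..n} \<times> {1..n} \<times> {1..k}" "\<forall>(u, w, y)\<in>tree_of n f c. u \<noteq> w"
    unfolding tree_of_def by blast+
  moreover have "card (tree_of n f c) = n - 1"
    using f card_nonroots_add_roots[of n f] by (simp add: card_tree_of trees_def)
  moreover have "acyclic {(u, w). \<exists>y. (u, w, y) \<in> tree_of n f c}"
  proof (rule acyclic_subset[OF wf_acyclic[OF wf_measure[of h]]])
    show "{(u, w). \<exists>y. (u, w, y) \<in> tree_of n f c} \<subseteq> Wellfounded.measure h"
      using h by (auto simp: in_tree_of nonroots_def)
  qed
  ultimately show ?thesis
    unfolding colored_rooted_tree_def by (auto simp: tree_of_def)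
qed

lemma finite_acyclic_rank:
  assumes "finite V" "R \<subseteq> V \<times> V" "acyclic R"
  obtains h :: "'a \<Rightarrow> nat" where "\<And>u w. (u, w) \<in> R \<Longrightarrow> h u < h w"
proof
  fix u w assume uw: "(u, w) \<in> R"
  have "R\<^sup>+ \<subseteq> V \<times> V"
    using assms(2) by (rule trancl_subset_Sigma)
  then have "finite {x. (x, w) \<in> R\<^sup>+}"
    using assms(1) by (auto intro: finite_subset)
  moreover have "u \<in> {x. (x, w) \<in> R\<^sup>+}" "u \<notin> {x. (x, u) \<in> R\<^sup>+}"
    using uw assms(3) by (auto simp: acyclic_def)
  then have "{x. (x, u) \<in> R\<^sup>+} \<subset> {x. (x, w) \<in> R\<^sup>+}"
    using uw by (auto intro: trancl_into_trancl)
  ultimately show "card {x. (x, u) \<in> R\<^sup>+} < card {x. (x, w) \<in> R\<^sup>+}"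
    by (rule psubset_card_mono)
qed

lemma tree_if_colored_rooted_tree:
  assumes n: "1 \<le> n" and T: "colored_rooted_tree n k (tree_of n f c)"
    and ext: "f \<in> extensional {1..n}"
  shows "f \<in> trees n"
proof -
  have sub: "tree_of n f c \<subseteq> {1..n} \<times> {1..n} \<times> {1..k}" and card: "card (tree_of n f c) = n - 1"
    and acyclic: "acyclic {(u, w). \<exists>y. (u, w, y) \<in> tree_of n f c}"
    using T unfolding colored_rooted_tree_def by blast+
  obtain h :: "nat \<Rightarrow> nat"
    where h: "\<And>u w. (u, w) \<in> {(u, w). \<exists>y. (u, w, y) \<in> tree_of n f c} \<Longrightarrow> h u < h w"
    by (rule finite_acyclic_rank[OF finite_atLeastAtMost _ acyclic, of 1 n]) (use sub in auto)
  have edge: "f w = 0 \<or> f w \<in> {1..n} \<and> h (f w) < h w" if "w \<in> {1..n}" for w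
  proof (cases "f w = 0")
    case False
    then have "(f w, w, c w) \<in> tree_of n f c"
      using that by (simp add: in_tree_of nonroots_def)
    then show ?thesis
      using sub h by blast
  qed simp
  define g where "g x = (if x = 0 then 0 else Suc (h x))" for x
  have "g (f w) < g w" if "w \<in> {1..n}" for w
    using edge[OF that] that by (auto simp: g_def)
  moreover have "f w \<in> insert 0 {1..n}" if "w \<in> {1..n}" for w
    using edge[OF that] by blast
  ultimately have "f \<in> forests {1..n}"
    using ext unfolding forests_def PiE_def by blast
  then show ?thesis
    using card card_nonroots_add_roots[of n f] n by (simp add: trees_def card_tree_of)
qed

lemma colored_rooted_tree_eq_tree_of:
  assumes n: "1 \<le> n" and T: "colored_rooted_tree n k T"
  obtains f c where "f \<in> trees n" "c \<in> colorings n k f" "T = tree_of n f c"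
proof -
  let ?child = "\<lambda>t :: nat \<times> nat \<times> nat. fst (snd t)"
  have sub: "T \<subseteq> {1..n} \<times> {1..n} \<times> {1..k}" and inj: "inj_on ?child T"
    using T unfolding colored_rooted_tree_def inj_on_def by blast+
  define edge where "edge = the_inv_into T ?child"
  have edge: "edge w = (u, w, y)" if "(u, w, y) \<in> T" for u w y
    using the_inv_into_f_f[OF inj that] by (simp add: edge_def)
  define f where "f = (\<lambda>w\<in>{1..n}. if w \<in> ?child ` T then fst (edge w) else 0)"
  define c where "c = (\<lambda>w\<in>?child ` T. snd (snd (edge w)))"
  have nonroots: "nonroots n f = ?child ` T"
  proof (intro equalityI subsetI)
    fix w assume "w \<in> ?child ` T"
    then obtain u y where "(u, w, y) \<in> T" by auto
    then show "w \<in> nonroots n f"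
      using sub edge by (force simp: nonroots_def f_def)
  qed (auto simp: nonroots_def f_def split: if_splits)
  have parent_color: "f w = u" "c w = y" if "(u, w, y) \<in> T" for u w y
    using that sub edge[OF that] by (force simp: f_def c_def)+
  have "tree_of n f c = (\<lambda>t. (f (?child t), ?child t, c (?child t))) ` T"
    by (simp add: tree_of_def nonroots image_image)
  also have "\<dots> = (\<lambda>t. t) ` T"
    by (rule image_cong) (auto simp: parent_color)
  finally have T_eq: "T = tree_of n f c" by simp
  moreover have "c \<in> colorings n k f"
    unfolding colorings_def nonroots
  proof (rule PiE_I)
    fix w assume "w \<in> ?child ` T"
    then obtain u y where "(u, w, y) \<in> T" by auto
    then show "c w \<in> {1..k}"
      using parent_color(2) sub by blast
  qed (simp add: c_def)
  moreover have "f \<in> trees n"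
    by (rule tree_if_colored_rooted_tree[OF n T[unfolded T_eq]]) (simp add: f_def)
  ultimately show ?thesis
    using that by blast
qed

lemma inj_on_tree_of: "inj_on (\<lambda>(f, c). tree_of n f c) (SIGMA f:trees n. colorings n k f)"
proof (rule inj_onI, clarify)
  fix f c f' c'
  assume f: "f \<in> trees n" "c \<in> colorings n k f" and f': "f' \<in> trees n" "c' \<in> colorings n k f'"
    and eq: "tree_of n f c = tree_of n f' c'"
  have same: "w \<in> nonroots n f \<and> u = f w \<and> y = c w \<longleftrightarrow> w \<in> nonroots n f' \<and> u = f' w \<and> y = c' w"
    for u w y
    using eq by (metis in_tree_of)
  then have nonroots: "nonroots n f = nonroots n f'"
    by blast
  have "f w = f' w" for w
  proof (cases "w \<in> {1..n}")
    case True
    then have "w \<in> nonroots n f \<longleftrightarrow> f w \<noteq> 0" "w \<in> nonroots n f \<longleftrightarrow> f' w \<noteq> 0"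
      using nonroots by (auto simp: nonroots_def)
    then show ?thesis
      using same by metis
  next
    case False
    then show ?thesis
      using f(1) f'(1) by (auto simp: trees_def forests_def PiE_def extensional_def)
  qed
  moreover have "c w = c' w" for w
    using same nonroots f(2) f'(2)
    by (cases "w \<in> nonroots n f") (blast, auto simp: colorings_def PiE_def extensional_def)
  ultimately show "f = f' \<and> c = c'" by auto
qed

lemma bij_betw_tree_of:
  assumes "1 \<le> n"
  shows "bij_betw (\<lambda>(f, c). tree_of n f c) (SIGMA f:trees n. colorings n k f)
           {T. colored_rooted_tree n k T}"
proof (rule bij_betw_imageI[OF inj_on_tree_of], intro equalityI subsetI)
  fix T assume "T \<in> {T. colored_rooted_tree n k T}"
  then obtain f c where "f \<in> trees n" "c \<in> colorings n k f" "T = tree_of n f c"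
    using colored_rooted_tree_eq_tree_of[OF assms] by blast
  then show "T \<in> (\<lambda>(f, c). tree_of n f c) ` (SIGMA f:trees n. colorings n k f)"
    by (intro image_eqI[of _ _ "(f, c)"]) auto
qed (auto simp: colored_rooted_tree_tree_of)

definition non_increasing_at :: "nat \<Rightarrow> nat \<Rightarrow> nat set \<Rightarrow> (nat \<Rightarrow> nat) \<Rightarrow> bool" where
  "non_increasing_at k1 v C c \<longleftrightarrow> (C \<noteq> {} \<and> Min (c ` C) \<le> k1 \<longrightarrow> (\<exists>w\<in>C. c w = Min (c ` C) \<and> w < v))"

definition children :: "nat \<Rightarrow> (nat \<Rightarrow> nat) \<Rightarrow> nat \<Rightarrow> nat set" where
  "children n f v = {w \<in> nonroots n f. f w = v}"

lemma finite_children [simp]: "finite (children n f v)"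
  by (simp add: children_def)

text \<open>The condition is automatic at the vertex n, which is larger than all its children.\<close>

lemma non_increasing_tree_of:
  assumes f: "f \<in> trees n"
  shows "non_increasing k1 (tree_of n f c) \<longleftrightarrow>
      (\<forall>v\<in>{1..<n}. non_increasing_at k1 v (children n f v) c)"
proof -
  have "{y. \<exists>w. (v, w, y) \<in> tree_of n f c} = c ` children n f v" for v
    by (auto simp: in_tree_of children_def)
  moreover have "(\<exists>w y. (v, w, y) \<in> tree_of n f c) \<longleftrightarrow> children n f v \<noteq> {}" for v
    by (auto simp: in_tree_of children_def)
  moreover have "(\<exists>w. (v, w, y) \<in> tree_of n f c \<and> w < v) \<longleftrightarrow> (\<exists>w\<in>children n f v. c w = y \<and> w < v)"
    for v y
    by (auto simp: in_tree_of children_def)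
  ultimately have "non_increasing k1 (tree_of n f c) \<longleftrightarrow>
      (\<forall>v. non_increasing_at k1 v (children n f v) c)"
    by (simp add: non_increasing_def non_increasing_at_def min_child_color_def)
  moreover have "non_increasing_at k1 v (children n f v) c" if v: "v \<notin> {1..<n}" for v
    unfolding non_increasing_at_def
  proof (intro impI, elim conjE)
    assume ne: "children n f v \<noteq> {}"
    then have "v = n"
      using tree_parent(1)[OF f] v by (force simp: children_def)
    have "Min (c ` children n f v) \<in> c ` children n f v"
      using ne by (intro Min_in) auto
    then obtain w where w: "w \<in> children n f v" "c w = Min (c ` children n f v)" by auto
    moreover have "w < v"
      using w(1) tree_parent(2)[OF f, of w] \<open>v = n\<close> by (force simp: children_def nonroots_def)
    ultimately show "\<exists>w\<in>children n f v. c w = Min (c ` children n f v) \<and> w < v" by blast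
  qed
  ultimately show ?thesis by blast
qed

lemma num_root_edges_tree_of:
  "num_root_edges_col1 n (tree_of n f c) = card {w \<in> nonroots n f. f w = n \<and> c w = 1}"
proof -
  have "{t \<in> tree_of n f c. fst t = n \<and> snd (snd t) = 1} =
      (\<lambda>w. (f w, w, c w)) ` {w \<in> nonroots n f. f w = n \<and> c w = 1}"
    by (auto simp: tree_of_def)
  moreover have "inj_on (\<lambda>w. (f w, w, c w)) {w \<in> nonroots n f. f w = n \<and> c w = 1}"
    by (auto simp: inj_on_def)
  ultimately show ?thesis
    unfolding num_root_edges_col1_def by (simp only: card_image)
qed

section \<open>Inclusion-exclusion over the least child colors\<close>

lemma prod_of_bool:
  "finite C \<Longrightarrow> (\<Prod>w\<in>C. of_bool (P w)) = (of_bool (\<forall>w\<in>C. P w) :: 'a :: comm_semiring_1)"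
  by (induction C rule: finite_induct) auto

lemma sum_of_bool_unique:
  assumes "finite S" "\<And>s t. s \<in> S \<Longrightarrow> t \<in> S \<Longrightarrow> P s \<Longrightarrow> P t \<Longrightarrow> s = t"
  shows "(\<Sum>s\<in>S. of_bool (P s)) = (of_bool (\<exists>s\<in>S. P s) :: 'a :: semiring_1)"
proof (cases "\<exists>s\<in>S. P s")
  case True
  then obtain s where "s \<in> S" "P s" by blast
  then have "S \<inter> {s. P s} = {s}" using assms(2) by blast
  then show ?thesis
    using True assms(1) by simp
qed simp

definition least_color_below :: "nat \<Rightarrow> nat set \<Rightarrow> (nat \<Rightarrow> nat) \<Rightarrow> nat \<Rightarrow> bool" where
  "least_color_below v C c s \<longleftrightarrow> (\<forall>w\<in>C. s \<le> c w) \<and> (\<exists>w\<in>C. w < v \<and> c w = s)"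

lemma non_increasing_at_iff:
  assumes "finite C"
  shows "non_increasing_at k1 v C c \<longleftrightarrow> (\<forall>w\<in>C. k1 < c w) \<or> (\<exists>s\<le>k1. least_color_below v C c s)"
proof (cases "C = {}")
  case False
  then have "Min (c ` C) \<in> c ` C" "\<forall>w\<in>C. Min (c ` C) \<le> c w"
    using assms by auto
  then have "least_color_below v C c s \<longleftrightarrow> s = Min (c ` C) \<and> (\<exists>w\<in>C. c w = Min (c ` C) \<and> w < v)" for s
    unfolding least_color_below_def by (metis antisym imageE)
  moreover have "Min (c ` C) \<le> k1 \<longleftrightarrow> \<not> (\<forall>w\<in>C. k1 < c w)"
    using False assms by (auto simp: not_less Min_le_iff)
  ultimately show ?thesis
    using False unfolding non_increasing_at_def by blast
qed (simp add: non_increasing_at_def)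

text \<open>The colorings allowed by the choice (j, 0) but not by (j, 1) are those in which the least
  color is k1 - j + 1 and attained by a child smaller than the vertex.\<close>

definition choice_allows :: "nat \<Rightarrow> nat \<Rightarrow> nat \<times> nat \<Rightarrow> nat \<Rightarrow> nat \<Rightarrow> bool" where
  "choice_allows k1 v p w y \<longleftrightarrow> k1 - fst p + (if w < v then snd p else 0) < y"

lemma least_color_below_indicator:
  assumes "finite C" "s = Suc k1 - j" "j \<in> {1..k1}"
  shows "of_bool (\<forall>w\<in>C. choice_allows k1 v (j, 0) w (c w)) -
      of_bool (\<forall>w\<in>C. choice_allows k1 v (j, 1) w (c w)) =
    (of_bool (least_color_below v C c s) :: 'a :: ring_1)"
proof -
  have s_eq: "s = k1 - j + 1" using assms(2,3) by (simp add: Suc_diff_le)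
  have "(\<forall>w\<in>C. choice_allows k1 v (j, 1) w (c w)) \<longrightarrow> (\<forall>w\<in>C. choice_allows k1 v (j, 0) w (c w))"
    by (fastforce simp: choice_allows_def split: if_splits)
  moreover have "least_color_below v C c s \<longleftrightarrow>
      (\<forall>w\<in>C. choice_allows k1 v (j, 0) w (c w)) \<and> \<not> (\<forall>w\<in>C. choice_allows k1 v (j, 1) w (c w))"
    unfolding least_color_below_def choice_allows_def s_eq by (fastforce split: if_splits)
  ultimately show ?thesis by auto
qed

lemma non_increasing_at_indicator:
  assumes fin: "finite C" and pos: "\<And>w. w \<in> C \<Longrightarrow> 1 \<le> c w"
  shows "(\<Sum>p\<in>choices k1. (-1) ^ snd p * (\<Prod>w\<in>C. of_bool (choice_allows k1 v p w (c w)))) =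
    (of_bool (non_increasing_at k1 v C c) :: 'a :: comm_ring_1)"
proof -
  let ?allowed = "\<lambda>j e. of_bool (\<forall>w\<in>C. choice_allows k1 v (j, e) w (c w)) :: 'a"
  have "(\<Sum>p\<in>choices k1. (-1) ^ snd p * (\<Prod>w\<in>C. of_bool (choice_allows k1 v p w (c w)))) =
      (\<Sum>j\<in>{0..k1}. ?allowed j 0) - (\<Sum>j\<in>{1..k1}. ?allowed j 1)"
    using sum_choices[of ?allowed k1] by (simp add: prod_of_bool[OF fin] case_prod_beta)
  also have "\<dots> = ?allowed 0 0 + (\<Sum>j\<in>{1..k1}. ?allowed j 0 - ?allowed j 1)"
    unfolding sum_subtractf sum.atLeast_Suc_atMost[OF le0] One_nat_def
    by (rule add_diff_eq[symmetric])
  also have "(\<Sum>j\<in>{1..k1}. ?allowed j 0 - ?allowed j 1) =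
      (\<Sum>j\<in>{1..k1}. of_bool (least_color_below v C c (k1 + 1 - j)))"
    by (rule sum.cong[OF refl], rule least_color_below_indicator[OF fin]) auto
  also have "\<dots> = (\<Sum>s\<in>{1..k1}. of_bool (least_color_below v C c s))"
    by (rule sum.atLeastAtMost_rev[symmetric])
  also have "\<dots> = of_bool (\<exists>s\<in>{1..k1}. least_color_below v C c s)"
    by (rule sum_of_bool_unique) (auto simp: least_color_below_def intro: antisym)
  also have "?allowed 0 0 + \<dots> = of_bool (non_increasing_at k1 v C c)"
  proof -
    have "1 \<le> s" "s \<le> k1 \<Longrightarrow> \<not> (\<forall>w\<in>C. k1 < c w)" if "least_color_below v C c s" for s
      using that pos unfolding least_color_below_def by force+
    then have "(\<exists>s\<in>{1..k1}. least_color_below v C c s) \<longleftrightarrow> (\<exists>s\<le>k1. least_color_below v C c s)"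
      "(\<exists>s\<le>k1. least_color_below v C c s) \<longrightarrow> \<not> (\<forall>w\<in>C. k1 < c w)"
      by (meson atLeastAtMost_iff)+
    moreover have "?allowed 0 0 = of_bool (\<forall>w\<in>C. k1 < c w)"
      by (simp add: choice_allows_def)
    ultimately show ?thesis
      unfolding non_increasing_at_iff[OF fin] by (auto simp: of_bool_def)
  qed
  finally show ?thesis .
qed

definition choice_sign :: "nat \<Rightarrow> (nat \<Rightarrow> nat \<times> nat) \<Rightarrow> 'a :: comm_ring_1" where
  "choice_sign m \<kappa> = (\<Prod>u\<in>{1..m}. (-1) ^ snd (\<kappa> u))"

text \<open>Weight of an edge from u to w of color y: the vertex Suc m carries no condition, but its
  edges of color 1 are marked by x.\<close>

definition edge_weight ::
    "nat \<Rightarrow> nat \<Rightarrow> 'a :: comm_ring_1 \<Rightarrow> (nat \<Rightarrow> nat \<times> nat) \<Rightarrow> nat \<Rightarrow> nat \<Rightarrow> nat \<Rightarrow> 'a" where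
  "edge_weight m k1 x \<kappa> u w y =
     (if u = Suc m then (if y = 1 then x else 1) else of_bool (choice_allows k1 u (\<kappa> u) w y))"

lemma non_increasing_indicator:
  assumes f: "f \<in> trees (Suc m)" and c: "c \<in> colorings (Suc m) k f"
  shows "of_bool (non_increasing k1 (tree_of (Suc m) f c)) =
    (\<Sum>\<kappa>\<in>PiE {1..m} (\<lambda>_. choices k1). choice_sign m \<kappa> *
      (\<Prod>w\<in>nonroots (Suc m) f. edge_weight m k1 1 \<kappa> (f w) w (c w)) :: 'a :: comm_ring_1)"
proof -
  let ?Ks = "PiE {1..m} (\<lambda>_. choices k1)" and ?C = "children (Suc m) f"
  let ?ind = "\<lambda>v p w. of_bool (choice_allows k1 v p w (c w)) :: 'a"
  have pos: "1 \<le> c w" if "w \<in> ?C v" for v w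
    using that c by (auto simp: colorings_def children_def)
  have "of_bool (non_increasing k1 (tree_of (Suc m) f c)) =
      (\<Prod>v\<in>{1..m}. of_bool (non_increasing_at k1 v (?C v) c) :: 'a)"
    by (simp add: non_increasing_tree_of[OF f] prod_of_bool atLeastLessThanSuc_atLeastAtMost)
  also have "\<dots> = (\<Prod>v\<in>{1..m}. \<Sum>p\<in>choices k1. (-1) ^ snd p * (\<Prod>w\<in>?C v. ?ind v p w))"
    using pos by (simp add: non_increasing_at_indicator)
  also have "\<dots> = (\<Sum>\<kappa>\<in>?Ks. choice_sign m \<kappa> * (\<Prod>v\<in>{1..m}. \<Prod>w\<in>?C v. ?ind v (\<kappa> v) w))"
    by (subst prod_sum_PiE) (simp_all add: prod.distrib choice_sign_def)
  also have "\<dots> = (\<Sum>\<kappa>\<in>?Ks. choice_sign m \<kappa> *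
      (\<Prod>w\<in>nonroots (Suc m) f. edge_weight m k1 1 \<kappa> (f w) w (c w)))"
  proof (intro sum.cong refl arg_cong[of _ _ "(*) _"])
    fix \<kappa>
    have "(\<Prod>v\<in>{1..m}. \<Prod>w\<in>?C v. ?ind v (\<kappa> v) w) =
        (\<Prod>v\<in>{1..m}. \<Prod>w\<in>nonroots (Suc m) f. if f w = v then ?ind v (\<kappa> v) w else 1)"
      by (simp add: children_def prod.inter_filter)
    also have "\<dots> = (\<Prod>w\<in>nonroots (Suc m) f. \<Prod>v\<in>{1..m}. if f w = v then ?ind v (\<kappa> v) w else 1)"
      by (rule prod.swap)
    also have "\<dots> = (\<Prod>w\<in>nonroots (Suc m) f. edge_weight m k1 1 \<kappa> (f w) w (c w))"
    proof (rule prod.cong[OF refl])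
      fix w assume "w \<in> nonroots (Suc m) f"
      from tree_parent(1)[OF f this]
      show "(\<Prod>v\<in>{1..m}. if f w = v then ?ind v (\<kappa> v) w else 1) =
          edge_weight m k1 1 \<kappa> (f w) w (c w)"
        by (auto simp: edge_weight_def prod.delta)
    qed
    finally show "(\<Prod>v\<in>{1..m}. \<Prod>w\<in>?C v. ?ind v (\<kappa> v) w) =
        (\<Prod>w\<in>nonroots (Suc m) f. edge_weight m k1 1 \<kappa> (f w) w (c w))" .
  qed
  finally show ?thesis .
qed

lemma weighted_tree_indicator:
  fixes x :: "'a :: comm_ring_1" and f c :: "nat \<Rightarrow> nat" and m :: nat
  defines "T \<equiv> tree_of (Suc m) f c"
  assumes f: "f \<in> trees (Suc m)" and c: "c \<in> colorings (Suc m) k f"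
  shows "of_bool (non_increasing k1 T) * x ^ num_root_edges_col1 (Suc m) T =
    (\<Sum>\<kappa>\<in>PiE {1..m} (\<lambda>_. choices k1). choice_sign m \<kappa> *
      (\<Prod>w\<in>nonroots (Suc m) f. edge_weight m k1 x \<kappa> (f w) w (c w)))"
proof -
  let ?NR = "nonroots (Suc m) f"
  have "x ^ num_root_edges_col1 (Suc m) T = (\<Prod>w\<in>?NR. if f w = Suc m \<and> c w = 1 then x else 1)"
    unfolding T_def num_root_edges_tree_of by (simp add: prod.inter_filter[symmetric])
  moreover have "(\<Prod>w\<in>?NR. edge_weight m k1 1 \<kappa> (f w) w (c w)) *
      (\<Prod>w\<in>?NR. if f w = Suc m \<and> c w = 1 then x else 1) =
      (\<Prod>w\<in>?NR. edge_weight m k1 x \<kappa> (f w) w (c w))" for \<kappa>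
    unfolding prod.distrib[symmetric] by (rule prod.cong) (auto simp: edge_weight_def)
  ultimately show ?thesis
    unfolding T_def non_increasing_indicator[OF f c] sum_distrib_right by (simp only: mult.assoc)
qed

definition up_weight :: "nat \<Rightarrow> nat \<Rightarrow> nat \<Rightarrow> 'a :: comm_ring_1 \<Rightarrow> (nat \<Rightarrow> nat \<times> nat) \<Rightarrow> nat \<Rightarrow> 'a" where
  "up_weight m k1 k2 x \<kappa> u =
      (if u = Suc m then of_nat (k1 + k2) - 1 + x else of_nat k2 + of_nat (fst (\<kappa> u)))"

definition down_weight :: "nat \<Rightarrow> nat \<Rightarrow> nat \<Rightarrow> 'a :: comm_ring_1 \<Rightarrow> (nat \<Rightarrow> nat \<times> nat) \<Rightarrow> nat \<Rightarrow> 'a" where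
  "down_weight m k1 k2 x \<kappa> u =
      up_weight m k1 k2 x \<kappa> u - (if u = Suc m then 0 else of_nat (snd (\<kappa> u)))"

definition choice_factor ::
    "nat \<Rightarrow> nat \<Rightarrow> nat \<Rightarrow> 'a :: comm_ring_1 \<Rightarrow> (nat \<Rightarrow> nat \<times> nat) \<Rightarrow> nat \<Rightarrow> 'a" where
  "choice_factor m k1 k2 x \<kappa> =
     updown_factor (Suc m) 0 (up_weight m k1 k2 x \<kappa>) (down_weight m k1 k2 x \<kappa>)"

lemma sum_choice_allows:
  assumes "p \<in> choices k1"
  shows "(\<Sum>y\<in>{1..k1 + k2}. of_bool (choice_allows k1 v p w y)) =
    (of_nat k2 + of_nat (fst p) - (if w < v then of_nat (snd p) else 0) :: 'a :: comm_ring_1)"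
proof -
  let ?s = "k1 - fst p + (if w < v then snd p else 0)"
  have threshold: "?s \<le> k1 + k2" "k1 + k2 - ?s + (if w < v then snd p else 0) = k2 + fst p"
    using assms by (auto simp: choices_def)
  have "{1..k1 + k2} \<inter> {y. choice_allows k1 v p w y} = {?s<..k1 + k2}"
    by (auto simp: choice_allows_def)
  then have "(\<Sum>y\<in>{1..k1 + k2}. of_bool (choice_allows k1 v p w y)) = (of_nat (k1 + k2 - ?s) :: 'a)"
    by simp
  also have "\<dots> = of_nat k2 + of_nat (fst p) - (if w < v then of_nat (snd p) else 0)"
    using arg_cong[OF threshold(2), of "of_nat :: nat \<Rightarrow> 'a"] by (auto simp: eq_diff_eq)
  finally show ?thesis .
qed

lemma sum_edge_weight:
  fixes x :: "'a :: comm_ring_1"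
  assumes k1: "1 \<le> k1" and \<kappa>: "\<kappa> \<in> PiE {1..m} (\<lambda>_. choices k1)" and u: "u \<in> {1..Suc m}" "u \<noteq> w"
  shows "(\<Sum>y\<in>{1..k1 + k2}. edge_weight m k1 x \<kappa> u w y) =
    (if u < w then up_weight m k1 k2 x \<kappa> u else down_weight m k1 k2 x \<kappa> u)"
proof (cases "u = Suc m")
  case True
  have "(\<Sum>y\<in>{1..k1 + k2}. edge_weight m k1 x \<kappa> u w y) =
      (\<Sum>y\<in>{1..k1 + k2}. (if y = 1 then x - 1 else 0) + 1)"
    unfolding edge_weight_def using True by (intro sum.cong) auto
  also have "\<dots> = x - 1 + of_nat (k1 + k2)"
    using k1 by (subst sum.distrib) (simp add: sum.delta)
  finally show ?thesis using True by (simp add: up_weight_def down_weight_def)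
next
  case False
  then have "\<kappa> u \<in> choices k1" using \<kappa> u by auto
  then have "(\<Sum>y\<in>{1..k1 + k2}. edge_weight m k1 x \<kappa> u w y) =
      of_nat k2 + of_nat (fst (\<kappa> u)) - (if w < u then of_nat (snd (\<kappa> u)) else 0)"
    by (simp only: edge_weight_def False if_False sum_choice_allows)
  then show ?thesis
    using False u(2) by (simp add: up_weight_def down_weight_def)
qed

lemma sum_edge_weights_over_trees:
  fixes x :: "'a :: comm_ring_1"
  assumes k1: "1 \<le> k1" and \<kappa>: "\<kappa> \<in> PiE {1..m} (\<lambda>_. choices k1)"
  shows "(\<Sum>f\<in>trees (Suc m). \<Sum>c\<in>colorings (Suc m) (k1 + k2) f.
      \<Prod>w\<in>nonroots (Suc m) f. edge_weight m k1 x \<kappa> (f w) w (c w)) =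
    (\<Prod>i\<in>{1..m}. choice_factor m k1 k2 x \<kappa> i)"
  unfolding choice_factor_def tree_sum_updown[symmetric]
proof (rule sum.cong[OF refl])
  fix f assume f: "f \<in> trees (Suc m)"
  let ?A = "up_weight m k1 k2 x \<kappa>" and ?D = "down_weight m k1 k2 x \<kappa>"
  have "(\<Sum>c\<in>colorings (Suc m) (k1 + k2) f.
        \<Prod>w\<in>nonroots (Suc m) f. edge_weight m k1 x \<kappa> (f w) w (c w)) =
      (\<Prod>w\<in>nonroots (Suc m) f. \<Sum>y\<in>{1..k1 + k2}. edge_weight m k1 x \<kappa> (f w) w y)"
    unfolding colorings_def by (rule prod_sum_PiE[symmetric]) auto
  also have "\<dots> = (\<Prod>w\<in>nonroots (Suc m) f. if f w < w then ?A (f w) else ?D (f w))"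
    by (intro prod.cong refl sum_edge_weight[OF k1 \<kappa>] tree_parent[OF f])
  finally show "(\<Sum>c\<in>colorings (Suc m) (k1 + k2) f.
        \<Prod>w\<in>nonroots (Suc m) f. edge_weight m k1 x \<kappa> (f w) w (c w)) =
      (\<Prod>w\<in>nonroots (Suc m) f. if f w < w then ?A (f w) else ?D (f w))" .
qed

theorem colored_tree_sum:
  fixes x :: "'a :: comm_ring_1"
  assumes k1: "1 \<le> k1"
  shows "(\<Sum>T | colored_rooted_tree (Suc m) (k1 + k2) T \<and> non_increasing k1 T.
      x ^ num_root_edges_col1 (Suc m) T) =
    (\<Sum>\<kappa>\<in>PiE {1..m} (\<lambda>_. choices k1). choice_sign m \<kappa> *
      (\<Prod>i\<in>{1..m}. choice_factor m k1 k2 x \<kappa> i))"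
proof -
  let ?n = "Suc m" and ?k = "k1 + k2" and ?Ks = "PiE {1..m} (\<lambda>_. choices k1)"
  let ?wt = "\<lambda>T. of_bool (non_increasing k1 T) * x ^ num_root_edges_col1 ?n T"
  let ?prod = "\<lambda>\<kappa> f c. \<Prod>w\<in>nonroots ?n f. edge_weight m k1 x \<kappa> (f w) w (c w)"
  have "(\<Sum>T | colored_rooted_tree ?n ?k T \<and> non_increasing k1 T. x ^ num_root_edges_col1 ?n T) =
      (\<Sum>T | colored_rooted_tree ?n ?k T. ?wt T)"
    by (rule sum.mono_neutral_cong_left) (auto simp: finite_colored_rooted_trees)
  also have "\<dots> = (\<Sum>(f, c)\<in>(SIGMA f:trees ?n. colorings ?n ?k f). ?wt (tree_of ?n f c))"
    by (subst sum.reindex_bij_betw[OF bij_betw_tree_of, symmetric]) (simp_all add: case_prod_beta)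
  also have "\<dots> = (\<Sum>f\<in>trees ?n. \<Sum>c\<in>colorings ?n ?k f. ?wt (tree_of ?n f c))"
    by (rule sum.Sigma[symmetric]) auto
  also have "\<dots> = (\<Sum>f\<in>trees ?n. \<Sum>c\<in>colorings ?n ?k f. \<Sum>\<kappa>\<in>?Ks. choice_sign m \<kappa> * ?prod \<kappa> f c)"
    by (intro sum.cong refl weighted_tree_indicator)
  also have "\<dots> = (\<Sum>f\<in>trees ?n. \<Sum>\<kappa>\<in>?Ks. \<Sum>c\<in>colorings ?n ?k f. choice_sign m \<kappa> * ?prod \<kappa> f c)"
    by (intro sum.cong refl sum.swap)
  also have "\<dots> = (\<Sum>\<kappa>\<in>?Ks. \<Sum>f\<in>trees ?n. \<Sum>c\<in>colorings ?n ?k f. choice_sign m \<kappa> * ?prod \<kappa> f c)"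
    by (rule sum.swap)
  also have "\<dots> = (\<Sum>\<kappa>\<in>?Ks. choice_sign m \<kappa> *
      (\<Prod>i\<in>{1..m}. choice_factor m k1 k2 x \<kappa> i))"
    by (intro sum.cong refl)
      (simp only: sum_distrib_left[symmetric] sum_edge_weights_over_trees[OF k1])
  finally show ?thesis .
qed

lemma choice_factor_eq:
  fixes q :: "'a :: comm_ring_1"
  assumes "i \<in> {1..m}"
  shows "choice_factor m k1 k2 (1 - q) \<kappa> i =
    - (q - of_nat (k1 + k2) - of_nat m * of_nat k2 - (\<Sum>u\<in>{1..m}. of_nat (fst (\<kappa> u))) +
       (\<Sum>u\<in>{i<..m}. of_nat (snd (\<kappa> u))))"
proof -
  let ?A = "up_weight m k1 k2 (1 - q) \<kappa>" and ?D = "down_weight m k1 k2 (1 - q) \<kappa>"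
  let ?a = "\<lambda>u. of_nat k2 + of_nat (fst (\<kappa> u)) :: 'a"
  have up: "(\<Sum>u\<in>{1..i}. ?A u) = (\<Sum>u\<in>{1..i}. ?a u)"
    by (rule sum.cong) (use assms in \<open>auto simp: up_weight_def\<close>)
  have "{i<..Suc m} = insert (Suc m) {i<..m}"
    using assms by auto
  then have "(\<Sum>u\<in>{i<..Suc m}. ?D u) = of_nat (k1 + k2) - q + (\<Sum>u\<in>{i<..m}. ?D u)"
    by (simp add: up_weight_def down_weight_def)
  also have "(\<Sum>u\<in>{i<..m}. ?D u) = (\<Sum>u\<in>{i<..m}. ?a u - of_nat (snd (\<kappa> u)))"
    by (rule sum.cong) (auto simp: up_weight_def down_weight_def)
  finally have down: "(\<Sum>u\<in>{i<..Suc m}. ?D u) =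
      of_nat (k1 + k2) - q + ((\<Sum>u\<in>{i<..m}. ?a u) - (\<Sum>u\<in>{i<..m}. of_nat (snd (\<kappa> u))))"
    unfolding sum_subtractf .
  have "{1..m} = {1..i} \<union> {i<..m}"
    using assms by auto
  then have "(\<Sum>u\<in>{1..i}. ?a u) + (\<Sum>u\<in>{i<..m}. ?a u) = (\<Sum>u\<in>{1..m}. ?a u)"
    by (simp only:) (rule sum.union_disjoint[symmetric], auto)
  also have "\<dots> = of_nat m * of_nat k2 + (\<Sum>u\<in>{1..m}. of_nat (fst (\<kappa> u)))"
    by (simp add: sum.distrib)
  finally show ?thesis
    unfolding choice_factor_def updown_factor_def up down
    by (simp only: algebra_simps add_0_left) (simp add: algebra_simps)
qed

corollary colored_tree_sum_eq_choice_sum: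
  fixes q :: "'a :: comm_ring_1"
  assumes "1 \<le> k1"
  shows "(\<Sum>T | colored_rooted_tree (Suc m) (k1 + k2) T \<and> non_increasing k1 T.
            (1 - q) ^ num_root_edges_col1 (Suc m) T) =
         (-1) ^ m * choice_sum k1 m (\<lambda>_. 1) 0 (q - of_nat (k1 + k2) - of_nat m * of_nat k2)"
proof -
  let ?R = "q - of_nat (k1 + k2) - of_nat m * of_nat k2"
  let ?z = "\<lambda>\<kappa> i. ?R - (\<Sum>u\<in>{1..m}. of_nat (fst (\<kappa> u))) + (\<Sum>u\<in>{i<..m}. of_nat (snd (\<kappa> u)))"
  have "(\<Prod>i\<in>{1..m}. choice_factor m k1 k2 (1 - q) \<kappa> i) = (-1) ^ m * (\<Prod>i\<in>{1..m}. ?z \<kappa> i)" for \<kappa>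
  proof -
    have "(\<Prod>i\<in>{1..m}. choice_factor m k1 k2 (1 - q) \<kappa> i) = (\<Prod>i\<in>{1..m}. - ?z \<kappa> i)"
      by (rule prod.cong[OF refl choice_factor_eq])
    then show ?thesis
      by (simp only: prod_uminus card_atLeastAtMost diff_Suc_1)
  qed
  then show ?thesis
    unfolding colored_tree_sum[OF assms] choice_sum_def choice_term_def choice_sign_def Let_def
      sum_distrib_left
    by (intro sum.cong refl) (simp only: mult_ac add_0_right mult_1_left)
qed

section \<open>Comparing bases and trees\<close>

definition ascent_gap :: "nat \<Rightarrow> nat \<Rightarrow> nat \<Rightarrow> nat \<Rightarrow> int" where
  "ascent_gap k1 k2 u v = (if u < v then int k1 + int k2 + 1 else int k2)"

locale interval_gain_graph =
  fixes m k1 k2 :: nat and r :: "gedge \<Rightarrow> nat"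
  assumes k1_pos: "1 \<le> k1" and inj_r: "inj_on r (gain_edges (Suc m) (1 - int k2) (int k1 + int k2))"
begin

sublocale ordered_gain_graph "Suc m" "1 - int k2" "int k1 + int k2" r
  using k1_pos inj_r by unfold_locales auto

sublocale gap_function "ascent_gap k1 k2"
  by unfold_locales (auto simp: ascent_gap_def)

lemma total_gap_ascents:
  "total_gap w = int (ascents w) * (int k1 + 1) + int (length w - 1) * int k2"
proof (induction w rule: total_gap.induct)
  case (3 u v w)
  then show ?case
    by (cases "u < v") (simp_all add: ascent_gap_def[of _ _ u v] algebra_simps)
qed simp_all

lemma separated_if_proper:
  assumes x: "x \<in> proper_vectors q"
  shows "x \<in> separated_points (int k2) (q - (int k1 + int k2)) {1..m}"
proof -
  have range: "0 \<le> x i \<and> x i < q" if "i \<in> {1..m}" for i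
    using x that by (auto simp: proper_vectors_def residue_vectors_def)
  have zero: "x i = 0" if "i \<notin> {1..m}" for i
    using x that unfolding proper_vectors_def residue_vectors_def atLeastLessThanSuc_atLeastAtMost
    by auto
  have proper: "\<not> q dvd x j - x i - g" if "(i, j, g) \<in> E" for i j g
  proof -
    have "\<not> q dvd slack x (i, j, g)"
      using x that by (auto simp: proper_vectors_def)
    then show ?thesis
      by (simp add: slack_edge)
  qed
  have "int k2 \<le> x i \<and> x i < q - (int k1 + int k2)" if i: "i \<in> {1..m}" for i
  proof (rule ccontr)
    assume "\<not> ?thesis"
    then have "(i, Suc m, - x i) \<in> E \<or> (i, Suc m, q - x i) \<in> E"
      using range[OF i] i by (auto simp: gain_edges_iff)
    then show False
      using proper[of i "Suc m" "- x i"] proper[of i "Suc m" "q - x i"] zero[of "Suc m"] by auto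
  qed
  moreover have less: "precedes x i j \<or> precedes x j i" if ij: "i \<in> {1..m}" "j \<in> {1..m}" "i < j"
    for i j
  proof (rule ccontr)
    assume "\<not> ?thesis"
    then have "(i, j, x j - x i) \<in> E"
      using ij by (auto simp: gain_edges_iff precedes_def ascent_gap_def)
    then show False
      using proper by fastforce
  qed
  have "precedes x i j \<or> precedes x j i" if "i \<in> {1..m}" "j \<in> {1..m}" "i \<noteq> j" for i j
    using less that by (metis linorder_neqE_nat)
  ultimately show ?thesis
    using zero by (auto simp: separated_points_def)
qed

lemma proper_if_separated:
  assumes x: "x \<in> separated_points (int k2) (q - (int k1 + int k2)) {1..m}"
  shows "x \<in> proper_vectors q"
proof -
  have bounds: "int k2 \<le> x i" "x i < q - (int k1 + int k2)" if "i \<in> {1..m}" for i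
    using x that by (auto simp: separated_points_def)
  have zero: "x i = 0" if "i \<notin> {1..m}" for i
    using x that by (auto simp: separated_points_def)
  have separated: "precedes x i j \<or> precedes x j i" if "i \<in> {1..m}" "j \<in> {1..m}" "i \<noteq> j" for i j
    using x that by (auto simp: separated_points_def)
  have "0 \<le> x i \<and> x i < q" if "i \<in> {1..m}" for i
    using bounds[OF that] by linarith
  then have "x \<in> residue_vectors q"
    unfolding residue_vectors_def atLeastLessThanSuc_atLeastAtMost using zero by auto
  moreover have "\<not> q dvd slack x (i, j, g)" if e: "(i, j, g) \<in> E" for i j g
  proof -
    have gain: "1 - int k2 \<le> g" "g \<le> int k1 + int k2" "i < j" "j \<le> Suc m" and i: "i \<in> {1..m}"
      using e by (auto simp: gain_edges_iff)
    have "slack x (i, j, g) \<noteq> 0 \<and> \<bar>slack x (i, j, g)\<bar> < q"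
    proof (cases "j = Suc m")
      case True
      then have "x j = 0" by (intro zero) simp
      then show ?thesis using bounds[OF i] gain by (simp add: slack_edge)
    next
      case False
      then have j: "j \<in> {1..m}" using gain by auto
      have "precedes x i j \<or> precedes x j i"
        using separated[OF i j] gain(3) by simp
      then have "x j - x i \<ge> int k1 + int k2 + 1 \<or> x i - x j \<ge> int k2"
        using gain(3) by (auto simp: precedes_def ascent_gap_def)
      then show ?thesis using bounds[OF i] bounds[OF j] gain by (simp add: slack_edge) linarith
    qed
    then show ?thesis
      using zdvd_imp_le[of q "\<bar>slack x (i, j, g)\<bar>"] by auto
  qed
  ultimately show ?thesis
    by (auto simp: proper_vectors_def)
qed

lemma proper_vectors_eq_separated_points:
  "proper_vectors q = separated_points (int k2) (q - (int k1 + int k2)) {1..m}"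
  using separated_if_proper proper_if_separated by blast

lemma card_proper_vectors_eq_choice_sum:
  assumes q: "int (k1 + k2) + int m * int k2 + int m * (int k1 + 1) < q"
  shows "of_nat (card (proper_vectors q)) =
    choice_sum k1 m (\<lambda>_. 1) 0
      (of_int q - of_nat (k1 + k2) - of_nat m * of_nat k2 :: 'a :: field_char_0)"
proof -
  let ?R = "of_int q - of_nat (k1 + k2) - of_nat m * of_nat k2 :: 'a"
  let ?z = "\<lambda>w. q - (int k1 + int k2) - int k2 - total_gap w + int m - 1"
  have "of_nat (card (proper_vectors q)) =
      (\<Sum>w\<in>permutations_of_set {1..m}. of_nat (nat (?z w) choose m) :: 'a)"
    by (simp add: proper_vectors_eq_separated_points card_separated_points)
  also have "\<dots> =
      (\<Sum>w\<in>permutations_of_set {1..m}. multichoose (?R - of_nat (ascents w) * of_nat (Suc k1)) m)"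
  proof (rule sum.cong[OF refl])
    fix w assume w: "w \<in> permutations_of_set {1..m}"
    show "of_nat (nat (?z w) choose m) = multichoose (?R - of_nat (ascents w) * of_nat (Suc k1)) m"
    proof (cases "m = 0")
      case False
      have z_eq: "?z w =
          q - int (k1 + k2) - int m * int k2 + int m - 1 - int (ascents w) * (int k1 + 1)"
        using False length_finite_permutations_of_set[OF w]
        by (simp add: total_gap_ascents of_nat_diff algebra_simps)
      have "int (ascents w) * (int k1 + 1) \<le> int m * (int k1 + 1)"
        using ascents_permutation_le[OF w] by (intro mult_right_mono) auto
      then have "0 \<le> ?z w"
        unfolding z_eq using q False by linarith
      then have "of_nat (nat (?z w) choose m) = (of_int (?z w) gchoose m :: 'a)"
        by (simp add: binomial_gbinomial)
      also have "of_int (?z w) = ?R - of_nat (ascents w) * of_nat (Suc k1) + of_nat m - 1"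
        unfolding z_eq by (simp add: algebra_simps)
      finally show ?thesis
        by (simp only: multichoose_def)
    qed simp
  qed
  finally show ?thesis
    by (simp only: choice_sum_ascents)
qed

lemma nbc_basis_sum_eq_tree_sum:
  fixes q :: int
  assumes q: "int (Suc m) * (\<bar>1 - int k2\<bar> + \<bar>int k1 + int k2\<bar>) < q"
    "int (k1 + k2) + int m * int k2 + int m * (int k1 + 1) < q"
  shows "(\<Sum>B | nbc_basis r (Suc m) (1 - int k2) (int k1 + int k2) B.
      (1 - of_int q) ^ activity r (Suc m) (1 - int k2) (int k1 + int k2) B) =
    (\<Sum>T | colored_rooted_tree (Suc m) (k1 + k2) T \<and> non_increasing k1 T.
      (1 - of_int q) ^ num_root_edges_col1 (Suc m) T :: 'a :: field_char_0)"
proof -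
  let ?act = "activity r (Suc m) (1 - int k2) (int k1 + int k2)"
  let ?X = "{B. nbc_basis r (Suc m) (1 - int k2) (int k1 + int k2) B}"
  have "(\<Sum>B\<in>?X. (1 - q) ^ ?act B) = (-1) ^ m * int (card (proper_vectors q))"
    using nbc_sets_alternating_sum_activity[of q] card_proper_vectors[OF q(1)] by simp
  then have "of_int (\<Sum>B\<in>?X. (1 - q) ^ ?act B) =
      (of_int ((-1) ^ m * int (card (proper_vectors q))) :: 'a)"
    by (rule arg_cong)
  then have "(\<Sum>B\<in>?X. (1 - of_int q) ^ ?act B) = ((-1) ^ m * of_nat (card (proper_vectors q)) :: 'a)"
    by simp
  then show ?thesis
    by (simp only: colored_tree_sum_eq_choice_sum[OF k1_pos]
        card_proper_vectors_eq_choice_sum[OF q(2)])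
qed

end

lemma card_eq_if_power_sums_eq:
  assumes "finite X" "finite Y" "infinite S"
    and "\<And>x :: 'a :: {idom, ring_char_0}. x \<in> S \<Longrightarrow> (\<Sum>a\<in>X. x ^ f a) = (\<Sum>b\<in>Y. x ^ g b)"
  shows "card {a \<in> X. f a = \<alpha>} = card {b \<in> Y. g b = \<alpha>}"
proof -
  define P where "P = (\<Sum>a\<in>X. monom (1 :: 'a) (f a)) - (\<Sum>b\<in>Y. monom 1 (g b))"
  have "poly P x = 0" if "x \<in> S" for x
    using assms(4)[OF that] by (simp add: P_def poly_sum poly_monom)
  then have "S \<subseteq> {x. poly P x = 0}" by auto
  then have "P = 0"
    using assms(3) poly_roots_finite finite_subset by blast
  then have "coeff (\<Sum>a\<in>X. monom (1 :: 'a) (f a)) \<alpha> = coeff (\<Sum>b\<in>Y. monom 1 (g b)) \<alpha>"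
    by (simp add: P_def)
  then have "(\<Sum>a\<in>X. if f a = \<alpha> then 1 else 0 :: 'a) = (\<Sum>b\<in>Y. if g b = \<alpha> then 1 else 0)"
    by (simp add: coeff_sum)
  then show ?thesis
    using assms(1,2) by (simp add: sum.inter_filter[symmetric])
qed

theorem (in interval_gain_graph) card_nbc_bases_eq_card_trees:
  "card {B. nbc_basis r (Suc m) (1 - int k2) (int k1 + int k2) B \<and>
      activity r (Suc m) (1 - int k2) (int k1 + int k2) B = \<alpha>} =
   card {T. colored_rooted_tree (Suc m) (k1 + k2) T \<and> non_increasing k1 T \<and>
      num_root_edges_col1 (Suc m) T = \<alpha>}"
proof -
  let ?X = "{B. nbc_basis r (Suc m) (1 - int k2) (int k1 + int k2) B}"
  let ?Y = "{T. colored_rooted_tree (Suc m) (k1 + k2) T \<and> non_increasing k1 T}"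
  let ?S = "{max (int (Suc m) * (\<bar>1 - int k2\<bar> + \<bar>int k1 + int k2\<bar>))
    (int (k1 + k2) + int m * int k2 + int m * (int k1 + 1))<..}"
  have infinite: "infinite ((\<lambda>q. 1 - real_of_int q) ` ?S)"
  proof
    assume "finite ((\<lambda>q. 1 - real_of_int q) ` ?S)"
    then have "finite ?S"
      by (rule finite_imageD) (auto simp: inj_on_def)
    then show False using infinite_Ioi by blast
  qed
  have finite: "finite ?Y"
    by (rule finite_subset[OF _ finite_colored_rooted_trees]) auto
  have "card {B \<in> ?X. activity r (Suc m) (1 - int k2) (int k1 + int k2) B = \<alpha>} =
      card {T \<in> ?Y. num_root_edges_col1 (Suc m) T = \<alpha>}"
    by (rule card_eq_if_power_sums_eq[OF finite_nbc_bases finite infinite])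
      (use nbc_basis_sum_eq_tree_sum in auto)
  then show ?thesis
    by (simp add: conj_assoc)
qed

section \<open>Symmetric reachability\<close>

lemma rtrancl_insert_absorb: "(i, j) \<in> D\<^sup>* \<Longrightarrow> (insert (i, j) D)\<^sup>* = D\<^sup>*"
  unfolding rtrancl_insert by (auto intro: rtrancl_trans)

lemma rtrancl_insert_rev: "(j, i) \<in> (insert (i, j) D)\<^sup>* \<longleftrightarrow> (j, i) \<in> D\<^sup>*"
  unfolding rtrancl_insert by auto

lemma rtrancl_insert_both:
  "(b, a) \<in> (insert (i, j) (insert (j, i) D))\<^sup>* \<longleftrightarrow> (b, a) \<in> D\<^sup>* \<or>
     (b, i) \<in> D\<^sup>* \<and> (j, a) \<in> D\<^sup>* \<or> (b, j) \<in> D\<^sup>* \<and> (i, a) \<in> D\<^sup>*"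
  unfolding rtrancl_insert by (auto intro: rtrancl_trans)

lemma sym_rtrancl_iff: "sym (D\<^sup>*) \<longleftrightarrow> (\<forall>a b. (a, b) \<in> D \<longrightarrow> (b, a) \<in> D\<^sup>*)"
proof
  assume "\<forall>a b. (a, b) \<in> D \<longrightarrow> (b, a) \<in> D\<^sup>*"
  then have "D\<inverse> \<subseteq> D\<^sup>*" by auto
  then have "(D\<^sup>*)\<inverse> \<subseteq> D\<^sup>*"
    unfolding rtrancl_converse[symmetric] by (rule rtrancl_subset_rtrancl)
  then show "sym (D\<^sup>*)"
    by (auto simp: sym_def)
qed (auto dest: symD)

lemma rtrancl_sym_closure: "sym (D\<^sup>*) \<Longrightarrow> (D \<union> D\<inverse>)\<^sup>* = D\<^sup>*"
  by (rule rtrancl_subset) (auto dest: symD)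

lemma sym_rtrancl_insert_iff:
  assumes "sym (D\<^sup>*)" "(i, j) \<in> (D \<union> D\<inverse>)\<^sup>*"
  shows "(insert (i, j) D)\<^sup>* = D\<^sup>*" "(insert (j, i) D)\<^sup>* = D\<^sup>*"
    "(insert (i, j) (insert (j, i) D))\<^sup>* = D\<^sup>*"
proof -
  have "(i, j) \<in> D\<^sup>*" "(j, i) \<in> D\<^sup>*"
    using assms rtrancl_sym_closure[OF assms(1)] by (auto dest: symD)
  then show "(insert (i, j) D)\<^sup>* = D\<^sup>*" "(insert (j, i) D)\<^sup>* = D\<^sup>*"
    "(insert (i, j) (insert (j, i) D))\<^sup>* = D\<^sup>*"
    by (simp_all add: rtrancl_insert_absorb)
qed

text \<open>A digraph that becomes symmetric by adding both arcs but is not symmetric itself becomes so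
  by exactly one of them, as an irreversible arc lies on a cycle through just one of them.\<close>

lemma sym_rtrancl_insert_count:
  assumes con: "(i, j) \<in> (D \<union> D\<inverse>)\<^sup>*"
  shows "of_bool (sym ((insert (i, j) D)\<^sup>*)) + of_bool (sym ((insert (j, i) D)\<^sup>*)) =
    (of_bool (sym (D\<^sup>*)) + of_bool (sym ((insert (i, j) (insert (j, i) D))\<^sup>*)) :: int)"
proof (cases "sym (D\<^sup>*)")
  case True
  then show ?thesis
    by (simp add: sym_rtrancl_insert_iff[OF True con])
next
  case False
  let ?B = "insert (i, j) (insert (j, i) D)"
  have forward: "(j, i) \<in> D\<^sup>*" if "sym ((insert (i, j) D)\<^sup>*)"
    using symD[OF that, of i j] rtrancl_insert_rev[of j i D] by auto
  have backward: "(i, j) \<in> D\<^sup>*" if "sym ((insert (j, i) D)\<^sup>*)"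
    using symD[OF that, of j i] rtrancl_insert_rev[of i j D] by auto
  have not_both: "\<not> (sym ((insert (i, j) D)\<^sup>*) \<and> sym ((insert (j, i) D)\<^sup>*))"
    using forward backward rtrancl_insert_absorb[of i j D] False by auto
  have "(j, i) \<in> D\<^sup>* \<or> (i, j) \<in> D\<^sup>*" if B: "sym (?B\<^sup>*)"
  proof -
    obtain a b where ab: "(a, b) \<in> D" "(b, a) \<notin> D\<^sup>*"
      using False unfolding sym_rtrancl_iff by blast
    moreover have "(b, a) \<in> ?B\<^sup>*"
      using symD[OF B, of a b] ab(1) by auto
    ultimately consider "(b, i) \<in> D\<^sup>*" "(j, a) \<in> D\<^sup>*" | "(b, j) \<in> D\<^sup>*" "(i, a) \<in> D\<^sup>*"
      unfolding rtrancl_insert_both by blast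
    then show ?thesis
      using ab(1) by cases (meson rtrancl_trans r_into_rtrancl)+
  qed
  moreover have "?B\<^sup>* = (insert (i, j) D)\<^sup>*" if "(j, i) \<in> D\<^sup>*"
    using that rtrancl_mono[of D "insert (i, j) D"] rtrancl_insert_absorb[of j i "insert (i, j) D"]
    by (auto simp: insert_commute)
  moreover have "?B\<^sup>* = (insert (j, i) D)\<^sup>*" if "(i, j) \<in> D\<^sup>*"
    using that rtrancl_mono[of D "insert (j, i) D"] rtrancl_insert_absorb[of i j "insert (j, i) D"]
    by auto
  ultimately have "sym (?B\<^sup>*) \<longleftrightarrow> sym ((insert (i, j) D)\<^sup>*) \<or> sym ((insert (j, i) D)\<^sup>*)"
    using forward backward by metis
  then show ?thesis
    using False not_both by auto
qed

lemma sym_rtrancl_insert_bridge: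
  assumes unconnected: "(i, j) \<notin> (D \<union> D\<inverse>)\<^sup>*"
  shows "\<not> sym ((insert (i, j) D)\<^sup>*)" "\<not> sym ((insert (j, i) D)\<^sup>*)"
    "sym ((insert (i, j) (insert (j, i) D))\<^sup>*) \<longleftrightarrow> sym (D\<^sup>*)"
proof -
  have sym_closure: "sym ((D \<union> D\<inverse>)\<^sup>*)"
    by (rule sym_rtrancl) (auto simp: sym_def)
  have sub: "D\<^sup>* \<subseteq> (D \<union> D\<inverse>)\<^sup>*"
    by (rule rtrancl_mono) auto
  have unreachable: "(i, j) \<notin> D\<^sup>*" "(j, i) \<notin> D\<^sup>*"
    using unconnected sub symD[OF sym_closure] by blast+
  show "\<not> sym ((insert (i, j) D)\<^sup>*)" "\<not> sym ((insert (j, i) D)\<^sup>*)"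
    using unreachable rtrancl_insert_rev[of j i D] rtrancl_insert_rev[of i j D]
    by (meson insertI1 r_into_rtrancl symD)+
  let ?B = "insert (i, j) (insert (j, i) D)"
  have "(b, a) \<in> D\<^sup>*" if "sym (?B\<^sup>*)" and ab: "(a, b) \<in> D" for a b
  proof -
    have "(b, a) \<in> ?B\<^sup>*"
      using symD[OF that(1), of a b] ab by auto
    moreover have "(a, b) \<in> (D \<union> D\<inverse>)\<^sup>*" "(b, a) \<in> (D \<union> D\<inverse>)\<^sup>*"
      using ab by auto
    ultimately show ?thesis
      unfolding rtrancl_insert_both using unconnected sub
      by (meson rtrancl_trans subsetD symD[OF sym_closure])
  qed
  moreover have "(b, a) \<in> ?B\<^sup>*" if "sym (D\<^sup>*)" "(a, b) \<in> ?B" for a b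
    using that unfolding sym_rtrancl_iff rtrancl_insert_both by auto
  ultimately show "sym (?B\<^sup>*) \<longleftrightarrow> sym (D\<^sup>*)"
    unfolding sym_rtrancl_iff by blast
qed

section \<open>Cells and their constraint digraphs\<close>

definition cell :: "gedge set \<Rightarrow> gedge set \<Rightarrow> gedge set \<Rightarrow> (nat \<Rightarrow> real) set" where
  "cell F P N = {x. (\<forall>e\<in>F. slack x e = 0) \<and> (\<forall>e\<in>P. 0 < slack x e) \<and> (\<forall>e\<in>N. slack x e < 0)}"

text \<open>Boundedness modulo the lineality space of the arrangement A.\<close>

definition slack_bounded :: "gedge set \<Rightarrow> (nat \<Rightarrow> real) set \<Rightarrow> bool" where
  "slack_bounded A X \<longleftrightarrow> (\<exists>M. \<forall>x\<in>X. \<forall>e\<in>A. \<bar>slack x e\<bar> \<le> M)"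

definition constraint_arcs :: "gedge set \<Rightarrow> gedge set \<Rightarrow> gedge set \<Rightarrow> (nat \<times> nat) set" where
  "constraint_arcs F P N = {(i, j). \<exists>g. (i, j, g) \<in> F \<union> N} \<union> {(j, i). \<exists>g. (i, j, g) \<in> F \<union> P}"

lemma cell_insert:
  "cell F (insert e P) N = {x \<in> cell F P N. 0 < slack x e}"
  "cell F P (insert e N) = {x \<in> cell F P N. slack x e < 0}"
  "cell (insert e F) P N = {x \<in> cell F P N. slack x e = 0}"
  by (auto simp: cell_def)

lemma constraint_arcs_insert:
  "constraint_arcs F (insert (i, j, g) P) N = insert (j, i) (constraint_arcs F P N)"
  "constraint_arcs F P (insert (i, j, g) N) = insert (i, j) (constraint_arcs F P N)"
  "constraint_arcs (insert (i, j, g) F) P N = insert (i, j) (insert (j, i) (constraint_arcs F P N))"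
  by (auto simp: constraint_arcs_def)

lemma conn_eq_constraint_arcs:
  "conn (F \<union> (P \<union> N)) = (constraint_arcs F P N \<union> (constraint_arcs F P N)\<inverse>)\<^sup>*"
proof -
  have "adj (F \<union> (P \<union> N)) = constraint_arcs F P N \<union> (constraint_arcs F P N)\<inverse>"
    by (auto simp: in_adj_iff constraint_arcs_def)
  then show ?thesis
    by (simp add: conn_def)
qed

lemma conn_subset_constraint_arcs: "conn F \<subseteq> (constraint_arcs F P N)\<^sup>*"
proof -
  have "adj F \<subseteq> constraint_arcs F P N"
    by (auto simp: in_adj_iff constraint_arcs_def)
  then show ?thesis
    unfolding conn_def by (rule rtrancl_mono)
qed

lemma finite_slack_bounded:
  assumes "finite A" "\<And>e. e \<in> A \<Longrightarrow> \<exists>M. \<forall>x\<in>X. \<bar>slack x e\<bar> \<le> M"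
  shows "slack_bounded A X"
proof -
  obtain M where M: "\<And>e x. e \<in> A \<Longrightarrow> x \<in> X \<Longrightarrow> \<bar>slack x e\<bar> \<le> M e"
    using assms(2) by metis
  have "\<bar>slack x e\<bar> \<le> (\<Sum>e\<in>A. \<bar>M e\<bar>)" if "x \<in> X" "e \<in> A" for x e
  proof -
    have "\<bar>slack x e\<bar> \<le> \<bar>M e\<bar>"
      using M[OF that(2,1)] by linarith
    also have "\<dots> \<le> (\<Sum>e\<in>A. \<bar>M e\<bar>)"
      by (rule member_le_sum) (use that assms(1) in auto)
    finally show ?thesis .
  qed
  then show ?thesis
    unfolding slack_bounded_def by blast
qed

lemma constraint_path_bound:
  assumes "(u, w) \<in> (constraint_arcs F P N)\<^sup>*"
  shows "\<exists>c. \<forall>x\<in>cell F P N. x w - x u \<le> c"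
  using assms
proof (induction rule: rtrancl_induct)
  case base
  show ?case by (rule exI[of _ 0]) simp
next
  case (step v w)
  then obtain c where bound_v: "\<forall>x\<in>cell F P N. x v - x u \<le> c" by blast
  have "\<exists>d. \<forall>x\<in>cell F P N. x w - x v \<le> d"
  proof -
    consider (upper) g where "(v, w, g) \<in> F \<union> N" | (lower) g where "(w, v, g) \<in> F \<union> P"
      using step.hyps(2) by (auto simp: constraint_arcs_def)
    then show ?thesis
    proof cases
      case upper
      then have "x w - x v \<le> of_int g" if "x \<in> cell F P N" for x
        using that by (fastforce simp: cell_def slack_edge)
      then show ?thesis by blast
    next
      case lower
      then have "x w - x v \<le> - of_int g" if "x \<in> cell F P N" for x
        using that by (fastforce simp: cell_def slack_edge)
      then show ?thesis by blast
    qed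
  qed
  then obtain d where step_bound: "\<forall>x\<in>cell F P N. x w - x v \<le> d" by blast
  have "x w - x u \<le> c + d" if "x \<in> cell F P N" for x
    using bspec[OF bound_v that] bspec[OF step_bound that] by linarith
  then show ?case by blast
qed

lemma shift_in_cell:
  assumes x: "x \<in> cell F P N" and t: "0 \<le> t"
    and closed: "\<And>v w. (v, w) \<in> constraint_arcs F P N \<Longrightarrow> w \<in> C \<Longrightarrow> v \<in> C"
  shows "shift C t x \<in> cell F P N"
proof -
  have indicator_le: "of_bool (w \<in> C) \<le> (of_bool (v \<in> C) :: real)"
    if "(v, w) \<in> constraint_arcs F P N" for v w
    using closed[OF that] by auto
  have "slack (shift C t x) e = 0" if "e \<in> F" for e
  proof -
    obtain i j g where e: "e = (i, j, g)" by (cases e)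
    then have "(i, j) \<in> constraint_arcs F P N" "(j, i) \<in> constraint_arcs F P N"
      using that by (auto simp: constraint_arcs_def)
    then have "of_bool (i \<in> C) = (of_bool (j \<in> C) :: real)"
      using indicator_le by (intro antisym) auto
    then show ?thesis using x that by (simp add: e cell_def slack_shift)
  qed
  moreover have "0 < slack (shift C t x) e" if "e \<in> P" for e
  proof -
    obtain i j g where e: "e = (i, j, g)" by (cases e)
    then have "(j, i) \<in> constraint_arcs F P N"
      using that by (auto simp: constraint_arcs_def)
    then have "0 \<le> t * (of_bool (j \<in> C) - of_bool (i \<in> C))"
      using indicator_le[of j i] t by simp
    moreover have "0 < slack x (i, j, g)"
      using x that e by (simp add: cell_def)
    ultimately show ?thesis by (simp add: e slack_shift)
  qed
  moreover have "slack (shift C t x) e < 0" if "e \<in> N" for e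
  proof -
    obtain i j g where e: "e = (i, j, g)" by (cases e)
    then have "(i, j) \<in> constraint_arcs F P N"
      using that by (auto simp: constraint_arcs_def)
    then have "t * (of_bool (j \<in> C) - of_bool (i \<in> C)) \<le> 0"
      using indicator_le[of i j] t by (simp add: mult_nonneg_nonpos)
    moreover have "slack x (i, j, g) < 0"
      using x that e by (simp add: cell_def)
    ultimately show ?thesis by (simp add: e slack_shift)
  qed
  ultimately show ?thesis
    unfolding cell_def by blast
qed

lemma slack_bounded_if_sym:
  assumes fin: "finite (P \<union> N)" and sym: "sym ((constraint_arcs F P N)\<^sup>*)"
  shows "slack_bounded (P \<union> N) (cell F P N)"
proof (rule finite_slack_bounded[OF fin])
  fix e assume e: "e \<in> P \<union> N"
  obtain i j g where e_eq: "e = (i, j, g)" by (cases e)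
  have "(i, j) \<in> (constraint_arcs F P N)\<^sup>* \<or> (j, i) \<in> (constraint_arcs F P N)\<^sup>*"
    using e e_eq by (auto simp: constraint_arcs_def)
  then have "(i, j) \<in> (constraint_arcs F P N)\<^sup>*" "(j, i) \<in> (constraint_arcs F P N)\<^sup>*"
    using symD[OF sym] by blast+
  then obtain c d where upper: "\<forall>x\<in>cell F P N. x j - x i \<le> c"
    and lower: "\<forall>x\<in>cell F P N. x i - x j \<le> d"
    using constraint_path_bound by meson
  have "\<bar>slack x e\<bar> \<le> \<bar>c\<bar> + \<bar>d\<bar> + \<bar>real_of_int g\<bar>" if "x \<in> cell F P N" for x
    using bspec[OF upper that] bspec[OF lower that] unfolding e_eq slack_edge by linarith
  then show "\<exists>M. \<forall>x\<in>cell F P N. \<bar>slack x e\<bar> \<le> M" by blast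
qed

text \<open>If an arc (u, w) cannot be reversed, all vertices not reachable from w can be moved up
  together indefinitely.\<close>

lemma sym_if_slack_bounded:
  assumes ne: "cell F P N \<noteq> {}" and bounded: "slack_bounded (P \<union> N) (cell F P N)"
  shows "sym ((constraint_arcs F P N)\<^sup>*)"
  unfolding sym_rtrancl_iff
proof (intro allI impI, rule ccontr)
  let ?D = "constraint_arcs F P N"
  fix u w assume uw: "(u, w) \<in> ?D" and irreversible: "(w, u) \<notin> ?D\<^sup>*"
  obtain x where x: "x \<in> cell F P N" using ne by blast
  obtain M where M: "\<And>y e. y \<in> cell F P N \<Longrightarrow> e \<in> P \<union> N \<Longrightarrow> \<bar>slack y e\<bar> \<le> M"
    using bounded unfolding slack_bounded_def by blast
  obtain i j g where e: "(i, j, g) \<in> P \<union> N" "{u, w} = {i, j}"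
    using uw irreversible unfolding constraint_arcs_def by fastforce
  define C where "C = {v. (w, v) \<notin> ?D\<^sup>*}"
  define t where "t = M + \<bar>slack x (i, j, g)\<bar> + 1"
  have "0 \<le> t"
    using M[OF x e(1)] unfolding t_def by linarith
  then have "shift C t x \<in> cell F P N"
    using x by (intro shift_in_cell) (auto simp: C_def intro: rtrancl_into_rtrancl)
  from M[OF this e(1)]
  have "\<bar>slack x (i, j, g) + t * (of_bool (j \<in> C) - of_bool (i \<in> C))\<bar> \<le> M"
    by (simp add: slack_shift)
  moreover have "u \<in> C" "w \<notin> C"
    using irreversible by (auto simp: C_def)
  then have "i \<in> C \<and> j \<notin> C \<or> i \<notin> C \<and> j \<in> C"
    using e(2) by (auto simp: doubleton_eq_iff)
  ultimately show False
    unfolding t_def by auto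
qed

definition bounded_cell :: "gedge set \<Rightarrow> gedge set \<Rightarrow> gedge set \<Rightarrow> bool" where
  "bounded_cell F P N \<longleftrightarrow> cell F P N \<noteq> {} \<and> slack_bounded (P \<union> N) (cell F P N)"

lemma bounded_cell_iff:
  "finite (P \<union> N) \<Longrightarrow> bounded_cell F P N \<longleftrightarrow> cell F P N \<noteq> {} \<and> sym ((constraint_arcs F P N)\<^sup>*)"
  unfolding bounded_cell_def using slack_bounded_if_sym sym_if_slack_bounded by blast

section \<open>Deletion and restriction of bounded cells\<close>

lemma slack_eq_if_conn:
  fixes x y :: "nat \<Rightarrow> 'a :: comm_ring_1"
  assumes "(i, j) \<in> conn F" "\<And>e. e \<in> F \<Longrightarrow> slack x e = slack y e"
  shows "slack x (i, j, g) = slack y (i, j, g)"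
proof -
  have "x j - y j = x i - y i"
    using assms(1) unfolding conn_def
  proof (induction rule: rtrancl_induct)
    case (step v w)
    obtain e where e: "e \<in> F" "ends e = {v, w}"
      using step.hyps(2) by (auto simp: adj_def)
    obtain i' j' g' where "e = (i', j', g')" by (cases e)
    then have "x w - y w = x v - y v"
      using assms(2)[OF e(1)] e(2)
      by (auto simp: slack_edge ends_def doubleton_eq_iff algebra_simps)
    then show ?case
      using step.IH by simp
  qed simp
  then show ?thesis
    by (simp add: slack_edge algebra_simps)
qed

lemma bounded_cell_connected:
  assumes H: "H = (i, j, g)" and fin: "finite (P \<union> N)" and con: "(i, j) \<in> conn F"
  shows "of_bool (bounded_cell F P (insert H N)) + of_bool (bounded_cell F (insert H P) N) =
    (of_bool (bounded_cell F P N) - of_bool (bounded_cell (insert H F) P N) :: int)"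
proof -
  let ?D = "constraint_arcs F P N"
  have "(i, j) \<in> ?D\<^sup>*" "(j, i) \<in> ?D\<^sup>*"
    using con conn_sym[OF con] conn_subset_constraint_arcs by blast+
  then have closure: "(insert (i, j) ?D)\<^sup>* = ?D\<^sup>*" "(insert (j, i) ?D)\<^sup>* = ?D\<^sup>*"
    "(insert (i, j) (insert (j, i) ?D))\<^sup>* = ?D\<^sup>*"
    by (metis rtrancl_insert_absorb)+
  have iff: "bounded_cell F P (insert H N) \<longleftrightarrow> cell F P (insert H N) \<noteq> {} \<and> sym (?D\<^sup>*)"
    "bounded_cell F (insert H P) N \<longleftrightarrow> cell F (insert H P) N \<noteq> {} \<and> sym (?D\<^sup>*)"
    "bounded_cell (insert H F) P N \<longleftrightarrow> cell (insert H F) P N \<noteq> {} \<and> sym (?D\<^sup>*)"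
    "bounded_cell F P N \<longleftrightarrow> cell F P N \<noteq> {} \<and> sym (?D\<^sup>*)"
    using fin
    by (simp_all add: bounded_cell_iff H constraint_arcs_insert closure)
  show ?thesis
  proof (cases "cell F P N = {}")
    case True
    then show ?thesis unfolding iff cell_insert by simp
  next
    case False
    then obtain x where x: "x \<in> cell F P N" by blast
    define s where "s = slack x H"
    have const: "slack y H = s" if "y \<in> cell F P N" for y
      unfolding H s_def by (rule slack_eq_if_conn[OF con]) (use x that in \<open>simp add: cell_def\<close>)
    have "cell F P (insert H N) \<noteq> {} \<longleftrightarrow> s < 0" "cell F (insert H P) N \<noteq> {} \<longleftrightarrow> 0 < s"
      "cell (insert H F) P N \<noteq> {} \<longleftrightarrow> s = 0"
      unfolding cell_insert using x const by auto
    then show ?thesis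
      unfolding iff using False by auto
  qed
qed

definition segment_point :: "real \<Rightarrow> (nat \<Rightarrow> real) \<Rightarrow> (nat \<Rightarrow> real) \<Rightarrow> nat \<Rightarrow> real" where
  "segment_point s x y v = (1 - s) * x v + s * y v"

lemma slack_segment_point: "slack (segment_point s x y) e = (1 - s) * slack x e + s * slack y e"
  by (simp add: slack_def segment_point_def algebra_simps)

lemma segment_point_in_cell:
  assumes x: "x \<in> cell F P N" and y: "y \<in> cell F P N" and s: "0 \<le> s" "s \<le> 1"
  shows "segment_point s x y \<in> cell F P N"
proof -
  have pos: "0 < (1 - s) * u + s * v" if "0 < u" "0 < v" for u v :: real
    using s that by (cases "s = 0") (auto intro: add_nonneg_pos)
  have neg: "(1 - s) * u + s * v < 0" if "u < 0" "v < 0" for u v :: real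
    using pos[of "- u" "- v"] that by simp
  show ?thesis
    using x y by (simp add: cell_def slack_segment_point pos neg)
qed

lemma cell_crosses_hyperplane:
  assumes x: "x \<in> cell F P N" "slack x H < 0" and y: "y \<in> cell F P N" "0 < slack y H"
  shows "cell (insert H F) P N \<noteq> {}"
proof -
  define s where "s = - slack x H / (slack y H - slack x H)"
  have "slack (segment_point s x y) H = 0"
    using x(2) y(2) by (simp add: s_def slack_segment_point field_simps)
  moreover have "segment_point s x y \<in> cell F P N"
    by (rule segment_point_in_cell[OF x(1) y(1)]) (use x(2) y(2) in \<open>auto simp: s_def field_simps\<close>)
  ultimately show ?thesis
    unfolding cell_insert by blast
qed

lemma cell_perturb:
  assumes x: "x \<in> cell F P N" and fin: "finite (P \<union> N)"
    and closed: "\<And>i j g. (i, j, g) \<in> F \<Longrightarrow> i \<in> C \<longleftrightarrow> j \<in> C"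
  obtains \<delta> where "0 < \<delta>" "\<And>t. \<bar>t\<bar> \<le> \<delta> \<Longrightarrow> shift C t x \<in> cell F P N"
proof -
  define \<mu> where "\<mu> = Min (insert 1 ((\<lambda>e. \<bar>slack x e\<bar>) ` (P \<union> N)))"
  have "0 < \<bar>slack x e\<bar>" if "e \<in> P \<union> N" for e
    using x that by (fastforce simp: cell_def)
  then have "0 < \<mu>"
    unfolding \<mu>_def using fin by (subst Min_gr_iff) auto
  moreover have "shift C t x \<in> cell F P N" if t: "\<bar>t\<bar> \<le> \<mu> / 2" for t
  proof -
    have near: "\<bar>slack (shift C t x) e - slack x e\<bar> < \<bar>slack x e\<bar>" if "e \<in> P \<union> N" for e
    proof -
      obtain i j g where e: "e = (i, j, g)" by (cases e)
      have "\<bar>slack (shift C t x) e - slack x e\<bar> \<le> \<bar>t\<bar>"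
        by (simp add: e slack_shift of_bool_def)
      moreover have "\<mu> \<le> \<bar>slack x e\<bar>"
        unfolding \<mu>_def using fin that by (intro Min_le) auto
      ultimately show ?thesis
        using t \<open>0 < \<mu>\<close> by linarith
    qed
    have "slack (shift C t x) e = slack x e" if "e \<in> F" for e
      using that closed by (cases e) (simp add: slack_shift)
    moreover have "0 < slack (shift C t x) e" if "e \<in> P" for e
    proof -
      have "0 < slack x e" using x that by (simp add: cell_def)
      then show ?thesis using near[of e] that by (simp add: abs_less_iff)
    qed
    moreover have "slack (shift C t x) e < 0" if "e \<in> N" for e
    proof -
      have "slack x e < 0" using x that by (simp add: cell_def)
      then show ?thesis using near[of e] that by (simp add: abs_less_iff)
    qed
    ultimately show ?thesis
      using x by (simp add: cell_def)
  qed
  ultimately show ?thesis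
    using that[of "\<mu> / 2"] by simp
qed

lemma bounded_cell_redundant:
  assumes H: "H = (i, j, g)" and fin: "finite (P \<union> N)" and con: "(i, j) \<in> conn (F \<union> (P \<union> N))"
    and side: "(P', N') = (insert H P, N) \<or> (P', N') = (P, insert H N)"
    and same: "cell F P' N' = cell F P N"
  shows "bounded_cell F P' N' \<longleftrightarrow> bounded_cell F P N"
proof
  assume bounded: "bounded_cell F P N"
  let ?D = "constraint_arcs F P N"
  have sym: "sym (?D\<^sup>*)"
    using bounded fin by (simp add: bounded_cell_iff)
  then have "(constraint_arcs F P' N')\<^sup>* = ?D\<^sup>*"
    using side sym_rtrancl_insert_iff[OF sym] con
    by (auto simp: H constraint_arcs_insert conn_eq_constraint_arcs)
  moreover have "finite (P' \<union> N')"
    using side fin by auto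
  ultimately show "bounded_cell F P' N'"
    using bounded same sym fin by (simp add: bounded_cell_iff)
next
  assume "bounded_cell F P' N'"
  moreover have "P \<union> N \<subseteq> P' \<union> N'"
    using side by auto
  ultimately show "bounded_cell F P N"
    unfolding bounded_cell_def slack_bounded_def same by blast
qed

lemma bounded_cell_dependent:
  assumes H: "H = (i, j, g)" and fin: "finite (P \<union> N)"
    and unconnected: "(i, j) \<notin> conn F" and con: "(i, j) \<in> conn (F \<union> (P \<union> N))"
  shows "of_bool (bounded_cell F P (insert H N)) + of_bool (bounded_cell F (insert H P) N) =
    (of_bool (bounded_cell F P N) + of_bool (bounded_cell (insert H F) P N) :: int)"
proof (cases "cell (insert H F) P N = {}")
  case True
  then have nonzero: "slack x H \<noteq> 0" if "x \<in> cell F P N" for x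
    using that unfolding cell_insert by blast
  consider (above) "cell F P (insert H N) = {}" | (below) "cell F (insert H P) N = {}"
    using cell_crosses_hyperplane[of _ F P N H] True unfolding cell_insert by blast
  then show ?thesis
  proof cases
    case above
    then have "cell F (insert H P) N = cell F P N"
      using nonzero unfolding cell_insert by (auto simp: neq_iff)
    then show ?thesis
      using above True bounded_cell_redundant[OF H fin con, of "insert H P" N]
      by (simp add: bounded_cell_def)
  next
    case below
    then have "cell F P (insert H N) = cell F P N"
      using nonzero unfolding cell_insert by (auto simp: neq_iff)
    then show ?thesis
      using below True bounded_cell_redundant[OF H fin con, of P "insert H N"]
      by (simp add: bounded_cell_def)
  qed
next
  case False
  then obtain x where x: "x \<in> cell F P N" "slack x H = 0"
    unfolding cell_insert by blast
  let ?C = "conn F `` {j}"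
  obtain \<delta> where \<delta>: "0 < \<delta>" "\<And>t. \<bar>t\<bar> \<le> \<delta> \<Longrightarrow> shift ?C t x \<in> cell F P N"
    by (rule cell_perturb[OF x(1) fin, of "conn F `` {j}"]) (erule conn_class_edge, rule that)
  have "i \<notin> ?C"
    using unconnected conn_sym by blast
  then have "slack (shift ?C t x) H = t" for t
    using x(2) by (simp add: H slack_shift)
  then have "cell F (insert H P) N \<noteq> {}" "cell F P (insert H N) \<noteq> {}"
    unfolding cell_insert using \<delta>(1) \<delta>(2)[of \<delta>] \<delta>(2)[of "- \<delta>"] by force+
  moreover have "cell F P N \<noteq> {}" using x by blast
  ultimately show ?thesis
    using fin False sym_rtrancl_insert_count[of i j "constraint_arcs F P N"] con
    by (simp add: H bounded_cell_iff constraint_arcs_insert conn_eq_constraint_arcs)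
qed

lemma bounded_cell_independent:
  assumes H: "H = (i, j, g)" and fin: "finite (P \<union> N)"
    and unconnected: "(i, j) \<notin> conn (F \<union> (P \<union> N))"
  shows "\<not> bounded_cell F P (insert H N)" "\<not> bounded_cell F (insert H P) N"
    "bounded_cell (insert H F) P N \<longleftrightarrow> bounded_cell F P N"
proof -
  note bridge = sym_rtrancl_insert_bridge[OF unconnected[unfolded conn_eq_constraint_arcs]]
  show "\<not> bounded_cell F P (insert H N)" "\<not> bounded_cell F (insert H P) N"
    using fin bridge by (simp_all add: H bounded_cell_iff constraint_arcs_insert)
  let ?C = "conn (F \<union> (P \<union> N)) `` {j}"
  have "i \<notin> ?C"
    using unconnected conn_sym by blast
  then have zero: "slack (shift ?C (- slack x H) x) H = 0" for x :: "nat \<Rightarrow> real"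
    by (simp add: H slack_shift)
  have "slack (shift ?C t x) e = slack x e" if "e \<in> F \<union> (P \<union> N)" for t e and x :: "nat \<Rightarrow> real"
    using that conn_class_edge by (cases e) (simp add: slack_shift del: Image_singleton_iff)
  then have "shift ?C t x \<in> cell F P N" if "x \<in> cell F P N" for t x
    using that by (simp add: cell_def)
  then have "cell (insert H F) P N = {} \<longleftrightarrow> cell F P N = {}"
    unfolding cell_insert using zero by blast
  then show "bounded_cell (insert H F) P N \<longleftrightarrow> bounded_cell F P N"
    using fin bridge(3) by (simp add: H bounded_cell_iff constraint_arcs_insert)
qed

definition count_bounded_cells :: "gedge set \<Rightarrow> gedge set \<Rightarrow> int" where
  "count_bounded_cells F A = (\<Sum>P\<in>Pow A. of_bool (bounded_cell F P (A - P)))"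

lemma count_bounded_cells_insert:
  assumes "finite A" "H \<notin> A"
  shows "count_bounded_cells F (insert H A) =
    (\<Sum>P\<in>Pow A. of_bool (bounded_cell F P (insert H (A - P))) +
       of_bool (bounded_cell F (insert H P) (A - P)))"
  unfolding count_bounded_cells_def sum_Pow_insert[OF assms]
proof (rule sum.cong[OF refl])
  fix P assume "P \<in> Pow A"
  then have "insert H A - P = insert H (A - P)" "insert H A - insert H P = A - P"
    using assms(2) by auto
  then show "of_bool (bounded_cell F P (insert H A - P)) +
        of_bool (bounded_cell F (insert H P) (insert H A - insert H P)) =
      (of_bool (bounded_cell F P (insert H (A - P))) +
        of_bool (bounded_cell F (insert H P) (A - P)) :: int)"
    by simp
qed

lemma count_bounded_cells_deletion_restriction:
  assumes H: "H = (i, j, g)" and A: "finite A" "H \<notin> A"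
  shows "(i, j) \<in> conn F \<Longrightarrow> count_bounded_cells F (insert H A) =
      count_bounded_cells F A - count_bounded_cells (insert H F) A" (is "_ \<Longrightarrow> ?connected")
    and "(i, j) \<notin> conn F \<Longrightarrow> (i, j) \<in> conn (F \<union> A) \<Longrightarrow> count_bounded_cells F (insert H A) =
      count_bounded_cells F A + count_bounded_cells (insert H F) A" (is "_ \<Longrightarrow> _ \<Longrightarrow> ?dependent")
    and "(i, j) \<notin> conn (F \<union> A) \<Longrightarrow> count_bounded_cells F (insert H A) = 0 \<and>
      count_bounded_cells F A = count_bounded_cells (insert H F) A" (is "_ \<Longrightarrow> ?independent")
proof -
  have split: "finite (P \<union> (A - P))" "P \<union> (A - P) = A" if "P \<in> Pow A" for P
    using that A(1) finite_subset by auto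
  show ?connected if "(i, j) \<in> conn F"
    unfolding count_bounded_cells_insert[OF A]
    unfolding count_bounded_cells_def sum_subtractf[symmetric]
    by (intro sum.cong refl bounded_cell_connected[OF H]) (simp_all only: split A(1) that)
  show ?dependent if "(i, j) \<notin> conn F" "(i, j) \<in> conn (F \<union> A)"
    unfolding count_bounded_cells_insert[OF A]
    unfolding count_bounded_cells_def sum.distrib[symmetric]
    by (intro sum.cong refl bounded_cell_dependent[OF H]) (simp_all only: split A(1) that simp_thms)
  show ?independent if unconnected: "(i, j) \<notin> conn (F \<union> A)"
  proof -
    have "\<not> bounded_cell F P (insert H (A - P))" "\<not> bounded_cell F (insert H P) (A - P)"
      "bounded_cell (insert H F) P (A - P) \<longleftrightarrow> bounded_cell F P (A - P)" if "P \<in> Pow A" for P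
      using bounded_cell_independent[OF H split(1)[OF that]] unconnected
      by (simp_all only: split(2)[OF that])
    then show ?thesis
      unfolding count_bounded_cells_insert[OF A] unfolding count_bounded_cells_def by simp
  qed
qed

definition central :: "gedge set \<Rightarrow> bool" where
  "central F \<longleftrightarrow> cell F {} {} \<noteq> {}"

definition central_sum :: "gedge set \<Rightarrow> gedge set \<Rightarrow> int" where
  "central_sum F A = (\<Sum>G\<in>Pow A. of_bool (central (F \<union> G)) * (-1) ^ card G)"

lemma central_sum_insert:
  assumes "finite A" "H \<notin> A"
  shows "central_sum F (insert H A) = central_sum F A - central_sum (insert H F) A"
proof -
  have "(-1 :: int) ^ card (insert H G) = - ((-1) ^ card G)" if "G \<in> Pow A" for G
  proof -
    have "finite G" "H \<notin> G"
      using that assms finite_subset by auto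
    then show ?thesis by simp
  qed
  then show ?thesis
    unfolding central_sum_def sum_Pow_insert[OF assms] sum_subtractf[symmetric]
    by (intro sum.cong) auto
qed

text \<open>Zaslavsky's theorem for relatively bounded regions, by deletion and restriction.\<close>

theorem central_sum_eq_count_bounded_cells:
  assumes "A \<subseteq> gain_edges n a b"
  shows "central_sum F A =
    (-1) ^ (card (graph_components n F) + card (graph_components n (F \<union> A))) *
      count_bounded_cells F A"
  using finite_if_gain_edges[OF assms] assms
proof (induction A arbitrary: F rule: finite_induct)
  case empty
  have "central F \<longleftrightarrow> bounded_cell F {} {}"
    by (simp add: central_def bounded_cell_def slack_bounded_def)
  then show ?case
    by (simp add: central_sum_def count_bounded_cells_def flip: mult_2)
next
  case (insert H A)
  obtain i j g where H: "H = (i, j, g)" by (cases H)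
  have ij: "i \<in> {1..n}" "j \<in> {1..n}"
    using insert.prems H by (auto simp: gain_edges_iff)
  let ?c = "\<lambda>X. card (graph_components n X)"
  note count = count_bounded_cells_deletion_restriction[OF H insert.hyps]
  have IH: "central_sum F (insert H A) = (-1) ^ (?c F + ?c (F \<union> A)) * count_bounded_cells F A -
      (-1) ^ (?c (insert H F) + ?c (insert H (F \<union> A))) * count_bounded_cells (insert H F) A"
    unfolding central_sum_insert[OF insert.hyps] using insert.IH insert.prems by simp
  consider (connected) "(i, j) \<in> conn F" "(i, j) \<in> conn (F \<union> A)"
    | (dependent) "(i, j) \<notin> conn F" "(i, j) \<in> conn (F \<union> A)"
    | (independent) "(i, j) \<notin> conn F" "(i, j) \<notin> conn (F \<union> A)"
    using conn_mono[of F "F \<union> A"] by blast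
  then show ?case
  proof cases
    case connected
    then have "?c (insert H F) = ?c F" "?c (insert H (F \<union> A)) = ?c (F \<union> A)"
      unfolding H by (simp_all only: graph_components_insert_connected)
    then show ?thesis
      unfolding IH Un_insert_right count(1)[OF connected(1)] by (simp add: algebra_simps)
  next
    case dependent
    then have "?c F = Suc (?c (insert H F))" "?c (insert H (F \<union> A)) = ?c (F \<union> A)"
      unfolding H using card_components_insert[OF ij]
      by (simp_all only: graph_components_insert_connected)
    then show ?thesis
      unfolding IH Un_insert_right count(2)[OF dependent] by (simp add: algebra_simps)
  next
    case independent
    then have "?c F = Suc (?c (insert H F))" "?c (F \<union> A) = Suc (?c (insert H (F \<union> A)))"
      unfolding H using card_components_insert[OF ij] by simp_all
    then show ?thesis
      unfolding IH Un_insert_right using count(3)[OF independent(2)] by simp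
  qed
qed

section \<open>Central edge sets and NBC sets\<close>

lemma sum_zero_by_closure:
  fixes w :: "'a \<Rightarrow> 'c :: ab_group_add" and cl :: "'a \<Rightarrow> 'b set"
  assumes fin: "finite \<G>" "\<And>G. G \<in> \<G> \<Longrightarrow> finite (cl G)"
    and zero: "\<And>X. X \<in> cl ` \<G> \<Longrightarrow> (\<Sum>G | G \<in> \<G> \<and> cl G \<subseteq> X. w G) = 0"
  shows "(\<Sum>G\<in>\<G>. w G) = 0"
proof -
  define d where "d X = (\<Sum>G | G \<in> \<G> \<and> cl G = X. w G)" for X
  have "d X = 0" if X: "X \<in> cl ` \<G>" for X
  proof -
    have "finite X" using X fin(2) by blast
    then show ?thesis
      using X
    proof (induction X rule: finite_psubset_induct)
      case (psubset X)
      let ?S = "{G. G \<in> \<G> \<and> cl G \<subseteq> X}"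
      have "0 = (\<Sum>G\<in>?S. w G)" using zero[OF psubset.prems] by simp
      also have "\<dots> = (\<Sum>Y\<in>cl ` ?S. \<Sum>G | G \<in> ?S \<and> cl G = Y. w G)"
        by (rule sum.image_gen) (use fin in auto)
      also have "\<dots> = (\<Sum>Y\<in>cl ` ?S. d Y)"
        unfolding d_def by (intro sum.cong refl arg_cong[of _ _ "sum w"]) auto
      also have "\<dots> = d X + (\<Sum>Y\<in>cl ` ?S - {X}. d Y)"
        using psubset.prems fin by (intro sum.remove) auto
      also have "(\<Sum>Y\<in>cl ` ?S - {X}. d Y) = 0"
        by (rule sum.neutral) (use psubset.IH in auto)
      finally show ?case by simp
    qed
  qed
  moreover have "(\<Sum>G\<in>\<G>. w G) = (\<Sum>Y\<in>cl ` \<G>. d Y)"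
    unfolding d_def by (rule sum.image_gen[OF fin(1)])
  ultimately show ?thesis by simp
qed

context gain_graph
begin

lemma forest_central:
  assumes "F \<subseteq> E" "is_forest F"
  shows "central F"
  using finite_if_gain_edges[OF assms(1)] assms
proof (induction F)
  case empty
  then show ?case by (simp add: central_def cell_def)
next
  case (insert e F)
  obtain i j g where e: "e = (i, j, g)" by (cases e)
  have F: "is_forest F" "F \<subseteq> E" and eE: "(i, j, g) \<in> E"
    using insert.prems e by (auto intro: is_forest_mono)
  have "(i, j) \<notin> conn F"
    using is_forest_insert[of F i j g] insert e F edge_verts[OF eE] by auto
  then have i_separated: "i \<notin> conn F `` {j}"
    using conn_sym by blast
  obtain x where x: "x \<in> cell F {} {}"
    using insert.IH F by (auto simp: central_def)
  let ?y = "shift (conn F `` {j}) (- slack x e) x"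
  have "slack ?y f = 0" if "f \<in> F" for f
    using x that conn_class_edge
    by (cases f) (simp add: cell_def slack_shift del: Image_singleton_iff)
  moreover have "slack ?y e = 0"
    unfolding e using i_separated by (simp add: slack_shift)
  ultimately have "?y \<in> cell (insert e F) {} {}"
    by (simp add: cell_def)
  then show ?case
    unfolding central_def by blast
qed

definition edge_closure :: "gedge set \<Rightarrow> gedge set" where
  "edge_closure G = flat_of (0 :: real) (cell G {} {})"

lemma edge_closure_subset: "edge_closure G \<subseteq> E"
  unfolding edge_closure_def by (rule flat_of_subset)

lemma central_closure_subset_iff:
  assumes "G\<^sub>0 \<subseteq> E" "central G\<^sub>0"
  shows "G \<subseteq> E \<and> central G \<and> edge_closure G \<subseteq> edge_closure G\<^sub>0 \<longleftrightarrow> G \<subseteq> edge_closure G\<^sub>0"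
proof
  assume G: "G \<subseteq> E \<and> central G \<and> edge_closure G \<subseteq> edge_closure G\<^sub>0"
  then have "G \<subseteq> edge_closure G"
    by (auto simp: edge_closure_def flat_of_def cell_def)
  then show "G \<subseteq> edge_closure G\<^sub>0" using G by blast
next
  assume G: "G \<subseteq> edge_closure G\<^sub>0"
  then have "cell G\<^sub>0 {} {} \<subseteq> cell G {} {}"
    by (auto simp: edge_closure_def flat_of_def cell_def)
  then show "G \<subseteq> E \<and> central G \<and> edge_closure G \<subseteq> edge_closure G\<^sub>0"
    using assms(2) G edge_closure_subset by (auto simp: central_def edge_closure_def flat_of_def)
qed

end

text \<open>Over each flat both alternating sums are the indicator of the empty flat.\<close>

theorem (in ordered_gain_graph) central_sum_eq_nbc_sum:
  "central_sum {} E = (\<Sum>F | nbc_set r n a b F. (-1) ^ card F)"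
proof -
  let ?\<G> = "{G. G \<subseteq> E \<and> central G}" and ?\<N> = "{F. nbc_set r n a b F}"
  have fin: "finite ?\<G>"
    by (rule finite_subset[of _ "Pow E"]) auto
  have fin_cl: "finite (edge_closure G)" for G
    by (rule finite_if_gain_edges[OF edge_closure_subset])
  have sub: "?\<N> \<subseteq> ?\<G>"
    using forest_central by (auto simp: nbc_set_def)
  have "(\<Sum>G\<in>?\<G> - ?\<N>. (-1 :: int) ^ card G) = 0"
  proof (rule sum_zero_by_closure[of _ edge_closure])
    fix X assume "X \<in> edge_closure ` (?\<G> - ?\<N>)"
    then obtain G\<^sub>0 where G\<^sub>0: "G\<^sub>0 \<subseteq> E" "central G\<^sub>0" and X: "X = edge_closure G\<^sub>0" by blast
    let ?\<N>X = "{F. nbc_set r n a b F \<and> F \<subseteq> X}"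
    have "{G. G \<in> ?\<G> - ?\<N> \<and> edge_closure G \<subseteq> X} = Pow X - ?\<N>X"
      unfolding X using central_closure_subset_iff[OF G\<^sub>0] by blast
    then have "(\<Sum>G | G \<in> ?\<G> - ?\<N> \<and> edge_closure G \<subseteq> X. (-1 :: int) ^ card G) =
        (\<Sum>G\<in>Pow X. (-1) ^ card G) - (\<Sum>G\<in>?\<N>X. (-1) ^ card G)"
      using fin_cl[of G\<^sub>0] X by (simp only:) (rule sum_diff, auto)
    also have "(\<Sum>G\<in>Pow X. (-1 :: int) ^ card G) = of_bool (X = {})"
      using sum_Pow_power_card[of X "-1 :: int"] fin_cl[of G\<^sub>0] by (simp add: X power_0_left)
    also have "(\<Sum>G\<in>?\<N>X. (-1 :: int) ^ card G) = of_bool (X = {})"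
      unfolding X edge_closure_def
      by (rule nbc_alternating_sum_flat[OF _ large_modulus_real_0])
        (use G\<^sub>0(2) in \<open>simp add: central_def\<close>)
    finally show "(\<Sum>G | G \<in> ?\<G> - ?\<N> \<and> edge_closure G \<subseteq> X. (-1 :: int) ^ card G) = 0" by simp
  qed (use fin fin_cl in auto)
  then have "(\<Sum>G\<in>?\<G>. (-1 :: int) ^ card G) = (\<Sum>F\<in>?\<N>. (-1) ^ card F)"
    using sum.subset_diff[OF sub fin, of "\<lambda>G. (-1 :: int) ^ card G"] by simp
  moreover have "central_sum {} E = (\<Sum>G\<in>?\<G>. (-1) ^ card G)"
    unfolding central_sum_def by (rule sum.mono_neutral_cong_right) auto
  ultimately show ?thesis by simp
qed

theorem (in ordered_gain_graph) count_bounded_cells_eq_card_inactive_bases: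
  "count_bounded_cells {} E = int (card {B. nbc_basis r n a b B \<and> activity r n a b B = 0})"
proof -
  have "(-1 :: int) ^ (n + 1) = (-1) ^ (n - 1)"
    using n_pos by (cases n) simp_all
  then have "central_sum {} E = (-1) ^ (n - 1) * count_bounded_cells {} E"
    using central_sum_eq_count_bounded_cells[of E n a b "{}"]
    by (simp add: card_components_empty card_components_edges)
  then have "(-1) ^ (n - 1) * central_sum {} E = ((-1) * (-1)) ^ (n - 1) * count_bounded_cells {} E"
    by (simp only: power_mult_distrib mult.assoc)
  then have "count_bounded_cells {} E = (-1) ^ (n - 1) * central_sum {} E"
    by simp
  also have "\<dots> = (\<Sum>B | nbc_basis r n a b B. 0 ^ activity r n a b B)"
    using nbc_sets_alternating_sum_activity[of "1 :: int"] by (simp add: central_sum_eq_nbc_sum)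
  also have "\<dots> = (\<Sum>B | nbc_basis r n a b B. of_bool (activity r n a b B = 0))"
    by (simp add: power_0_left of_bool_def)
  also have "\<dots> = int (card {B. nbc_basis r n a b B \<and> activity r n a b B = 0})"
    by (simp add: Collect_conj_eq)
  finally show ?thesis .
qed

section \<open>Bounded regions\<close>

lemma slack_sign_const_on_connected:
  fixes T :: "(nat \<Rightarrow> real) set"
  assumes "connected T" "\<And>z. z \<in> T \<Longrightarrow> slack z e \<noteq> 0" "x \<in> T" "y \<in> T" "0 < slack x e"
  shows "0 < slack y e"
proof (rule ccontr)
  assume "\<not> 0 < slack y e"
  have "continuous_on T (\<lambda>z. slack z e)"
    unfolding slack_def
    by (intro continuous_intros continuous_on_subset[OF continuous_on_product_coordinates]) auto
  then have "connected ((\<lambda>z. slack z e) ` T)"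
    using assms(1) by (rule connected_continuous_image)
  then have "{slack y e..slack x e} \<subseteq> (\<lambda>z. slack z e) ` T"
    using assms(3,4) by (intro connected_contains_Icc) auto
  then have "0 \<in> (\<lambda>z. slack z e) ` T"
    using assms(5) \<open>\<not> 0 < slack y e\<close> by auto
  then show False
    using assms(2) by force
qed

lemma abs_le_if_sum_zero:
  fixes x :: "'a \<Rightarrow> real"
  assumes "finite V" "i \<in> V" "(\<Sum>v\<in>V. x v) = 0" "\<And>v. v \<in> V \<Longrightarrow> \<bar>x i - x v\<bar> \<le> c"
  shows "\<bar>x i\<bar> \<le> c"
proof -
  have "real (card V) * x i = (\<Sum>v\<in>V. x i - x v)"
    using assms(3) by (simp add: sum_subtractf)
  then have "real (card V) * \<bar>x i\<bar> = \<bar>\<Sum>v\<in>V. x i - x v\<bar>"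
    by (metis abs_mult abs_of_nat)
  also have "\<dots> \<le> (\<Sum>v\<in>V. \<bar>x i - x v\<bar>)"
    by (rule sum_abs)
  also have "\<dots> \<le> real (card V) * c"
    using sum_mono[of V "\<lambda>v. \<bar>x i - x v\<bar>" "\<lambda>_. c"] assms(4) by simp
  finally show ?thesis
    by (rule mult_left_le_imp_le) (use assms(1,2) in \<open>auto simp: card_gt_0_iff\<close>)
qed

context gain_graph
begin

definition positive_edges :: "(nat \<Rightarrow> real) \<Rightarrow> gedge set" where
  "positive_edges x = {e \<in> E. 0 < slack x e}"

definition region_cell :: "gedge set \<Rightarrow> (nat \<Rightarrow> real) set" where
  "region_cell P = sum_zero_space n \<inter> cell {} P (E - P)"

lemma arr_complement_eq: "arr_complement n a b = {x \<in> sum_zero_space n. \<forall>e\<in>E. slack x e \<noteq> 0}"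
  by (auto simp: arr_complement_def hyperplane_of_def slack_def)

lemma in_region_cell_iff:
  assumes "P \<subseteq> E"
  shows "x \<in> region_cell P \<longleftrightarrow> x \<in> arr_complement n a b \<and> positive_edges x = P"
proof -
  have "x \<in> cell {} P (E - P) \<longleftrightarrow> (\<forall>e\<in>E. if e \<in> P then 0 < slack x e else slack x e < 0)"
    using assms by (auto simp: cell_def)
  also have "\<dots> \<longleftrightarrow> (\<forall>e\<in>E. slack x e \<noteq> 0 \<and> (0 < slack x e \<longleftrightarrow> e \<in> P))"
    by (intro ball_cong refl) auto
  finally show ?thesis
    using assms by (auto simp: region_cell_def arr_complement_eq positive_edges_def)
qed

lemma segment_point_in_region_cell:
  assumes "x \<in> region_cell P" "y \<in> region_cell P" "s \<in> {0..1}"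
  shows "segment_point s x y \<in> region_cell P"
proof -
  have "(\<Sum>v\<in>{1..n}. segment_point s x y v) = (1 - s) * (\<Sum>v\<in>{1..n}. x v) + s * (\<Sum>v\<in>{1..n}. y v)"
    by (simp add: segment_point_def sum.distrib sum_distrib_left)
  then show ?thesis
    using assms segment_point_in_cell[of x "{}" P "E - P" y s]
    by (auto simp: region_cell_def sum_zero_space_def segment_point_def)
qed

lemma region_eq_region_cell:
  assumes x: "x \<in> arr_complement n a b"
  shows "connected_component_set (arr_complement n a b) x = region_cell (positive_edges x)"
proof (intro equalityI subsetI)
  have posE: "positive_edges z \<subseteq> E" for z
    by (auto simp: positive_edges_def)
  fix y
  {
    assume "y \<in> connected_component_set (arr_complement n a b) x"
    then obtain T where T: "connected T" "T \<subseteq> arr_complement n a b" "x \<in> T" "y \<in> T"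
      unfolding connected_component_def by auto
    have nonzero: "slack z e \<noteq> 0" if "e \<in> E" "z \<in> T" for e z
      using T(2) that by (auto simp: arr_complement_eq)
    have "positive_edges y = positive_edges x"
      unfolding positive_edges_def
      using slack_sign_const_on_connected[OF T(1) nonzero] T(3,4) by blast
    then show "y \<in> region_cell (positive_edges x)"
      unfolding in_region_cell_iff[OF posE] using T(2,4) by blast
  next
    assume y: "y \<in> region_cell (positive_edges x)"
    have x_cell: "x \<in> region_cell (positive_edges x)"
      using in_region_cell_iff[OF posE] x by simp
    let ?S = "(\<lambda>s. segment_point s x y) ` {0..1}"
    have "continuous_on {0..1} (\<lambda>s. segment_point s x y)"
      unfolding segment_point_def
      by (intro continuous_on_coordinatewise_then_product continuous_intros)
    then have "connected ?S"
      by (rule connected_continuous_image) simp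
    moreover have "?S \<subseteq> arr_complement n a b"
      using segment_point_in_region_cell[OF x_cell y] in_region_cell_iff[OF posE] by blast
    moreover have "segment_point 0 x y = x" "segment_point 1 x y = y"
      by (auto simp: segment_point_def)
    then have "x \<in> ?S" "y \<in> ?S"
      by (metis atLeastAtMost_iff imageI order_refl zero_le_one)+
    ultimately show "y \<in> connected_component_set (arr_complement n a b) x"
      unfolding connected_component_def by blast
  }
qed

lemma bounded_region_iff_slack_bounded:
  assumes R: "R \<subseteq> sum_zero_space n"
  shows "bounded_region n R \<longleftrightarrow> slack_bounded E R"
proof
  assume "bounded_region n R"
  then obtain M where M: "\<And>x i. x \<in> R \<Longrightarrow> i \<in> {1..n} \<Longrightarrow> \<bar>x i\<bar> \<le> M"
    unfolding bounded_region_def by blast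
  have "\<exists>c. \<forall>x\<in>R. \<bar>slack x e\<bar> \<le> c" if e: "e \<in> E" for e
  proof -
    obtain i j g where e_eq: "e = (i, j, g)" by (cases e)
    have "\<bar>slack x e\<bar> \<le> 2 * M + \<bar>real_of_int g\<bar>" if "x \<in> R" for x
      using M[OF that, of i] M[OF that, of j] edge_verts[of i j g] e unfolding e_eq slack_edge
      by auto
    then show ?thesis by blast
  qed
  then show "slack_bounded E R"
    by (rule finite_slack_bounded[OF finite_gain_edges])
next
  assume "slack_bounded E R"
  then obtain M where M: "\<And>x e. x \<in> R \<Longrightarrow> e \<in> E \<Longrightarrow> \<bar>slack x e\<bar> \<le> M"
    unfolding slack_bounded_def by blast
  have "\<bar>x i\<bar> \<le> \<bar>M\<bar> + \<bar>real_of_int a\<bar>" if x: "x \<in> R" and i: "i \<in> {1..n}" for x i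
  proof (rule abs_le_if_sum_zero[of "{1..n}"])
    have less: "\<bar>x v - x u\<bar> \<le> \<bar>M\<bar> + \<bar>real_of_int a\<bar>" if "u \<in> {1..n}" "v \<in> {1..n}" "u < v" for u v
    proof -
      have "(u, v, a) \<in> E" using that gains_nonempty by (auto simp: gain_edges_iff)
      from M[OF x this] show ?thesis by (simp add: slack_edge)
    qed
    show "\<bar>x i - x v\<bar> \<le> \<bar>M\<bar> + \<bar>real_of_int a\<bar>" if v: "v \<in> {1..n}" for v
      using less[OF v i] less[OF i v]
      by (cases v i rule: linorder_cases) (auto simp: abs_minus_commute)
    show "(\<Sum>v\<in>{1..n}. x v) = 0"
      using R x by (auto simp: sum_zero_space_def)
  qed (use i in auto)
  then show "bounded_region n R" unfolding bounded_region_def by blast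
qed

text \<open>Slacks are invariant under adding constants, so cells can be normalized to sum zero.\<close>

lemma sum_zero_representative:
  obtains y where "y \<in> sum_zero_space n" "\<And>e. e \<in> E \<Longrightarrow> slack y e = slack x e"
proof
  let ?y = "\<lambda>v. if v \<in> {1..n} then x v - (\<Sum>v\<in>{1..n}. x v) / real n else 0"
  have "(\<Sum>v\<in>{1..n}. ?y v) = (\<Sum>v\<in>{1..n}. x v - (\<Sum>v\<in>{1..n}. x v) / real n)"
    by (rule sum.cong) auto
  also have "\<dots> = 0"
    using n_pos by (simp add: sum_subtractf)
  finally show "?y \<in> sum_zero_space n"
    by (simp add: sum_zero_space_def)
  show "slack ?y e = slack x e" if "e \<in> E" for e
    using that edge_verts by (cases e) (simp add: slack_edge)
qed

lemma bounded_cell_iff_bounded_region: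
  assumes P: "P \<subseteq> E"
  shows "bounded_cell {} P (E - P) \<longleftrightarrow> region_cell P \<noteq> {} \<and> bounded_region n (region_cell P)"
proof -
  let ?C = "cell {} P (E - P)"
  have representative: "\<exists>y\<in>region_cell P. \<forall>e\<in>E. slack y e = slack x e" if "x \<in> ?C" for x
  proof -
    obtain y where "y \<in> sum_zero_space n" "\<And>e. e \<in> E \<Longrightarrow> slack y e = slack x e"
      by (rule sum_zero_representative[of x]) (rule that)
    then show ?thesis
      using that P by (intro bexI[of _ y]) (auto simp: region_cell_def cell_def)
  qed
  have sub: "region_cell P \<subseteq> ?C"
    by (auto simp: region_cell_def)
  then have "?C \<noteq> {} \<longleftrightarrow> region_cell P \<noteq> {}"
    using representative by blast
  moreover have "slack_bounded E ?C \<longleftrightarrow> slack_bounded E (region_cell P)"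
    unfolding slack_bounded_def using sub representative by (metis subsetD)
  moreover have "P \<union> (E - P) = E"
    using P by blast
  ultimately show ?thesis
    by (simp add: bounded_cell_def bounded_region_iff_slack_bounded region_cell_def)
qed

lemma bounded_regions_eq_image:
  "{R \<in> regions n a b. bounded_region n R} = region_cell ` {P \<in> Pow E. bounded_cell {} P (E - P)}"
proof (intro equalityI subsetI)
  fix R assume R: "R \<in> {R \<in> regions n a b. bounded_region n R}"
  then obtain x where x: "x \<in> arr_complement n a b" "R = region_cell (positive_edges x)"
    unfolding regions_def using region_eq_region_cell by auto
  have posE: "positive_edges x \<subseteq> E" by (auto simp: positive_edges_def)
  have "x \<in> R"
    using in_region_cell_iff[OF posE] x by simp
  then have "bounded_cell {} (positive_edges x) (E - positive_edges x)"
    using bounded_cell_iff_bounded_region[OF posE] R x(2) by blast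
  then show "R \<in> region_cell ` {P \<in> Pow E. bounded_cell {} P (E - P)}"
    using x(2) posE by blast
next
  fix R assume "R \<in> region_cell ` {P \<in> Pow E. bounded_cell {} P (E - P)}"
  then obtain P where P: "P \<subseteq> E" "R = region_cell P" "bounded_cell {} P (E - P)" by blast
  then obtain x where "x \<in> R" and bounded: "bounded_region n R"
    using bounded_cell_iff_bounded_region by blast
  then have "x \<in> arr_complement n a b" "R = connected_component_set (arr_complement n a b) x"
    using in_region_cell_iff[OF P(1)] P(2) region_eq_region_cell by auto
  then show "R \<in> {R \<in> regions n a b. bounded_region n R}"
    using bounded unfolding regions_def by blast
qed

end

theorem (in ordered_gain_graph) card_bounded_regions:
  "card {R \<in> regions n a b. bounded_region n R} =
      card {B. nbc_basis r n a b B \<and> activity r n a b B = 0}"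
proof -
  let ?G = "{P \<in> Pow E. bounded_cell {} P (E - P)}"
  have "inj_on region_cell ?G"
  proof (rule inj_onI)
    fix P Q assume P: "P \<in> ?G" and Q: "Q \<in> ?G" and eq: "region_cell P = region_cell Q"
    obtain x where "x \<in> region_cell P"
      using P bounded_cell_iff_bounded_region by blast
    then show "P = Q"
      using in_region_cell_iff[of P x] in_region_cell_iff[of Q x] eq P Q by simp
  qed
  then have "card {R \<in> regions n a b. bounded_region n R} = card ?G"
    by (simp add: bounded_regions_eq_image card_image)
  moreover have "count_bounded_cells {} E = int (card ?G)"
    by (simp add: count_bounded_cells_def Collect_conj_eq Int_commute Pow_def)
  ultimately show ?thesis
    using count_bounded_cells_eq_card_inactive_bases by simp
qed

theorem theorem4p3:
  fixes n k1 k2 \<alpha> :: nat and r :: "gedge \<Rightarrow> nat"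
  assumes "2 \<le> n" and "1 \<le> k1" and "\<alpha> \<le> n - 1"
    and "inj_on r (gain_edges n (1 - int k2) (int k1 + int k2))"
  shows "card {B. nbc_basis r n (1 - int k2) (int k1 + int k2) B \<and>
                  activity r n (1 - int k2) (int k1 + int k2) B = \<alpha>}
         = card {T. colored_rooted_tree n (k1 + k2) T \<and> non_increasing k1 T \<and>
                    num_root_edges_col1 n T = \<alpha>}
       \<and> card {R \<in> regions n (1 - int k2) (int k1 + int k2). bounded_region n R}
         = card {T. colored_rooted_tree n (k1 + k2) T \<and> non_increasing k1 T \<and>
                    num_root_edges_col1 n T = 0}"
proof -
  obtain m where n: "n = Suc m"
    using assms(1) by (cases n) auto
  interpret interval_gain_graph m k1 k2 r
    using assms(2,4) by unfold_locales (simp_all add: n)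
  show ?thesis
    unfolding n card_bounded_regions by (simp only: card_nbc_bases_eq_card_trees)
qed

end
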